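(* Let $X=(X_t)_{t\ge 0}$ be the piecewise deterministic Markov process on $(0,\infty)$ with generator $$\mathcal L f(x)=\tau(x)f'(x)+\beta(x)\int_0^1[f(xy)-f(x)]\,Q(x,dy).$$ Assume the following. (A1) The functions $\beta,\tau:(0,\infty)\to(0,\infty)$ are continuous and $\tau$ is locally Lipschitz; there are real constants $\gamma_0,\gamma_\infty,\nu_0,\nu_\infty$ and constants $\beta_0,\beta_\infty,\tau_0,\tau_\infty>0$ such that $\beta(x)\sim\beta_0x^{\gamma_0}$ and $\tau(x)\sim\tau_0x^{\nu_0}$ as $x\to0$, and $\beta(x)\sim\beta_\infty x^{\gamma_\infty}$ and $\tau(x)\sim\tau_\infty x^{\nu_\infty}$ as $x\to\infty$. (A2) There exist $a>0$ and $b>0$ such that $M(a)<1$ and $M(-b)<+\infty$, where $M(c):=\sup_{x>0}\int_0^1y^c\,Q(x,dy)$; moreover $Q(x,\{1\})=0$ for every $x>0$. Fix such $a$ and $b$. (A3) $\gamma_0>\nu_0-1$ and $\gamma_\infty>\nu_\infty-1$. Let $\pi$ be the stationary measure of $X$. If $$b\ge\nu_0-1,$$ then $$\int_0^1x^{\nu_0-1-b}\,\pi(dx)<+\infty.$$ Moreover, suppose in addition that the following holds. (D) (i) For every $x>0$, $Q(x,dy)=q(y)\,dy$ with a density $q$ not depending on $x$, and there exist constants $q_0,q_1\ge0$ and $\mu_0,\mu_1>-1$ such that $q(x)=q_0x^{\mu_0}+o(x^{\mu_0})$ as $x\to0$ and $q(x)=q_1(1-x)^{\mu_1}+o((1-x)^{\mu_1})$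 as $x\to1$. (ii) $\pi(dx)=G(x)\,dx$ is absolutely continuous with respect to Lebesgue measure, and there exist constants $G_0,G_\infty,\widetilde G_\infty>0$ and $\alpha_0,\alpha_\infty,\widetilde\alpha_\infty\in\mathbb R$ such that $G(x)\sim G_0x^{\alpha_0}$ as $x\to0$ and $G(x)\sim G_\infty x^{\alpha_\infty}\exp\left(-\widetilde G_\infty x^{\widetilde\alpha_\infty}\right)$ as $x\to+\infty$. If $\mu_0+2-\nu_0>0$, then $$\alpha_0\ge\mu_0+1-\nu_0.$$
   Context: Setting: $Q(x,dy)$, $x>0$, is a Markov kernel from $(0,\infty)$ to $[0,1]$ (each $Q(x,\cdot)$ is a probability measure). $X$ has càdlàg trajectories almost surely. Between jumps it follows the flow of $\dot y=\tau(y)$; it jumps at rate $\beta(X_t)$, and at a jump from position $x$ it moves to $xY$ with $Y$ distributed as $Q(x,\cdot)$. Under (A1), (A2), (A3) the process $X$ possesses a stationary measure $\pi$, unique up to a multiplicative constant; this is the measure $\pi$ in the statement. *)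

theory Defs
  imports "HOL-Probability.Probability" "HOL-Library.Landau_Symbols"
begin

text \<open>
  The state space is the open half-line; measures on it (and on the unit interval) are represented
  as Borel measures on the reals that are concentrated on the respective set.
\<close>

definition flow_solves :: "(real \<Rightarrow> real) \<Rightarrow> real \<Rightarrow> real \<Rightarrow> (real \<Rightarrow> real) \<Rightarrow> bool" where
  "flow_solves \<tau> x t y \<longleftrightarrow>
     y 0 = x \<and> (\<forall>s\<in>{0..t}. 0 < y s \<and> (y has_real_derivative \<tau> (y s)) (at s within {0..t}))"

text \<open>
  Solutions may blow up in finite time, so the flow is only meaningful where \<open>flow_defined\<close> holds.
\<close>

definition flow_defined :: "(real \<Rightarrow> real) \<Rightarrow> real \<Rightarrow> real \<Rightarrow> bool" where
  "flow_defined \<tau> x t \<longleftrightarrow> 0 \<le> t \<and> (\<exists>y. flow_solves \<tau> x t y)"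

definition flow :: "(real \<Rightarrow> real) \<Rightarrow> real \<Rightarrow> real \<Rightarrow> real" where
  "flow \<tau> x t = (THE v. \<exists>y. flow_solves \<tau> x t y \<and> v = y t)"

text \<open>
  Joint law of the waiting time \<open>t\<close> until the next jump and of the position after that jump, for a
  process that starts at \<open>x\<close>: the waiting time has hazard rate \<open>\<beta>\<close> along the flow, and the jump
  multiplies the current position by a random factor with law \<open>Q (flow \<tau> x t)\<close>.
\<close>

definition jump_kernel ::
  "(real \<Rightarrow> real) \<Rightarrow> (real \<Rightarrow> real) \<Rightarrow> (real \<Rightarrow> real measure) \<Rightarrow> real \<Rightarrow> (real \<times> real) set \<Rightarrow> ennreal" where
  "jump_kernel \<tau> \<beta> Q x A =
     (\<integral>\<^sup>+t\<in>{t. 0 < t \<and> flow_defined \<tau> x t}.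
        ennreal (\<beta> (flow \<tau> x t) * exp (- integral {0..t} (\<lambda>s. \<beta> (flow \<tau> x s))))
        * emeasure (Q (flow \<tau> x t)) {y. (t, flow \<tau> x t * y) \<in> A} \<partial>lborel)"

text \<open>
  The piecewise deterministic Markov process with generator
  \<open>f \<mapsto> (\<lambda>x. \<tau> x * f' x + \<beta> x * (\<integral>y. f (x * y) - f x \<partial>Q x))\<close>, given by its jump construction:
  \<open>T n\<close> are the jump times (\<open>T 0 = 0\<close>), \<open>Z n\<close> is the position at time \<open>T n\<close>. The last clause says
  that, conditionally on \<open>(T 0, Z 0), \<dots>, (T n, Z n)\<close>, the pair \<open>(T (n + 1) - T n, Z (n + 1))\<close> has law
  \<open>jump_kernel \<tau> \<beta> Q (Z n)\<close>; it is stated on the cylinder events, which form an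
  intersection-stable generator of the history up to the n-th jump.
\<close>

definition pdmp ::
  "(real \<Rightarrow> real) \<Rightarrow> (real \<Rightarrow> real) \<Rightarrow> (real \<Rightarrow> real measure) \<Rightarrow> 'w measure \<Rightarrow> (real \<Rightarrow> 'w \<Rightarrow> real) \<Rightarrow> bool" where
  "pdmp \<tau> \<beta> Q P X \<longleftrightarrow>
     prob_space P \<and>
     (\<forall>t\<ge>0. X t \<in> borel_measurable P) \<and>
     (\<exists>(T :: nat \<Rightarrow> 'w \<Rightarrow> real) (Z :: nat \<Rightarrow> 'w \<Rightarrow> real).
        (\<forall>n. T n \<in> borel_measurable P \<and> Z n \<in> borel_measurable P) \<and>
        (AE \<omega> in P. T 0 \<omega> = 0 \<and> (\<forall>n. T n \<omega> < T (Suc n) \<omega> \<and> 0 < Z n \<omega>) \<and>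
           filterlim (\<lambda>n. T n \<omega>) at_top sequentially) \<and>
        (AE \<omega> in P. \<forall>n. \<forall>t\<in>{T n \<omega>..<T (Suc n) \<omega>}. X t \<omega> = flow \<tau> (Z n \<omega>) (t - T n \<omega>)) \<and>
        (\<forall>n A B. (\<forall>k\<le>n. A k \<in> sets (borel \<Otimes>\<^sub>M borel)) \<longrightarrow> B \<in> sets (borel \<Otimes>\<^sub>M borel) \<longrightarrow>
           emeasure P {\<omega>\<in>space P. (\<forall>k\<le>n. (T k \<omega>, Z k \<omega>) \<in> A k) \<and>
                                   (T (Suc n) \<omega> - T n \<omega>, Z (Suc n) \<omega>) \<in> B}
           = (\<integral>\<^sup>+\<omega>\<in>{\<omega>\<in>space P. \<forall>k\<le>n. (T k \<omega>, Z k \<omega>) \<in> A k}. jump_kernel \<tau> \<beta> Q (Z n \<omega>) B \<partial>P)))"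

text \<open>The process started from every deterministic initial position \<open>x\<close>, under the law \<open>P x\<close>.\<close>

definition pdmp_family ::
  "(real \<Rightarrow> real) \<Rightarrow> (real \<Rightarrow> real) \<Rightarrow> (real \<Rightarrow> real measure) \<Rightarrow>
   (real \<Rightarrow> 'w measure) \<Rightarrow> (real \<Rightarrow> 'w \<Rightarrow> real) \<Rightarrow> bool" where
  "pdmp_family \<tau> \<beta> Q P X \<longleftrightarrow>
     (\<forall>x>0. pdmp \<tau> \<beta> Q (P x) X \<and> (AE \<omega> in P x. X 0 \<omega> = x)) \<and>
     (\<forall>t\<ge>0. \<forall>A\<in>sets borel. (\<lambda>x. emeasure (P x) {\<omega>\<in>space (P x). X t \<omega> \<in> A})
        \<in> borel_measurable (restrict_space borel {0<..}))"

text \<open>Stationary measures may have infinite total mass.\<close>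

definition stationary_measure ::
  "(real \<Rightarrow> 'w measure) \<Rightarrow> (real \<Rightarrow> 'w \<Rightarrow> real) \<Rightarrow> real measure \<Rightarrow> bool" where
  "stationary_measure P X \<pi> \<longleftrightarrow>
     sets \<pi> = sets borel \<and> sigma_finite_measure \<pi> \<and>
     emeasure \<pi> {..0} = 0 \<and> emeasure \<pi> {0<..} \<noteq> 0 \<and>
     (\<forall>t\<ge>0. \<forall>A\<in>sets borel.
        (\<integral>\<^sup>+x\<in>{0<..}. emeasure (P x) {\<omega>\<in>space (P x). X t \<omega> \<in> A} \<partial>\<pi>) = emeasure \<pi> A)"

text \<open>
  The power \<open>y\<^sup>c\<close> for \<open>y \<ge> 0\<close> with its correct value at the origin (\<open>0 powr c = 0\<close> for all \<open>c\<close>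
  would make an atom at \<open>0\<close> invisible to negative moments).
\<close>

definition epowr :: "real \<Rightarrow> real \<Rightarrow> ennreal" where
  "epowr y c = (if y = 0 then (if c < 0 then \<infinity> else if c = 0 then 1 else 0) else ennreal (y powr c))"

definition moment_sup :: "(real \<Rightarrow> real measure) \<Rightarrow> real \<Rightarrow> ennreal" where
  "moment_sup Q c = (SUP x\<in>{0<..}. \<integral>\<^sup>+y\<in>{0..1}. epowr y c \<partial>Q x)"

definition fragmentation_density ::
  "(real \<Rightarrow> real measure) \<Rightarrow> (real \<Rightarrow> real) \<Rightarrow> real \<Rightarrow> real \<Rightarrow> real \<Rightarrow> real \<Rightarrow> bool" where
  "fragmentation_density Q q q\<^sub>0 q\<^sub>1 \<mu>\<^sub>0 \<mu>\<^sub>1 \<longleftrightarrow>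
     q \<in> borel_measurable borel \<and> (\<forall>y\<in>{0<..<1}. 0 \<le> q y) \<and>
     (\<forall>x>0. Q x = density lborel (\<lambda>y. ennreal (q y) * indicator {0<..<1} y)) \<and>
     0 \<le> q\<^sub>0 \<and> 0 \<le> q\<^sub>1 \<and> -1 < \<mu>\<^sub>0 \<and> -1 < \<mu>\<^sub>1 \<and>
     (\<lambda>y. q y - q\<^sub>0 * y powr \<mu>\<^sub>0) \<in> o[at_right 0](\<lambda>y. y powr \<mu>\<^sub>0) \<and>
     (\<lambda>y. q y - q\<^sub>1 * (1 - y) powr \<mu>\<^sub>1) \<in> o[at_left 1](\<lambda>y. (1 - y) powr \<mu>\<^sub>1)"

text \<open>Parameters \<open>c\<close> and \<open>\<kappa>\<close> are the constant and the exponent inside the exponential.\<close>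

definition stationary_density ::
  "real measure \<Rightarrow> (real \<Rightarrow> real) \<Rightarrow> real \<Rightarrow> real \<Rightarrow> real \<Rightarrow> real \<Rightarrow> real \<Rightarrow> real \<Rightarrow> bool" where
  "stationary_density \<pi> G G\<^sub>0 \<alpha>\<^sub>0 G_inf \<alpha>_inf c \<kappa> \<longleftrightarrow>
     G \<in> borel_measurable borel \<and> (\<forall>x>0. 0 \<le> G x) \<and>
     \<pi> = density lborel (\<lambda>x. ennreal (G x) * indicator {0<..} x) \<and>
     0 < G\<^sub>0 \<and> 0 < G_inf \<and> 0 < c \<and>
     G \<sim>[at_right 0] (\<lambda>x. G\<^sub>0 * x powr \<alpha>\<^sub>0) \<and>
     G \<sim>[at_top] (\<lambda>x. G_inf * x powr \<alpha>_inf * exp (- c * x powr \<kappa>))"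

end

theory Submission
  imports Defs
begin

text \<open>
  Let \<open>V x = x\<^sup>-\<^sup>b + x\<^sup>a\<close>. The assumptions make \<open>\<L> V \<le> - c x\<^bsup>\<nu>\<^sub>0 - 1 - b\<^esup>\<close> near \<open>0\<close>, where the
  drift term \<open>- b \<tau> x\<^bsup>- b - 1\<^esup>\<close> dominates, and \<open>\<L> V \<le> 0\<close> near \<open>\<infinity>\<close>, where \<open>(M(a) - 1) \<beta> x\<^sup>a\<close> dominates.
  Summed over the jumps, the drift inequality holds for the resolvent \<open>R f x = E\<^sub>x (\<integral> e\<^sup>-\<^sup>t f (X\<^sub>t) dt)\<close>,
  a Markov kernel that preserves \<open>\<pi>\<close>; integrating it against \<open>\<pi>\<close> bounds the integral of
  \<open>x\<^bsup>\<nu>\<^sub>0 - 1 - b\<^esup>\<close> near \<open>0\<close> by a multiple of the mass of a compact interval. The statement on the exponent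
  \<open>\<alpha>\<^sub>0\<close> follows because, in presence of a density \<open>q\<close>, every \<open>b\<close> with \<open>0 < b < \<mu>\<^sub>0 + 1\<close> is admissible.
\<close>

section \<open>The flow in the coordinate that linearises it\<close>

text \<open>Only the jump construction of the process is available, so Dynkin's formula for the
  unbounded \<open>V\<close> has to be replaced. Its substitute is
  \<open>R (V + W) \<le> V + R k\<close> whenever \<open>W \<le> k - \<L> V\<close> pointwise; here
  \<open>k\<close> is constant on a compact interval and \<open>W\<close> is a multiple of the
  desired power near 0. It rests on the fundamental theorem of calculus along one flow segment,
  discounted at rate 1, and on telescoping over the jumps; only nonnegative terms occur, because the
  expectations may be infinite. Three obstacles shape the rest. The flow may reach infinity in
  finite time; that a jump comes before is extracted from the existence of the process. The
  transition law is measurable in the starting point for each fixed time only; joint measurability,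
  needed for Fubini, comes from the increasing right-continuous paths between jumps. The measure
  \<pi> is only \<sigma>-finite, so its local finiteness has to be derived. All flow computations
  use the travel time \<open>H\<close>, an antiderivative of \<open>1 / \<tau>\<close>, in which the
  flow is a translation.\<close>

locale flow_coord =
  fixes \<tau> H :: "real \<Rightarrow> real"
  assumes \<tau>_cont: "continuous_on {0<..} \<tau>"
    and \<tau>_pos: "0 < x \<Longrightarrow> 0 < \<tau> x"
    and H_deriv: "0 < x \<Longrightarrow> (H has_real_derivative inverse (\<tau> x)) (at x)"
    and H_nonpos: "x \<le> 0 \<Longrightarrow> H x = 0"
begin

lemma H_strict: "0 < x \<Longrightarrow> x < y \<Longrightarrow> H x < H y"
  by (rule DERIV_pos_imp_increasing[of x y H])
    (auto intro!: exI[of _ "inverse (\<tau> _)"] H_deriv \<tau>_pos)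

lemma H_less_iff: "0 < x \<Longrightarrow> 0 < y \<Longrightarrow> H x < H y \<longleftrightarrow> x < y"
  by (metis H_strict linorder_neqE_linordered_idom order_less_asym)

lemma H_le_iff: "0 < x \<Longrightarrow> 0 < y \<Longrightarrow> H x \<le> H y \<longleftrightarrow> x \<le> y"
  by (meson H_less_iff linorder_not_le)

lemma H_inj: "0 < x \<Longrightarrow> 0 < y \<Longrightarrow> H x = H y \<Longrightarrow> x = y"
  by (metis H_less_iff linorder_neqE_linordered_idom order_less_irrefl)

lemma H_isCont: "0 < x \<Longrightarrow> isCont H x"
  using H_deriv DERIV_isCont by blast

text \<open>\<open>H\<close> is continuous on the half-line only; the normalisation
  \<open>H_nonpos\<close> turns it into a Borel function on all reals.\<close>

lemma measurable_H[measurable]: "H \<in> borel_measurable borel"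
proof -
  have "(\<lambda>x. indicator {0<..} x *\<^sub>R H x) \<in> borel_measurable borel"
    by (rule borel_measurable_continuous_on_indicator)
      (auto intro!: continuous_at_imp_continuous_on H_isCont)
  also have "(\<lambda>x. indicator {0<..} x *\<^sub>R H x) = H"
    using H_nonpos by (force simp: indicator_def not_less)
  finally show ?thesis .
qed

lemma H_ivt:
  assumes "0 < x" "H x \<le> u" "u \<le> H y" "0 < y"
  obtains z where "x \<le> z" "z \<le> y" "H z = u"
proof -
  have "x \<le> y" using assms H_le_iff[of x y] by linarith
  then have "\<exists>z\<ge>x. z \<le> y \<and> H z = u"
    by (intro IVT) (use assms H_isCont in auto)
  with that show ?thesis by blast
qed

definition Hinv :: "real \<Rightarrow> real" where
  "Hinv u = (THE y. 0 < y \<and> H y = u)"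

lemma Hinv_H: "0 < y \<Longrightarrow> Hinv (H y) = y"
  unfolding Hinv_def by (rule the_equality) (use H_inj in auto)

lemma Hinv_isCont:
  assumes "0 < y" shows "isCont Hinv (H y)"
  by (rule isCont_inverse_function2[of "y/2" y "y+1"])
    (use assms in \<open>auto intro!: Hinv_H H_isCont\<close>)

text \<open>As \<open>H\<close> has derivative \<open>1 / \<tau>\<close>, its inverse moves with
  velocity \<open>\<tau>\<close>; this produces the solutions of the flow equation.\<close>

lemma Hinv_deriv:
  assumes y: "0 < y" shows "(Hinv has_real_derivative \<tau> y) (at (H y))"
proof -
  have "(Hinv has_real_derivative inverse (inverse (\<tau> y))) (at (H y))"
  proof (rule DERIV_inverse_function[where a="H (y/2)" and b="H (y+1)"])
    show "(H has_real_derivative inverse (\<tau> y)) (at (Hinv (H y)))"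
      using H_deriv[OF y] Hinv_H[OF y] by simp
    show "inverse (\<tau> y) \<noteq> 0" using \<tau>_pos[OF y] by simp
    show "H (y/2) < H y" "H y < H (y+1)" using y by (auto intro!: H_strict)
    show "isCont Hinv (H y)" using y by (rule Hinv_isCont)
    fix u assume "H (y/2) < u" "u < H (y+1)"
    then obtain z where "y/2 \<le> z" "H z = u"
      using H_ivt[of "y/2" u "y+1"] y by auto
    then show "H (Hinv u) = u" using y Hinv_H[of z] by auto
  qed
  then show ?thesis using \<tau>_pos[OF y] by simp
qed

text \<open>The flow from \<open>z\<close> is translation by \<open>t\<close> in the coordinate
  \<open>H\<close>, so it lasts until \<open>t\<close> exactly when \<open>H z + t\<close> is still
  a value of \<open>H\<close>. A finite blow-up time means that \<open>H\<close> is bounded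
  above.\<close>

definition fdom :: "real \<Rightarrow> real \<Rightarrow> bool" where
  "fdom z t \<longleftrightarrow> 0 < z \<and> 0 \<le> t \<and> (\<exists>y>0. H y = H z + t)"

text \<open>The value \<open>1\<close> outside the domain keeps \<open>\<phi>\<close> inside the half-line where \<open>\<beta>\<close> and \<open>Q\<close> live.\<close>

definition \<phi> :: "real \<Rightarrow> real \<Rightarrow> real" where
  "\<phi> z t = (if fdom z t then Hinv (H z + t) else 1)"

lemma H_\<phi>: "fdom z t \<Longrightarrow> H (\<phi> z t) = H z + t"
  unfolding \<phi>_def fdom_def using Hinv_H by (auto, metis)

lemma \<phi>_pos[simp]: "0 < \<phi> z t"
  unfolding \<phi>_def fdom_def using Hinv_H by (auto, metis)

lemma \<phi>_eqI: "0 < z \<Longrightarrow> 0 \<le> t \<Longrightarrow> 0 < y \<Longrightarrow> H y = H z + t \<Longrightarrow> fdom z t \<and> \<phi> z t = y"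
  unfolding \<phi>_def fdom_def using Hinv_H by metis

lemma fdom_0[simp]: "0 < z \<Longrightarrow> fdom z 0" and \<phi>_0[simp]: "0 < z \<Longrightarrow> \<phi> z 0 = z"
  using \<phi>_eqI[of z 0 z] by auto

lemma fdom_pos: "fdom z t \<Longrightarrow> 0 < z" "fdom z t \<Longrightarrow> 0 \<le> t"
  by (auto simp: fdom_def)

text \<open>By monotonicity and the intermediate value theorem, a number above \<open>H z\<close> is
  a value of \<open>H\<close> as soon as it lies below some \<open>H n\<close>. This countable form
  gives measurability of the domain and later its exhaustion by compact time intervals.\<close>

lemma fdom_iff: "fdom z t \<longleftrightarrow> 0 < z \<and> 0 \<le> t \<and> (\<exists>n::nat. 0 < n \<and> H z + t \<le> H (real n))"
proof safe
  assume D: "fdom z t"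
  obtain n :: nat where n: "\<phi> z t < real n" using reals_Archimedean2 by blast
  have "0 < \<phi> z t" by simp
  with n have "0 < real n" by linarith
  with n H_strict[of "\<phi> z t" "real n"] H_\<phi>[OF D]
  show "\<exists>n::nat. 0 < n \<and> H z + t \<le> H (real n)" by (intro exI[of _ n]) auto
next
  fix n :: nat assume *: "0 < z" "0 \<le> t" "0 < n" "H z + t \<le> H (real n)"
  then obtain y where "z \<le> y" "H y = H z + t" using H_ivt[of z "H z + t" "real n"] by auto
  with * show "fdom z t" unfolding fdom_def by (intro conjI exI[of _ y]) auto
qed (auto simp: fdom_def)

lemma fdom_mono: "fdom z t \<Longrightarrow> 0 \<le> s \<Longrightarrow> s \<le> t \<Longrightarrow> fdom z s"
  unfolding fdom_iff by force

lemma \<phi>_ge: "fdom z t \<Longrightarrow> z \<le> \<phi> z t"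
  using H_\<phi>[of z t] fdom_pos[of z t] H_le_iff[of z "\<phi> z t"] by simp

lemma \<phi>_le_iff: "fdom z t \<Longrightarrow> \<phi> z t \<le> c \<longleftrightarrow> 0 < c \<and> H z + t \<le> H c"
  using H_\<phi>[of z t] H_le_iff[of "\<phi> z t" c] \<phi>_pos[of z t] by (metis order_less_le_trans)

lemma measurable_fdom[measurable]: "Measurable.pred (borel \<Otimes>\<^sub>M borel) (\<lambda>p. fdom (fst p) (snd p))"
  unfolding fdom_iff by measurable

text \<open>Sublevel sets of \<open>\<phi>\<close> are expressed by \<open>\<phi>_le_iff\<close>
  through \<open>fdom\<close> and \<open>H\<close>, both measurable; off the domain the default
  value 1 decides.\<close>

lemma measurable_\<phi>': "(\<lambda>p. \<phi> (fst p) (snd p)) \<in> borel_measurable (borel \<Otimes>\<^sub>M borel)"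
proof (rule borel_measurableI_le)
  fix c :: real
  have "{p \<in> space (borel \<Otimes>\<^sub>M borel). \<phi> (fst p) (snd p) \<le> c} =
      {p \<in> space (borel \<Otimes>\<^sub>M borel). if fdom (fst p) (snd p)
         then 0 < c \<and> H (fst p) + snd p \<le> H c else 1 \<le> c}"
    using \<phi>_le_iff by (auto simp: \<phi>_def)
  also have "\<dots> \<in> sets (borel \<Otimes>\<^sub>M borel)" by measurable
  finally show "{p \<in> space (borel \<Otimes>\<^sub>M borel). \<phi> (fst p) (snd p) \<le> c} \<in> sets (borel \<Otimes>\<^sub>M borel)" .
qed

lemma measurable_\<phi>[measurable]:
  "f \<in> borel_measurable M \<Longrightarrow> g \<in> borel_measurable M \<Longrightarrow> (\<lambda>x. \<phi> (f x) (g x)) \<in> borel_measurable M"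
  using measurable_compose[OF measurable_Pair measurable_\<phi>', of f M g] by simp

lemma \<phi>_deriv:
  assumes "fdom z t" "s \<in> {0..t}"
  shows "(\<phi> z has_real_derivative \<tau> (\<phi> z s)) (at s within {0..t})"
proof -
  have D: "fdom z r" if "r \<in> {0..t}" for r using fdom_mono[OF assms(1)] that by auto
  have "((\<lambda>r. Hinv (H z + r)) has_real_derivative \<tau> (\<phi> z s) * 1) (at s within {0..t})"
    by (rule DERIV_chain2[where f=Hinv])
      (auto intro!: derivative_eq_intros Hinv_deriv simp flip: H_\<phi>[OF D[OF assms(2)]])
  then have "((\<lambda>r. Hinv (H z + r)) has_real_derivative \<tau> (\<phi> z s)) (at s within {0..t})" by simp
  then show ?thesis
    by (rule has_field_derivative_transform_within[OF _ zero_less_one assms(2)])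
      (use D in \<open>auto simp: \<phi>_def\<close>)
qed

lemma flow_solves_\<phi>: "fdom z t \<Longrightarrow> flow_solves \<tau> z t (\<phi> z)"
  unfolding flow_solves_def using \<phi>_deriv fdom_pos by auto

text \<open>Along any solution \<open>y\<close>, the derivative of \<open>H (y s) - s\<close> is
  \<open>inverse (\<tau> (y s)) * \<tau> (y s) - 1\<close>, which is 0. Constancy gives uniqueness
  and also shows that a solution up to \<open>t\<close> forces \<open>fdom z t\<close>.\<close>

lemma flow_solves_imp:
  assumes z: "0 < z" and t: "0 \<le> t" and y: "flow_solves \<tau> z t y"
  shows "fdom z t \<and> y t = \<phi> z t"
proof -
  have y0: "y 0 = z" and yp: "\<And>s. s \<in> {0..t} \<Longrightarrow> 0 < y s"
    and yd: "\<And>s. s \<in> {0..t} \<Longrightarrow> (y has_real_derivative \<tau> (y s)) (at s within {0..t})"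
    using y by (auto simp: flow_solves_def)
  have "((\<lambda>s. H (y s) - s) has_real_derivative 0) (at s within {0..t})" if "s \<in> {0..t}" for s
  proof -
    have "((\<lambda>s. H (y s) - s) has_real_derivative inverse (\<tau> (y s)) * \<tau> (y s) - 1) (at s within {0..t})"
      by (intro derivative_intros DERIV_chain2[where f=H] H_deriv yp yd that)
    then show ?thesis using \<tau>_pos[OF yp[OF that]] by simp
  qed
  then have "\<exists>c. \<forall>s\<in>{0..t}. H (y s) - s = c"
    by (intro has_field_derivative_zero_constant) auto
  then have "H (y t) - t = H (y 0) - 0" using t by (metis atLeastAtMost_iff order_refl)
  then show ?thesis using \<phi>_eqI[of z t "y t"] z t yp[of t] y0 by auto
qed

lemma flow_defined_iff: "0 < z \<Longrightarrow> flow_defined \<tau> z t \<longleftrightarrow> fdom z t"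
  unfolding flow_defined_def using flow_solves_imp flow_solves_\<phi> fdom_pos by blast

lemma flow_eq: "fdom z t \<Longrightarrow> flow \<tau> z t = \<phi> z t"
  unfolding flow_def
  by (rule the_equality) (use flow_solves_imp flow_solves_\<phi> fdom_pos in blast)+

lemma \<phi>_continuous: "fdom z t \<Longrightarrow> continuous_on {0..t} (\<phi> z)"
  using \<phi>_deriv by (intro DERIV_continuous_on) auto

end

section \<open>The jump kernel\<close>

text \<open>Here \<open>f\<close> may change sign and \<open>k\<close> is merely bounded and
  measurable, so the sum is handled by set integrals and converted to \<open>ennreal\<close> at the
  end. The boundary values stand on opposite sides, as nonnegative terms, to avoid
  subtraction.\<close>

lemma nn_integral_FTC_perturbed:
  fixes F f k :: "real \<Rightarrow> real"
  assumes u: "0 \<le> u"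
    and F: "\<And>s. s \<in> {0..u} \<Longrightarrow> (F has_real_derivative f s) (at s within {0..u})"
    and f: "continuous_on {0..u} f"
    and k[measurable]: "k \<in> borel_measurable borel" and k_bd: "\<And>s. s \<in> {0..u} \<Longrightarrow> 0 \<le> k s \<and> k s \<le> c"
    and nonneg: "\<And>s. s \<in> {0..u} \<Longrightarrow> 0 \<le> f s + k s"
    and F_nonpos: "F 0 \<le> 0" "F u \<le> 0"
  shows "(\<integral>\<^sup>+s\<in>{0..u}. ennreal (f s + k s) \<partial>lborel) + ennreal (- F u)
    = ennreal (- F 0) + (\<integral>\<^sup>+s\<in>{0..u}. ennreal (k s) \<partial>lborel)"
proof -
  have fi: "set_integrable lborel {0..u} f" using f by (rule borel_integrable_atLeastAtMost')
  have ki: "set_integrable lborel {0..u} k"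
    unfolding set_integrable_def
    by (rule integrableI_bounded_set_indicator[where B=c]) (use k_bd u in \<open>auto intro!: AE_I2\<close>)
  have f_eq: "(LBINT s:{0..u}. f s) = F u - F 0"
    unfolding set_lebesgue_integral_def
    using integral_FTC_atLeastAtMost[OF u _ f, of F] F
    by (auto simp: has_real_derivative_iff_has_vector_derivative)
  have nn: "(\<integral>\<^sup>+s\<in>{0..u}. ennreal (g s) \<partial>lborel) = ennreal (LBINT s:{0..u}. g s)"
    if "set_integrable lborel {0..u} g" "\<And>s. s \<in> {0..u} \<Longrightarrow> 0 \<le> g s" for g
  proof -
    have "(\<integral>\<^sup>+s\<in>{0..u}. ennreal (g s) \<partial>lborel) = (\<integral>\<^sup>+s. ennreal (indicator {0..u} s *\<^sub>R g s) \<partial>lborel)"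
      by (intro nn_integral_cong) (auto simp: indicator_def)
    also have "\<dots> = ennreal (LBINT s:{0..u}. g s)"
      unfolding set_lebesgue_integral_def
      by (rule nn_integral_eq_integral)
        (use that in \<open>auto simp: set_integrable_def indicator_def intro!: AE_I2\<close>)
    finally show ?thesis .
  qed
  have "(LBINT s:{0..u}. f s + k s) = F u - F 0 + (LBINT s:{0..u}. k s)"
    using set_integral_add(2)[OF fi ki] f_eq by simp
  moreover have "0 \<le> (LBINT s:{0..u}. f s + k s)" "0 \<le> (LBINT s:{0..u}. k s)"
    unfolding set_lebesgue_integral_def
    by (auto intro!: integral_nonneg_AE AE_I2 simp: indicator_def nonneg k_bd)
  ultimately show ?thesis
    using nn[OF set_integral_add(1)[OF fi ki] nonneg] nn[OF ki] k_bd F_nonpos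
    by (auto simp flip: ennreal_plus)
qed

section \<open>Survival probability and law of the first jump\<close>

locale pdmp_coord = flow_coord +
  fixes \<beta> B :: "real \<Rightarrow> real" and Q :: "real \<Rightarrow> real measure"
  assumes \<beta>_cont: "continuous_on {0<..} \<beta>"
    and \<beta>_pos: "0 < x \<Longrightarrow> 0 < \<beta> x"
    and B_deriv: "0 < x \<Longrightarrow> (B has_real_derivative \<beta> x / \<tau> x) (at x)"
    and B_nonpos: "x \<le> 0 \<Longrightarrow> B x = 0"
    and Q_kernel: "Q \<in> restrict_space borel {0<..} \<rightarrow>\<^sub>M prob_algebra borel"
begin

lemma B_isCont: "0 < x \<Longrightarrow> isCont B x"
  using B_deriv DERIV_isCont by blast

lemma measurable_B[measurable]: "B \<in> borel_measurable borel"
proof -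
  have "(\<lambda>x. indicator {0<..} x *\<^sub>R B x) \<in> borel_measurable borel"
    by (rule borel_measurable_continuous_on_indicator)
      (auto intro!: continuous_at_imp_continuous_on B_isCont)
  also have "(\<lambda>x. indicator {0<..} x *\<^sub>R B x) = B"
    using B_nonpos by (force simp: indicator_def not_less)
  finally show ?thesis .
qed

lemma prob_Q: "0 < x \<Longrightarrow> prob_space (Q x)"
  and sets_Q: "0 < x \<Longrightarrow> sets (Q x) = sets borel"
  using measurable_space[OF Q_kernel, of x] by (auto simp: space_prob_algebra)

lemma measurable_\<phi>_pos:
  assumes [measurable]: "f \<in> borel_measurable M" "g \<in> borel_measurable M"
  shows "(\<lambda>x. \<phi> (f x) (g x)) \<in> M \<rightarrow>\<^sub>M restrict_space borel {0<..}"
  by (rule measurable_restrict_space2) auto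

lemma measurable_\<beta>\<phi>[measurable]:
  "f \<in> borel_measurable M \<Longrightarrow> g \<in> borel_measurable M \<Longrightarrow> (\<lambda>x. \<beta> (\<phi> (f x) (g x))) \<in> borel_measurable M"
  using measurable_compose[OF measurable_\<phi>_pos borel_measurable_continuous_on_restrict[OF \<beta>_cont]] .

lemma measurable_Q\<phi>[measurable]:
  "f \<in> borel_measurable M \<Longrightarrow> g \<in> borel_measurable M \<Longrightarrow> (\<lambda>x. Q (\<phi> (f x) (g x))) \<in> M \<rightarrow>\<^sub>M subprob_algebra borel"
  using measurable_compose[OF measurable_\<phi>_pos measurable_prob_algebraD[OF Q_kernel]] .

text \<open>The probability of no jump up to time \<open>t\<close>: since \<open>B\<close> is an
  antiderivative of \<open>\<beta> / \<tau>\<close>, the hazard accumulated along the flow is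
  \<open>B (\<phi> z t) - B z\<close>, a function of the end points alone.\<close>

definition surv :: "real \<Rightarrow> real \<Rightarrow> real" where
  "surv z t = exp (B z - B (\<phi> z t))"

lemma surv_pos[simp]: "0 < surv z t" and surv_nonneg[simp]: "0 \<le> surv z t"
  by (simp_all add: surv_def)

lemma surv_0[simp]: "0 < z \<Longrightarrow> surv z 0 = 1"
  by (simp add: surv_def)

lemma measurable_surv[measurable]:
  assumes [measurable]: "f \<in> borel_measurable M" "g \<in> borel_measurable M"
  shows "(\<lambda>x. surv (f x) (g x)) \<in> borel_measurable M"
  unfolding surv_def by measurable

lemma B_\<phi>_deriv:
  assumes "fdom z t" "s \<in> {0..t}"
  shows "((\<lambda>s. B (\<phi> z s)) has_real_derivative \<beta> (\<phi> z s)) (at s within {0..t})"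
proof -
  have "((\<lambda>s. B (\<phi> z s)) has_real_derivative \<beta> (\<phi> z s) / \<tau> (\<phi> z s) * \<tau> (\<phi> z s)) (at s within {0..t})"
    by (intro DERIV_chain2[where f=B] B_deriv \<phi>_deriv assms) simp
  then show ?thesis using \<tau>_pos[of "\<phi> z s"] by simp
qed

lemma surv_deriv:
  assumes "fdom z t" "s \<in> {0..t}"
  shows "(surv z has_real_derivative - \<beta> (\<phi> z s) * surv z s) (at s within {0..t})"
proof -
  have "((\<lambda>s. exp (B z - B (\<phi> z s))) has_real_derivative exp (B z - B (\<phi> z s)) * (0 - \<beta> (\<phi> z s)))
      (at s within {0..t})"
    by (intro DERIV_chain2[OF DERIV_exp] DERIV_diff DERIV_const B_\<phi>_deriv assms)
  then show ?thesis by (simp add: surv_def[abs_def] mult.commute)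
qed

lemma integral_\<beta>:
  assumes "fdom z t"
  shows "integral {0..t} (\<lambda>s. \<beta> (flow \<tau> z s)) = B (\<phi> z t) - B z"
proof -
  have "((\<lambda>s. \<beta> (flow \<tau> z s)) has_integral B (\<phi> z t) - B (\<phi> z 0)) {0..t}"
  proof (rule fundamental_theorem_of_calculus)
    fix s assume s: "s \<in> {0..t}"
    then have "fdom z s" using fdom_mono[OF assms] by auto
    then show "((\<lambda>s. B (\<phi> z s)) has_vector_derivative \<beta> (flow \<tau> z s)) (at s within {0..t})"
      using B_\<phi>_deriv[OF assms s]
      by (simp add: flow_eq has_real_derivative_iff_has_vector_derivative)
  qed (use fdom_pos[OF assms] in auto)
  then show ?thesis using fdom_pos[OF assms] by (simp add: integral_unique)
qed

definition jump_density :: "real \<Rightarrow> real \<Rightarrow> ennreal" where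
  "jump_density z t = indicator {t. 0 < t \<and> fdom z t} t * ennreal (\<beta> (\<phi> z t) * surv z t)"

lemma measurable_jump_density[measurable]:
  assumes [measurable]: "f \<in> borel_measurable M" "g \<in> borel_measurable M"
  shows "(\<lambda>x. jump_density (f x) (g x)) \<in> borel_measurable M"
proof -
  have [measurable]: "Measurable.pred M (\<lambda>x. fdom (f x) (g x))"
    using measurable_compose[OF measurable_Pair measurable_fdom, of f M g] by simp
  have "(\<lambda>x. jump_density (f x) (g x)) =
    (\<lambda>x. if 0 < g x \<and> fdom (f x) (g x) then ennreal (\<beta> (\<phi> (f x) (g x)) * surv (f x) (g x)) else 0)"
    by (auto simp: jump_density_def)
  also have "\<dots> \<in> borel_measurable M" by measurable
  finally show ?thesis .
qed

text \<open>Integration against \<open>jump_kernel\<close>, which is given only as a set function;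
  \<open>jump_kernel_eq\<close> identifies the two on indicators.\<close>

definition jump_integral :: "(real \<times> real \<Rightarrow> ennreal) \<Rightarrow> real \<Rightarrow> ennreal" where
  "jump_integral h z = (\<integral>\<^sup>+t. jump_density z t * (\<integral>\<^sup>+y. h (t, \<phi> z t * y) \<partial>Q (\<phi> z t)) \<partial>lborel)"

lemma measurable_jump_inner[measurable]:
  assumes [measurable]: "h \<in> borel_measurable (borel \<Otimes>\<^sub>M borel)"
    "f \<in> borel_measurable M" "g \<in> borel_measurable M"
  shows "(\<lambda>x. \<integral>\<^sup>+y. h (g x, \<phi> (f x) (g x) * y) \<partial>Q (\<phi> (f x) (g x))) \<in> borel_measurable M"
  by (rule nn_integral_measurable_subprob_algebra2[where N=borel]) measurable

lemma measurable_jump_integral[measurable]: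
  assumes [measurable]: "h \<in> borel_measurable (borel \<Otimes>\<^sub>M borel)"
  shows "jump_integral h \<in> borel_measurable borel"
  unfolding jump_integral_def[abs_def] by measurable

lemma jump_kernel_eq:
  assumes z: "0 < z" and A: "A \<in> sets (borel \<Otimes>\<^sub>M borel)"
  shows "jump_kernel \<tau> \<beta> Q z A = jump_integral (indicator A) z"
  unfolding jump_kernel_def jump_integral_def
proof (rule nn_integral_cong)
  fix t :: real
  have eq: "emeasure (Q (\<phi> z t)) {y. (t, \<phi> z t * y) \<in> A} = (\<integral>\<^sup>+y. indicator A (t, \<phi> z t * y) \<partial>Q (\<phi> z t))"
  proof -
    have "{y. (t, \<phi> z t * y) \<in> A} = (\<lambda>y. (t, \<phi> z t * y)) -` A \<inter> space borel" by auto
    also have "\<dots> \<in> sets borel" by (rule measurable_sets[OF _ A]) measurable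
    finally have "{y. (t, \<phi> z t * y) \<in> A} \<in> sets (Q (\<phi> z t))" by (simp add: sets_Q)
    moreover have "(\<lambda>y. indicator A (t, \<phi> z t * y) :: ennreal) = indicator {y. (t, \<phi> z t * y) \<in> A}"
      by (auto simp: indicator_def)
    ultimately show ?thesis by simp
  qed
  show "ennreal (\<beta> (flow \<tau> z t) * exp (- integral {0..t} (\<lambda>s. \<beta> (flow \<tau> z s)))) *
      emeasure (Q (flow \<tau> z t)) {y. (t, flow \<tau> z t * y) \<in> A} *
      indicator {t. 0 < t \<and> flow_defined \<tau> z t} t =
      jump_density z t * (\<integral>\<^sup>+y. indicator A (t, \<phi> z t * y) \<partial>Q (\<phi> z t))"
  proof (cases "0 < t \<and> fdom z t")
    case True
    then have D: "fdom z t" by simp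
    show ?thesis
      unfolding jump_density_def surv_def integral_\<beta>[OF D] flow_eq[OF D] eq
      using True by (simp add: flow_defined_iff[OF z] mult.commute)
  next
    case False
    then show ?thesis by (simp add: jump_density_def flow_defined_iff[OF z])
  qed
qed

lemma jump_integral_time:
  assumes [measurable]: "T \<in> sets borel"
  shows "jump_integral (indicator (T \<times> UNIV)) z = (\<integral>\<^sup>+t\<in>T. jump_density z t \<partial>lborel)"
proof -
  have "(\<integral>\<^sup>+y. indicator (T \<times> UNIV) (t, \<phi> z t * y) \<partial>Q (\<phi> z t)) = indicator T t" for t
    using prob_space.emeasure_space_1[OF prob_Q[of "\<phi> z t"]]
    by (simp add: indicator_times)
  then show ?thesis unfolding jump_integral_def by simp
qed

text \<open>\<open>\<beta> * surv\<close> along the flow is minus the derivative of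
  \<open>surv\<close>. Total mass 1 over the whole domain does not follow, since the survival
  probability may keep a positive limit at a finite blow-up time.\<close>

lemma jump_before:
  assumes D: "fdom z s"
  shows "(\<integral>\<^sup>+t\<in>{..s}. jump_density z t \<partial>lborel) + ennreal (surv z s) = 1"
proof -
  have s0: "0 \<le> s" and z: "0 < z" using fdom_pos[OF D] by auto
  \<comment> \<open>The two integrands differ at \<open>t = 0\<close>, where
    \<open>jump_density\<close> is 0, so they are compared almost everywhere.\<close>
  have 1: "(\<integral>\<^sup>+t\<in>{..s}. jump_density z t \<partial>lborel) = (\<integral>\<^sup>+t\<in>{0..s}. ennreal (\<beta> (\<phi> z t) * surv z t + 0) \<partial>lborel)"
    using AE_lborel_singleton[of 0]
  proof (intro nn_integral_cong_AE, eventually_elim)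
    fix t :: real assume "t \<noteq> 0"
    then show "jump_density z t * indicator {..s} t =
        ennreal (\<beta> (\<phi> z t) * surv z t + 0) * indicator {0..s} t"
      using fdom_mono[OF D, of t] fdom_pos[of z t]
      by (cases "0 < t \<and> t \<le> s") (auto simp: jump_density_def)
  qed
  have 2: "(\<integral>\<^sup>+t\<in>{0..s}. ennreal (\<beta> (\<phi> z t) * surv z t + 0) \<partial>lborel) + ennreal (- (- surv z s)) = ennreal (- (- surv z 0)) + (\<integral>\<^sup>+t\<in>{0..s}. ennreal 0 \<partial>lborel)"
  proof (rule nn_integral_FTC_perturbed[where c=0 and F="\<lambda>t. - surv z t" and k="\<lambda>_. 0", OF s0])
    fix t assume "t \<in> {0..s}"
    from DERIV_minus[OF surv_deriv[OF D this]]
    show "((\<lambda>t. - surv z t) has_real_derivative \<beta> (\<phi> z t) * surv z t) (at t within {0..s})" by simp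
  next
    have "continuous_on {0..s} (surv z)"
      by (rule DERIV_continuous_on[OF surv_deriv[OF D]])
    then show "continuous_on {0..s} (\<lambda>t. \<beta> (\<phi> z t) * surv z t)"
      by (intro continuous_on_mult continuous_on_compose2[OF \<beta>_cont \<phi>_continuous[OF D]]) auto
  next
    show "0 \<le> \<beta> (\<phi> z t) * surv z t + 0" for t using \<beta>_pos[of "\<phi> z t"] by simp
  qed auto
  show ?thesis using 2 z unfolding 1 by simp
qed

text \<open>This is the complement of \<open>jump_before\<close> within total mass 1. The mass is a
  hypothesis because it can fail for an explosive flow; the existence of the process supplies it
  later, in \<open>jump_density_total\<close>.\<close>

lemma jump_after:
  assumes z: "0 < z" and total: "(\<integral>\<^sup>+t. jump_density z t \<partial>lborel) = 1" and s: "0 \<le> s"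
  shows "(\<integral>\<^sup>+t\<in>{s<..}. jump_density z t \<partial>lborel) = (if fdom z s then ennreal (surv z s) else 0)"
proof (cases "fdom z s")
  case True
  have "(\<integral>\<^sup>+t. jump_density z t \<partial>lborel) =
      (\<integral>\<^sup>+t. jump_density z t * indicator {..s} t + jump_density z t * indicator {s<..} t \<partial>lborel)"
    by (intro nn_integral_cong) (auto simp: indicator_def)
  also have "\<dots> = (\<integral>\<^sup>+t\<in>{..s}. jump_density z t \<partial>lborel) + (\<integral>\<^sup>+t\<in>{s<..}. jump_density z t \<partial>lborel)"
    by (rule nn_integral_add) measurable
  finally have "(\<integral>\<^sup>+t\<in>{..s}. jump_density z t \<partial>lborel) + (\<integral>\<^sup>+t\<in>{s<..}. jump_density z t \<partial>lborel)
      = (\<integral>\<^sup>+t\<in>{..s}. jump_density z t \<partial>lborel) + ennreal (surv z s)"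
    using total jump_before[OF True] by simp
  moreover have "(\<integral>\<^sup>+t\<in>{..s}. jump_density z t \<partial>lborel) \<noteq> \<infinity>"
    using jump_before[OF True] by (metis ennreal_add_eq_top ennreal_one_neq_top infinity_ennreal_def)
  ultimately show ?thesis using True by (simp add: ennreal_add_left_cancel)
next
  case False
  have "(\<integral>\<^sup>+t\<in>{s<..}. jump_density z t \<partial>lborel) = (\<integral>\<^sup>+t. 0 \<partial>(lborel :: real measure))"
    by (rule nn_integral_cong)
      (use False fdom_mono[of z _ s] s in \<open>force simp: jump_density_def indicator_def\<close>)
  then show ?thesis using False by simp
qed

text \<open>Expected integral of \<open>exp (- s) * f\<close> along the path up to the first jump,
  with \<open>surv z s\<close> in place of the event that no jump has occurred yet. The resolvent
  will be a sum of such terms over the jumps.\<close>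

definition discounted :: "(real \<Rightarrow> ennreal) \<Rightarrow> real \<Rightarrow> ennreal" where
  "discounted f z = (\<integral>\<^sup>+s\<in>{s. fdom z s}. ennreal (exp (- s)) * ennreal (surv z s) * f (\<phi> z s) \<partial>lborel)"

lemma measurable_fdom2[measurable]:
  assumes [measurable]: "f \<in> borel_measurable M" "g \<in> borel_measurable M"
  shows "Measurable.pred M (\<lambda>x. fdom (f x) (g x))"
  using measurable_compose[OF measurable_Pair measurable_fdom, of f M g] by simp

lemma borel_measurable_Q: "0 < x \<Longrightarrow> f \<in> borel_measurable borel \<Longrightarrow> f \<in> borel_measurable (Q x)"
  using measurable_cong_sets[OF sets_Q refl] by blast

lemma measurable_discounted[measurable]:
  assumes [measurable]: "f \<in> borel_measurable borel"
  shows "discounted f \<in> borel_measurable borel"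
  unfolding discounted_def[abs_def] by measurable

lemma B_mono: "0 < x \<Longrightarrow> x \<le> y \<Longrightarrow> B x \<le> B y"
  by (rule DERIV_nonneg_imp_nondecreasing[of x y B])
    (auto intro!: exI[of _ "\<beta> _ / \<tau> _"] B_deriv divide_nonneg_nonneg less_imp_le[OF \<beta>_pos] less_imp_le[OF \<tau>_pos])

lemma surv_le_1: "fdom z s \<Longrightarrow> surv z s \<le> 1"
  using B_mono[of z "\<phi> z s"] \<phi>_ge[of z s] fdom_pos[of z s] by (simp add: surv_def)

text \<open>The hypothesis \<open>drift\<close> is \<open>\<L> V + h \<le> V + k\<close>, rearranged so that no side is negative.\<close>

lemma discounted_step_upto:
  fixes V V' k :: "real \<Rightarrow> real" and h :: "real \<Rightarrow> ennreal"
  assumes V_deriv: "\<And>x. 0 < x \<Longrightarrow> (V has_real_derivative V' x) (at x)"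
    and V'_cont: "continuous_on {0<..} V'"
    and V_nonneg: "\<And>x. 0 < x \<Longrightarrow> 0 \<le> V x"
    and k[measurable]: "k \<in> borel_measurable borel"
    and k_bd: "\<And>x. 0 \<le> k x \<and> k x \<le> c"
    and nonneg: "\<And>x. 0 < x \<Longrightarrow> 0 \<le> V x + \<beta> x * V x - \<tau> x * V' x + k x"
    and drift: "\<And>x. 0 < x \<Longrightarrow> h x + ennreal (\<beta> x) * (\<integral>\<^sup>+y. ennreal (V (x * y)) \<partial>Q x)
        \<le> ennreal (V x + \<beta> x * V x - \<tau> x * V' x + k x)"
    and D: "fdom z u"
  shows "(\<integral>\<^sup>+s\<in>{0..u}. ennreal (exp (- s)) * ennreal (surv z s) *
        (h (\<phi> z s) + ennreal (\<beta> (\<phi> z s)) * (\<integral>\<^sup>+y. ennreal (V (\<phi> z s * y)) \<partial>Q (\<phi> z s))) \<partial>lborel)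
    \<le> ennreal (V z) + discounted (\<lambda>x. ennreal (k x)) z" (is "?lhs \<le> _")
proof -
  have u: "0 \<le> u" and z: "0 < z" using fdom_pos[OF D] by auto
  have Ds: "fdom z s" if "s \<in> {0..u}" for s using fdom_mono[OF D] that by auto
  \<comment> \<open>\<open>F\<close> is minus the discounted value of \<open>V\<close> weighted by
    survival. With this sign its derivative \<open>f\<close> is \<open>exp (- s) * surv z s\<close>
    times the right-hand side of \<open>drift\<close> without \<open>k\<close>.\<close>
  define F where "F s = - (exp (- s) * (surv z s * V (\<phi> z s)))" for s
  define f where "f s = exp (- s) * surv z s *
    (V (\<phi> z s) + \<beta> (\<phi> z s) * V (\<phi> z s) - \<tau> (\<phi> z s) * V' (\<phi> z s))" for s
  \<comment> \<open>The cut-off outside \<open>{0..u}\<close> makes the bound by \<open>c\<close>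
    hold everywhere: \<open>surv_le_1\<close> is available only on the flow domain, and
    \<open>exp (- s) \<le> 1\<close> only for nonnegative times.\<close>
  define K where "K s = (if s \<in> {0..u} then exp (- s) * surv z s * k (\<phi> z s) else 0)" for s
  have F_deriv: "(F has_real_derivative f s) (at s within {0..u})" if s: "s \<in> {0..u}" for s
  proof -
    have e: "((\<lambda>s. exp (- s :: real)) has_real_derivative exp (- s) * (- 1)) (at s within {0..u})"
      by (intro DERIV_chain2[OF DERIV_exp] DERIV_minus DERIV_ident)
    have v: "((\<lambda>s. V (\<phi> z s)) has_real_derivative V' (\<phi> z s) * \<tau> (\<phi> z s)) (at s within {0..u})"
      by (intro DERIV_chain2[where f=V] V_deriv \<phi>_deriv D s) simp
    show ?thesis
      using DERIV_minus[OF DERIV_mult[OF e DERIV_mult[OF surv_deriv[OF D s] v]]]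
      unfolding F_def[abs_def] f_def by (rule DERIV_cong) (simp add: algebra_simps)
  qed
  have \<phi>_c: "continuous_on {0..u} (\<phi> z)" by (rule \<phi>_continuous[OF D])
  have comp: "continuous_on {0..u} (\<lambda>s. g (\<phi> z s))" if "continuous_on {0<..} g" for g :: "real \<Rightarrow> real"
    by (rule continuous_on_compose2[OF that \<phi>_c]) auto
  have V_cont: "continuous_on {0<..} V"
    using V_deriv by (intro continuous_at_imp_continuous_on) (auto intro: DERIV_isCont)
  have f_cont: "continuous_on {0..u} f"
    unfolding f_def[abs_def]
    by (intro continuous_intros DERIV_continuous_on[OF surv_deriv[OF D]] comp V_cont \<tau>_cont V'_cont \<beta>_cont)
  have K_meas[measurable]: "K \<in> borel_measurable borel" unfolding K_def[abs_def] by measurable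
  have K_bd: "0 \<le> K s \<and> K s \<le> c" for s
  proof (cases "s \<in> {0..u}")
    case True
    have "exp (- s) * surv z s \<le> 1 * 1"
      using surv_le_1[OF Ds[OF True]] True by (intro mult_mono) simp_all
    then have "exp (- s) * surv z s * k (\<phi> z s) \<le> 1 * c"
      using k_bd[of "\<phi> z s"] by (intro mult_mono) simp_all
    moreover have "K s = exp (- s) * surv z s * k (\<phi> z s)" using True by (simp add: K_def)
    ultimately show ?thesis using k_bd[of "\<phi> z s"] by simp
  next
    case False
    then have "K s = 0" by (auto simp: K_def)
    then show ?thesis using k_bd[of 1] by simp
  qed
  have fK: "f s + K s = exp (- s) * surv z s *
      (V (\<phi> z s) + \<beta> (\<phi> z s) * V (\<phi> z s) - \<tau> (\<phi> z s) * V' (\<phi> z s) + k (\<phi> z s))"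
    if "s \<in> {0..u}" for s
    using that by (simp add: f_def K_def algebra_simps)
  have fK_nonneg: "0 \<le> f s + K s" if "s \<in> {0..u}" for s
    unfolding fK[OF that] using nonneg[of "\<phi> z s"] by simp
  have F_nonpos: "F 0 \<le> 0" "F u \<le> 0" unfolding F_def using V_nonneg by simp_all
  have "?lhs \<le> (\<integral>\<^sup>+s\<in>{0..u}. ennreal (f s + K s) \<partial>lborel)"
  proof (rule nn_integral_mono)
    fix s
    show "ennreal (exp (- s)) * ennreal (surv z s) *
        (h (\<phi> z s) + ennreal (\<beta> (\<phi> z s)) * (\<integral>\<^sup>+y. ennreal (V (\<phi> z s * y)) \<partial>Q (\<phi> z s))) *
        indicator {0..u} s \<le> ennreal (f s + K s) * indicator {0..u} s"
    proof (cases "s \<in> {0..u}")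
      case True
      have "ennreal (f s + K s) = ennreal (exp (- s)) * ennreal (surv z s) *
          ennreal (V (\<phi> z s) + \<beta> (\<phi> z s) * V (\<phi> z s) - \<tau> (\<phi> z s) * V' (\<phi> z s) + k (\<phi> z s))"
        unfolding fK[OF True] using nonneg[of "\<phi> z s"] by (simp add: ennreal_mult)
      then show ?thesis using drift[of "\<phi> z s"] True by (simp add: mult_left_mono)
    qed simp
  qed
  \<comment> \<open>\<open>- F u\<close> is the discounted value of \<open>V\<close> at time
    \<open>u\<close> on survival. It is nonnegative and may be added, so no control of
    \<open>V\<close> near the end of the flow domain enters.\<close>
  also have "\<dots> \<le> (\<integral>\<^sup>+s\<in>{0..u}. ennreal (f s + K s) \<partial>lborel) + ennreal (- F u)"
    by simp
  also have "\<dots> = ennreal (- F 0) + (\<integral>\<^sup>+s\<in>{0..u}. ennreal (K s) \<partial>lborel)"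
    by (rule nn_integral_FTC_perturbed[OF u F_deriv f_cont K_meas K_bd fK_nonneg F_nonpos])
  also have "(\<integral>\<^sup>+s\<in>{0..u}. ennreal (K s) \<partial>lborel) \<le> discounted (\<lambda>x. ennreal (k x)) z"
    unfolding discounted_def
  proof (rule nn_integral_mono)
    fix s show "ennreal (K s) * indicator {0..u} s
      \<le> ennreal (exp (- s)) * ennreal (surv z s) * ennreal (k (\<phi> z s)) * indicator {s. fdom z s} s"
      using Ds[of s] k_bd[of "\<phi> z s"] by (auto simp: K_def ennreal_mult indicator_def)
  qed
  also have "- F 0 = V z" using z by (simp add: F_def)
  finally show ?thesis by (simp add: add_left_mono)
qed

text \<open>The bound of \<open>discounted_step_upto\<close> does not depend on \<open>u\<close>, so
  \<open>u\<close> may tend to the end of the flow domain. What results is a drift inequality over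
  one jump: the occupation of \<open>h\<close> before the jump plus the discounted value of
  \<open>V\<close> just after it.\<close>

lemma discounted_step:
  fixes V V' k :: "real \<Rightarrow> real" and h :: "real \<Rightarrow> ennreal"
  assumes V_deriv: "\<And>x. 0 < x \<Longrightarrow> (V has_real_derivative V' x) (at x)"
    and V'_cont: "continuous_on {0<..} V'"
    and V_nonneg: "\<And>x. 0 < x \<Longrightarrow> 0 \<le> V x"
    and [measurable]: "V \<in> borel_measurable borel" "h \<in> borel_measurable borel"
    and k: "k \<in> borel_measurable borel" "\<And>x. 0 \<le> k x \<and> k x \<le> c"
    and nonneg: "\<And>x. 0 < x \<Longrightarrow> 0 \<le> V x + \<beta> x * V x - \<tau> x * V' x + k x"
    and drift: "\<And>x. 0 < x \<Longrightarrow> h x + ennreal (\<beta> x) * (\<integral>\<^sup>+y. ennreal (V (x * y)) \<partial>Q x)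
        \<le> ennreal (V x + \<beta> x * V x - \<tau> x * V' x + k x)"
    and z: "0 < z"
  shows "discounted h z + jump_integral (\<lambda>(s, y). ennreal (exp (- s)) * ennreal (V y)) z
    \<le> ennreal (V z) + discounted (\<lambda>x. ennreal (k x)) z"
proof -
  define g where "g s = ennreal (exp (- s)) * ennreal (surv z s) *
        (h (\<phi> z s) + ennreal (\<beta> (\<phi> z s)) * (\<integral>\<^sup>+y. ennreal (V (\<phi> z s * y)) \<partial>Q (\<phi> z s)))" for s
  have QV[measurable]: "(\<lambda>s. \<integral>\<^sup>+y. ennreal (V (\<phi> z s * y)) \<partial>Q (\<phi> z s)) \<in> borel_measurable borel"
    by (rule nn_integral_measurable_subprob_algebra2[where N=borel]) measurable
  have [measurable]: "g \<in> borel_measurable borel" unfolding g_def[abs_def] by measurable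
  \<comment> \<open>\<open>U n\<close> consists of the times at which the flow is at or below level
    \<open>n\<close>; it is empty or the interval \<open>{0..H n - H z}\<close>. These sets increase
    to the flow domain, to which monotone convergence is then applied.\<close>
  define U where "U n = {s. 0 < n \<and> 0 \<le> s \<and> H z + s \<le> H (real n)}" for n :: nat
  have [measurable]: "U n \<in> sets borel" for n unfolding U_def by measurable
  have "jump_integral (\<lambda>(s, y). ennreal (exp (- s)) * ennreal (V y)) z
      \<le> (\<integral>\<^sup>+s\<in>{s. fdom z s}. ennreal (exp (- s)) * ennreal (surv z s) *
          (ennreal (\<beta> (\<phi> z s)) * (\<integral>\<^sup>+y. ennreal (V (\<phi> z s * y)) \<partial>Q (\<phi> z s))) \<partial>lborel)"
    unfolding jump_integral_def
  proof (rule nn_integral_mono)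
    fix s
    have "(\<lambda>y. ennreal (V (\<phi> z s * y))) \<in> borel_measurable (Q (\<phi> z s))"
      by (rule borel_measurable_Q[OF \<phi>_pos], measurable)
    then have "(\<integral>\<^sup>+y. (case (s, \<phi> z s * y) of (s, y) \<Rightarrow> ennreal (exp (- s)) * ennreal (V y)) \<partial>Q (\<phi> z s)) =
        ennreal (exp (- s)) * (\<integral>\<^sup>+y. ennreal (V (\<phi> z s * y)) \<partial>Q (\<phi> z s))"
      by (simp only: prod.case nn_integral_cmult)
    moreover have "jump_density z s \<le> ennreal (surv z s) * ennreal (\<beta> (\<phi> z s)) * indicator {s. fdom z s} s"
      using less_imp_le[OF \<beta>_pos[OF \<phi>_pos[of z s]]]
      by (simp add: jump_density_def ennreal_mult mult.commute[of "ennreal (surv z s)"] split: split_indicator)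
    ultimately show "jump_density z s *
        (\<integral>\<^sup>+y. (case (s, \<phi> z s * y) of (s, y) \<Rightarrow> ennreal (exp (- s)) * ennreal (V y)) \<partial>Q (\<phi> z s))
      \<le> ennreal (exp (- s)) * ennreal (surv z s) * (ennreal (\<beta> (\<phi> z s)) *
          (\<integral>\<^sup>+y. ennreal (V (\<phi> z s * y)) \<partial>Q (\<phi> z s))) * indicator {s. fdom z s} s"
      using mult_right_mono[of "jump_density z s" "ennreal (surv z s) * ennreal (\<beta> (\<phi> z s)) * indicator {s. fdom z s} s"
          "ennreal (exp (- s)) * (\<integral>\<^sup>+y. ennreal (V (\<phi> z s * y)) \<partial>Q (\<phi> z s))"]
      by (simp only: mult_ac) simp
  qed
  then have "discounted h z + jump_integral (\<lambda>(s, y). ennreal (exp (- s)) * ennreal (V y)) z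
      \<le> discounted h z + (\<integral>\<^sup>+s\<in>{s. fdom z s}. ennreal (exp (- s)) * ennreal (surv z s) *
          (ennreal (\<beta> (\<phi> z s)) * (\<integral>\<^sup>+y. ennreal (V (\<phi> z s * y)) \<partial>Q (\<phi> z s))) \<partial>lborel)"
    by (rule add_left_mono)
  also have "\<dots> = (\<integral>\<^sup>+s. ennreal (exp (- s)) * ennreal (surv z s) * h (\<phi> z s) * indicator {s. fdom z s} s +
      ennreal (exp (- s)) * ennreal (surv z s) * (ennreal (\<beta> (\<phi> z s)) *
        (\<integral>\<^sup>+y. ennreal (V (\<phi> z s * y)) \<partial>Q (\<phi> z s))) * indicator {s. fdom z s} s \<partial>lborel)"
    unfolding discounted_def by (rule nn_integral_add[symmetric]) measurable
  also have "\<dots> = (\<integral>\<^sup>+s\<in>{s. fdom z s}. g s \<partial>lborel)"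
    unfolding g_def by (simp only: distrib_left distrib_right)
  also have "\<dots> = (\<integral>\<^sup>+s. (SUP n. g s * indicator (U n) s) \<partial>lborel)"
  proof (rule nn_integral_cong)
    fix s
    have "indicator {s. fdom z s} s = (SUP n. indicator (U n) s :: ennreal)"
    proof (rule antisym)
      show "indicator {s. fdom z s} s \<le> (SUP n. indicator (U n) s :: ennreal)"
      proof (cases "fdom z s")
        case True
        then obtain n where "s \<in> U n" by (auto simp: fdom_iff U_def)
        then show ?thesis by (intro SUP_upper2[of n]) (auto simp: indicator_def)
      qed simp
      show "(SUP n. indicator (U n) s :: ennreal) \<le> indicator {s. fdom z s} s"
        using z by (intro SUP_least) (auto simp: U_def fdom_iff indicator_def)
    qed
    then show "g s * indicator {s. fdom z s} s = (SUP n. g s * indicator (U n) s)"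
      by (simp add: SUP_mult_left_ennreal)
  qed
  also have "\<dots> = (SUP n. \<integral>\<^sup>+s. g s * indicator (U n) s \<partial>lborel)"
  proof (rule nn_integral_monotone_convergence_SUP)
    have "U m \<subseteq> U n" if "m \<le> n" for m n
      using that H_le_iff[of "real m" "real n"] by (force simp: U_def)
    then show "incseq (\<lambda>n s. g s * indicator (U n) s)"
      by (auto simp: incseq_def le_fun_def indicator_def)
  qed measurable
  also have "\<dots> \<le> ennreal (V z) + discounted (\<lambda>x. ennreal (k x)) z"
  proof (rule SUP_least)
    fix n
    show "(\<integral>\<^sup>+s. g s * indicator (U n) s \<partial>lborel) \<le> ennreal (V z) + discounted (\<lambda>x. ennreal (k x)) z"
    proof (cases "0 < n \<and> H z \<le> H (real n)")
      case True
      define u where "u = H (real n) - H z"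
      have "fdom z u" using True z by (auto simp: fdom_iff u_def)
      from discounted_step_upto[where V=V and V'=V' and h=h and k=k, OF V_deriv V'_cont V_nonneg k nonneg drift this]
      have "(\<integral>\<^sup>+s\<in>{0..u}. g s \<partial>lborel) \<le> ennreal (V z) + discounted (\<lambda>x. ennreal (k x)) z"
        unfolding g_def .
      moreover have "U n = {0..u}" using True by (auto simp: U_def u_def)
      ultimately show ?thesis by simp
    next
      case False
      then have "U n = {}" by (auto simp: U_def)
      then show ?thesis by simp
    qed
  qed
  finally show ?thesis .
qed

end

section \<open>Paths of the process\<close>

context pdmp_coord begin

text \<open>Additivity, scaling and monotone limits of \<open>jump_integral\<close> are what the
  induction over measurable functions in \<open>markov\<close> consumes.\<close>

lemma jump_integral_add:
  assumes [measurable]: "u \<in> borel_measurable (borel \<Otimes>\<^sub>M borel)" "v \<in> borel_measurable (borel \<Otimes>\<^sub>M borel)"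
  shows "jump_integral (\<lambda>x. v x + u x) z = jump_integral v z + jump_integral u z"
proof -
  have "(\<integral>\<^sup>+y. v (t, \<phi> z t * y) + u (t, \<phi> z t * y) \<partial>Q (\<phi> z t)) =
      (\<integral>\<^sup>+y. v (t, \<phi> z t * y) \<partial>Q (\<phi> z t)) + (\<integral>\<^sup>+y. u (t, \<phi> z t * y) \<partial>Q (\<phi> z t))" for t
    by (rule nn_integral_add; rule borel_measurable_Q[OF \<phi>_pos], measurable)
  then have "jump_integral (\<lambda>x. v x + u x) z = (\<integral>\<^sup>+t. jump_density z t * (\<integral>\<^sup>+y. v (t, \<phi> z t * y) \<partial>Q (\<phi> z t)) +
      jump_density z t * (\<integral>\<^sup>+y. u (t, \<phi> z t * y) \<partial>Q (\<phi> z t)) \<partial>lborel)"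
    unfolding jump_integral_def by (simp only: distrib_left)
  also have "\<dots> = jump_integral v z + jump_integral u z"
    unfolding jump_integral_def by (rule nn_integral_add) measurable
  finally show ?thesis .
qed

lemma jump_integral_cmult:
  assumes [measurable]: "u \<in> borel_measurable (borel \<Otimes>\<^sub>M borel)"
  shows "jump_integral (\<lambda>x. c * u x) z = c * jump_integral u z"
proof -
  have "(\<integral>\<^sup>+y. c * u (t, \<phi> z t * y) \<partial>Q (\<phi> z t)) = c * (\<integral>\<^sup>+y. u (t, \<phi> z t * y) \<partial>Q (\<phi> z t))" for t
    by (rule nn_integral_cmult; rule borel_measurable_Q[OF \<phi>_pos], measurable)
  then have "jump_integral (\<lambda>x. c * u x) z =
      (\<integral>\<^sup>+t. c * (jump_density z t * (\<integral>\<^sup>+y. u (t, \<phi> z t * y) \<partial>Q (\<phi> z t))) \<partial>lborel)"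
    unfolding jump_integral_def by (simp only: mult.left_commute)
  also have "\<dots> = c * jump_integral u z"
    unfolding jump_integral_def by (rule nn_integral_cmult) measurable
  finally show ?thesis .
qed

lemma jump_integral_SUP:
  assumes [measurable]: "\<And>i. U i \<in> borel_measurable (borel \<Otimes>\<^sub>M borel)" and U: "incseq U"
  shows "jump_integral (\<lambda>x. SUP i. U i x) z = (SUP i. jump_integral (U i) z)"
proof -
  have inc: "U i x \<le> U j x" if "i \<le> j" for i j x using U that unfolding incseq_def le_fun_def by blast
  have "(\<integral>\<^sup>+y. (SUP i. U i (t, \<phi> z t * y)) \<partial>Q (\<phi> z t)) = (SUP i. \<integral>\<^sup>+y. U i (t, \<phi> z t * y) \<partial>Q (\<phi> z t))" for t
  proof (rule nn_integral_monotone_convergence_SUP)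
    show "incseq (\<lambda>i y. U i (t, \<phi> z t * y))"
      unfolding incseq_def le_fun_def by (intro allI impI inc)
    show "(\<lambda>y. U i (t, \<phi> z t * y)) \<in> borel_measurable (Q (\<phi> z t))" for i
      by (rule borel_measurable_Q[OF \<phi>_pos], measurable)
  qed
  then have "jump_integral (\<lambda>x. SUP i. U i x) z =
      (\<integral>\<^sup>+t. (SUP i. jump_density z t * (\<integral>\<^sup>+y. U i (t, \<phi> z t * y) \<partial>Q (\<phi> z t))) \<partial>lborel)"
    unfolding jump_integral_def by (simp only: SUP_mult_left_ennreal)
  also have "\<dots> = (SUP i. jump_integral (U i) z)"
    unfolding jump_integral_def
  proof (rule nn_integral_monotone_convergence_SUP)
    show "incseq (\<lambda>i t. jump_density z t * (\<integral>\<^sup>+y. U i (t, \<phi> z t * y) \<partial>Q (\<phi> z t)))"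
      unfolding incseq_def le_fun_def by (intro allI impI mult_left_mono nn_integral_mono inc) simp_all
  qed measurable
  finally show ?thesis .
qed

lemma jump_integral_mono: "(\<And>x. u x \<le> v x) \<Longrightarrow> jump_integral u z \<le> jump_integral v z"
  unfolding jump_integral_def by (intro nn_integral_mono mult_left_mono) auto

end

section \<open>The Markov property of the sequence of jump times and positions\<close>

locale pdmp_path = pdmp_coord + P: prob_space P for P :: "'w measure" +
  fixes X :: "real \<Rightarrow> 'w \<Rightarrow> real" and T Z :: "nat \<Rightarrow> 'w \<Rightarrow> real"
  assumes T_meas[measurable]: "T n \<in> borel_measurable P"
    and Z_meas[measurable]: "Z n \<in> borel_measurable P"
    and AE_path: "AE \<omega> in P. T 0 \<omega> = 0 \<and> (\<forall>n. T n \<omega> < T (Suc n) \<omega> \<and> 0 < Z n \<omega>) \<and>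
      filterlim (\<lambda>n. T n \<omega>) at_top sequentially"
    and AE_flow: "AE \<omega> in P. \<forall>n. \<forall>t\<in>{T n \<omega>..<T (Suc n) \<omega>}. X t \<omega> = flow \<tau> (Z n \<omega>) (t - T n \<omega>)"
    and cylinder: "\<And>n A B'. (\<forall>k\<le>n. A k \<in> sets (borel \<Otimes>\<^sub>M borel)) \<Longrightarrow> B' \<in> sets (borel \<Otimes>\<^sub>M borel) \<Longrightarrow>
      emeasure P {\<omega>\<in>space P. (\<forall>k\<le>n. (T k \<omega>, Z k \<omega>) \<in> A k) \<and> (T (Suc n) \<omega> - T n \<omega>, Z (Suc n) \<omega>) \<in> B'}
      = (\<integral>\<^sup>+\<omega>\<in>{\<omega>\<in>space P. \<forall>k\<le>n. (T k \<omega>, Z k \<omega>) \<in> A k}. jump_kernel \<tau> \<beta> Q (Z n \<omega>) B' \<partial>P)"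
begin

lemma AE_Z_pos: "AE \<omega> in P. \<forall>n. 0 < Z n \<omega>"
  using AE_path by eventually_elim auto

lemma markov_indicator:
  assumes A: "A \<in> sets (borel \<Otimes>\<^sub>M borel)" and C: "C \<in> sets (borel \<Otimes>\<^sub>M borel)"
  shows "(\<integral>\<^sup>+\<omega>. indicator A (T n \<omega>, Z n \<omega>) * indicator C (T (Suc n) \<omega> - T n \<omega>, Z (Suc n) \<omega>) \<partial>P)
    = (\<integral>\<^sup>+\<omega>. indicator A (T n \<omega>, Z n \<omega>) * jump_integral (indicator C) (Z n \<omega>) \<partial>P)"
proof -
  note [measurable] = A C
  \<comment> \<open>Only the pair with index \<open>n\<close> is constrained; the earlier
    coordinates of the cylinder are the whole plane.\<close>
  let ?A = "\<lambda>k. if k = n then A else UNIV"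
  have UNIV: "UNIV \<in> sets (borel \<Otimes>\<^sub>M borel :: (real \<times> real) measure)"
    using sets.top[of "borel \<Otimes>\<^sub>M borel :: (real \<times> real) measure"] by (simp add: space_pair_measure)
  have Aall: "(\<forall>k\<le>n. (T k \<omega>, Z k \<omega>) \<in> ?A k) \<longleftrightarrow> (T n \<omega>, Z n \<omega>) \<in> A" for \<omega> by auto
  let ?S = "{\<omega>\<in>space P. (T n \<omega>, Z n \<omega>) \<in> A \<and> (T (Suc n) \<omega> - T n \<omega>, Z (Suc n) \<omega>) \<in> C}"
  have [measurable]: "?S \<in> sets P" by measurable
  have "(\<integral>\<^sup>+\<omega>. indicator A (T n \<omega>, Z n \<omega>) * indicator C (T (Suc n) \<omega> - T n \<omega>, Z (Suc n) \<omega>) \<partial>P)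
      = (\<integral>\<^sup>+\<omega>. indicator ?S \<omega> \<partial>P)"
    by (intro nn_integral_cong) (auto simp: indicator_def)
  also have "\<dots> = emeasure P ?S" by simp
  also have "\<dots> = (\<integral>\<^sup>+\<omega>\<in>{\<omega>\<in>space P. (T n \<omega>, Z n \<omega>) \<in> A}. jump_kernel \<tau> \<beta> Q (Z n \<omega>) C \<partial>P)"
    using cylinder[of n ?A C] A C UNIV unfolding Aall by auto
  also have "\<dots> = (\<integral>\<^sup>+\<omega>. indicator A (T n \<omega>, Z n \<omega>) * jump_integral (indicator C) (Z n \<omega>) \<partial>P)"
  proof (rule nn_integral_cong_AE)
    show "AE \<omega> in P. jump_kernel \<tau> \<beta> Q (Z n \<omega>) C * indicator {\<omega>\<in>space P. (T n \<omega>, Z n \<omega>) \<in> A} \<omega> =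
        indicator A (T n \<omega>, Z n \<omega>) * jump_integral (indicator C) (Z n \<omega>)"
      using AE_Z_pos AE_space
    proof eventually_elim
      case (elim \<omega>)
      then have "jump_kernel \<tau> \<beta> Q (Z n \<omega>) C = jump_integral (indicator C) (Z n \<omega>)"
        by (intro jump_kernel_eq C) auto
      with elim show ?case by (simp add: indicator_def)
    qed
  qed
  finally show ?thesis .
qed

text \<open>Both sides integrate \<open>f\<close> against the image under \<open>(T n, Z n)\<close>
  of a measure with a density with respect to \<open>P\<close>. The two images agree on sets by
  \<open>markov_indicator\<close>, hence on functions.\<close>

lemma markov_set:
  assumes [measurable]: "f \<in> borel_measurable (borel \<Otimes>\<^sub>M borel)" and C[measurable]: "C \<in> sets (borel \<Otimes>\<^sub>M borel)"
  shows "(\<integral>\<^sup>+\<omega>. f (T n \<omega>, Z n \<omega>) * indicator C (T (Suc n) \<omega> - T n \<omega>, Z (Suc n) \<omega>) \<partial>P)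
    = (\<integral>\<^sup>+\<omega>. f (T n \<omega>, Z n \<omega>) * jump_integral (indicator C) (Z n \<omega>) \<partial>P)"
proof -
  let ?d1 = "\<lambda>\<omega>. indicator C (T (Suc n) \<omega> - T n \<omega>, Z (Suc n) \<omega>) :: ennreal"
  let ?d2 = "\<lambda>\<omega>. jump_integral (indicator C) (Z n \<omega>)"
  have [measurable]: "?d1 \<in> borel_measurable P" "?d2 \<in> borel_measurable P" by measurable
  let ?M = "\<lambda>d. distr (density P d) (borel \<Otimes>\<^sub>M borel) (\<lambda>\<omega>. (T n \<omega>, Z n \<omega>))"
  have int: "(\<integral>\<^sup>+x. g x \<partial>?M d) = (\<integral>\<^sup>+\<omega>. g (T n \<omega>, Z n \<omega>) * d \<omega> \<partial>P)"
    if [measurable]: "d \<in> borel_measurable P" "g \<in> borel_measurable (borel \<Otimes>\<^sub>M borel)" for d g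
    by (simp add: nn_integral_distr nn_integral_density mult.commute)
  have "?M ?d1 = ?M ?d2"
  proof (rule measure_eqI)
    fix A assume "A \<in> sets (?M ?d1)"
    then have A[measurable]: "A \<in> sets (borel \<Otimes>\<^sub>M borel)" by simp
    have "emeasure (?M ?d1) A = (\<integral>\<^sup>+x. indicator A x \<partial>?M ?d1)" by simp
    also have "\<dots> = (\<integral>\<^sup>+x. indicator A x \<partial>?M ?d2)"
      using markov_indicator[OF A C, of n] by (simp only: int \<open>?d1 \<in> _\<close> \<open>?d2 \<in> _\<close> borel_measurable_indicator A)
    finally show "emeasure (?M ?d1) A = emeasure (?M ?d2) A" by simp
  qed simp
  then have "(\<integral>\<^sup>+x. f x \<partial>?M ?d1) = (\<integral>\<^sup>+x. f x \<partial>?M ?d2)" by simp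
  then show ?thesis by (simp only: int \<open>?d1 \<in> _\<close> \<open>?d2 \<in> _\<close> assms)
qed

lemma markov:
  assumes f[measurable]: "f \<in> borel_measurable (borel \<Otimes>\<^sub>M borel)" and h: "h \<in> borel_measurable (borel \<Otimes>\<^sub>M borel)"
  shows "(\<integral>\<^sup>+\<omega>. f (T n \<omega>, Z n \<omega>) * h (T (Suc n) \<omega> - T n \<omega>, Z (Suc n) \<omega>) \<partial>P)
    = (\<integral>\<^sup>+\<omega>. f (T n \<omega>, Z n \<omega>) * jump_integral h (Z n \<omega>) \<partial>P)"
  using h
proof (induction h rule: borel_measurable_induct)
  case (cong u v)
  then have "u = v" by (auto simp: space_pair_measure)
  with cong show ?case by simp
next
  case (set C)
  then show ?case by (rule markov_set[OF f])
next
  case (mult u c)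
  note [measurable] = mult.hyps(2)
  have "(\<integral>\<^sup>+\<omega>. f (T n \<omega>, Z n \<omega>) * (c * u (T (Suc n) \<omega> - T n \<omega>, Z (Suc n) \<omega>)) \<partial>P) =
      (\<integral>\<^sup>+\<omega>. c * (f (T n \<omega>, Z n \<omega>) * u (T (Suc n) \<omega> - T n \<omega>, Z (Suc n) \<omega>)) \<partial>P)"
    by (rule nn_integral_cong) (rule mult.left_commute)
  also have "\<dots> = c * (\<integral>\<^sup>+\<omega>. f (T n \<omega>, Z n \<omega>) * u (T (Suc n) \<omega> - T n \<omega>, Z (Suc n) \<omega>) \<partial>P)"
    by (rule nn_integral_cmult) measurable
  also have "\<dots> = c * (\<integral>\<^sup>+\<omega>. f (T n \<omega>, Z n \<omega>) * jump_integral u (Z n \<omega>) \<partial>P)"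
    by (simp only: mult.IH)
  also have "\<dots> = (\<integral>\<^sup>+\<omega>. c * (f (T n \<omega>, Z n \<omega>) * jump_integral u (Z n \<omega>)) \<partial>P)"
    by (rule nn_integral_cmult[symmetric]) measurable
  also have "\<dots> = (\<integral>\<^sup>+\<omega>. f (T n \<omega>, Z n \<omega>) * jump_integral (\<lambda>x. c * u x) (Z n \<omega>) \<partial>P)"
    by (rule nn_integral_cong, subst jump_integral_cmult[OF mult.hyps(2)]) (rule mult.left_commute)
  finally show ?case .
next
  case (add u v)
  note [measurable] = add.hyps(1,3)
  have "(\<integral>\<^sup>+\<omega>. f (T n \<omega>, Z n \<omega>) * (v (T (Suc n) \<omega> - T n \<omega>, Z (Suc n) \<omega>) + u (T (Suc n) \<omega> - T n \<omega>, Z (Suc n) \<omega>)) \<partial>P) =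
      (\<integral>\<^sup>+\<omega>. f (T n \<omega>, Z n \<omega>) * v (T (Suc n) \<omega> - T n \<omega>, Z (Suc n) \<omega>) \<partial>P) +
      (\<integral>\<^sup>+\<omega>. f (T n \<omega>, Z n \<omega>) * u (T (Suc n) \<omega> - T n \<omega>, Z (Suc n) \<omega>) \<partial>P)"
    unfolding distrib_left by (rule nn_integral_add) measurable
  also have "\<dots> = (\<integral>\<^sup>+\<omega>. f (T n \<omega>, Z n \<omega>) * jump_integral v (Z n \<omega>) \<partial>P) +
      (\<integral>\<^sup>+\<omega>. f (T n \<omega>, Z n \<omega>) * jump_integral u (Z n \<omega>) \<partial>P)"
    by (simp only: add.IH)
  also have "\<dots> = (\<integral>\<^sup>+\<omega>. f (T n \<omega>, Z n \<omega>) * jump_integral v (Z n \<omega>) + f (T n \<omega>, Z n \<omega>) * jump_integral u (Z n \<omega>) \<partial>P)"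
    by (rule nn_integral_add[symmetric]) measurable
  also have "\<dots> = (\<integral>\<^sup>+\<omega>. f (T n \<omega>, Z n \<omega>) * jump_integral (\<lambda>x. v x + u x) (Z n \<omega>) \<partial>P)"
    by (rule nn_integral_cong, subst jump_integral_add[OF add.hyps(1,3)]) (rule distrib_left[symmetric])
  finally show ?case .
next
  case (seq U)
  note [measurable] = seq.hyps(1)
  have inc: "U i x \<le> U j x" if "i \<le> j" for i j x using seq.hyps(3) that unfolding incseq_def le_fun_def by blast
  have eq: "(SUP i. U i) = (\<lambda>x. SUP i. U i x)" by (rule ext) (rule SUP_apply)
  have "(\<integral>\<^sup>+\<omega>. f (T n \<omega>, Z n \<omega>) * (SUP i. U i (T (Suc n) \<omega> - T n \<omega>, Z (Suc n) \<omega>)) \<partial>P) =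
      (SUP i. \<integral>\<^sup>+\<omega>. f (T n \<omega>, Z n \<omega>) * U i (T (Suc n) \<omega> - T n \<omega>, Z (Suc n) \<omega>) \<partial>P)"
    unfolding SUP_mult_left_ennreal
  proof (rule nn_integral_monotone_convergence_SUP)
    show "incseq (\<lambda>i \<omega>. f (T n \<omega>, Z n \<omega>) * U i (T (Suc n) \<omega> - T n \<omega>, Z (Suc n) \<omega>))"
      unfolding incseq_def le_fun_def by (intro allI impI mult_left_mono inc) simp_all
  qed measurable
  also have "\<dots> = (\<integral>\<^sup>+\<omega>. f (T n \<omega>, Z n \<omega>) * jump_integral (\<lambda>x. SUP i. U i x) (Z n \<omega>) \<partial>P)"
    unfolding jump_integral_SUP[OF seq.hyps(1,3)] seq.IH SUP_mult_left_ennreal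
  proof (rule nn_integral_monotone_convergence_SUP[symmetric])
    show "incseq (\<lambda>i \<omega>. f (T n \<omega>, Z n \<omega>) * jump_integral (U i) (Z n \<omega>))"
      unfolding incseq_def le_fun_def by (intro allI impI mult_left_mono jump_integral_mono inc) simp_all
  qed measurable
  finally show ?case by (simp only: eq)
qed

text \<open>With the whole plane as event, the cylinder formula at \<open>n = 0\<close> equates the
  probability 1 with the total mass of the waiting time from \<open>x\<close>. Existence of the
  process thus excludes escape of the flow before the first jump.\<close>

lemma jump_density_total:
  assumes "AE \<omega> in P. Z 0 \<omega> = x"
  shows "(\<integral>\<^sup>+t. jump_density x t \<partial>lborel) = 1"
proof -
  have "1 = (\<integral>\<^sup>+\<omega>. 1 * indicator (UNIV \<times> UNIV) (T (Suc 0) \<omega> - T 0 \<omega>, Z (Suc 0) \<omega>) \<partial>P)"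
    by (simp add: P.emeasure_space_1)
  also have "\<dots> = (\<integral>\<^sup>+\<omega>. 1 * jump_integral (indicator (UNIV \<times> UNIV)) (Z 0 \<omega>) \<partial>P)"
    by (rule markov[where f="\<lambda>_. 1" and h="indicator (UNIV \<times> UNIV)"]) measurable
  also have "\<dots> = (\<integral>\<^sup>+\<omega>. (\<integral>\<^sup>+t. jump_density x t \<partial>lborel) \<partial>P)"
    using assms by (intro nn_integral_cong_AE, eventually_elim) (use jump_integral_time[of UNIV x] in simp)
  finally show ?thesis by (simp add: P.emeasure_space_1)
qed

end

section \<open>The resolvent as a sum over the jumps\<close>

definition resolvent :: "'w measure \<Rightarrow> (real \<Rightarrow> 'w \<Rightarrow> real) \<Rightarrow> (real \<Rightarrow> ennreal) \<Rightarrow> ennreal" where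
  "resolvent P X f = (\<integral>\<^sup>+t\<in>{0..}. ennreal (exp (- t)) * (\<integral>\<^sup>+\<omega>. f (X t \<omega>) \<partial>P) \<partial>lborel)"

lemma ex1_interval:
  fixes T :: "nat \<Rightarrow> real"
  assumes T0: "T 0 = 0" and inc: "\<And>n. T n < T (Suc n)" and lim: "filterlim T at_top sequentially" and t: "0 \<le> t"
  shows "\<exists>!n. t \<in> {T n..<T (Suc n)}"
proof -
  have mono: "T m \<le> T n" if "m \<le> n" for m n
    by (rule lift_Suc_mono_le[of T, OF less_imp_le[OF inc] that])
  have "\<exists>n. t < T n" using lim unfolding filterlim_at_top_dense
    by (meson eventually_happens sequentially_bot)
  then have ex: "t < T (LEAST n. t < T n)" by (rule LeastI_ex)
  then obtain n where n: "(LEAST n. t < T n) = Suc n"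
    using T0 t by (metis not0_implies_Suc not_less)
  have "\<not> t < T n" using not_less_Least[of n "\<lambda>n. t < T n"] n by simp
  with ex n have n_in: "t \<in> {T n..<T (Suc n)}" by simp
  moreover have "m = n" if "t \<in> {T m..<T (Suc m)}" for m
  proof (rule ccontr)
    assume "m \<noteq> n"
    then consider "Suc m \<le> n" | "Suc n \<le> m" by linarith
    then show False using mono[of "Suc m" n] mono[of "Suc n" m] that n_in by cases auto
  qed
  ultimately show ?thesis by blast
qed

text \<open>The mass condition is imposed for every \<open>z\<close>, because it is applied at the
  random positions \<open>Z n\<close>.\<close>

locale pdmp_path_total = pdmp_path +
  assumes total: "0 < z \<Longrightarrow> (\<integral>\<^sup>+t. jump_density z t \<partial>lborel) = 1"
begin

lemma jump_integral_after:
  assumes "0 < z" "0 \<le> s"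
  shows "jump_integral (indicator ({s<..} \<times> UNIV)) z = (if fdom z s then ennreal (surv z s) else 0)"
  using jump_integral_time[of "{s<..}" z] jump_after[OF assms(1) total[OF assms(1)] assms(2)] by simp

text \<open>For a fixed time \<open>q\<close>, \<open>markov\<close> gives probability 0 to waiting
  longer than \<open>q\<close> at a position whose flow does not last until \<open>q\<close>.
  Rational times suffice, as the flow domain is downward closed.\<close>

lemma AE_fdom: "AE \<omega> in P. \<forall>n s. 0 \<le> s \<longrightarrow> s < T (Suc n) \<omega> - T n \<omega> \<longrightarrow> fdom (Z n \<omega>) s"
proof -
  have "AE \<omega> in P. q < T (Suc n) \<omega> - T n \<omega> \<longrightarrow> fdom (Z n \<omega>) q" if q: "0 \<le> q" for n q
  proof -
    let ?f = "\<lambda>p :: real \<times> real. if fdom (snd p) q then 0 else 1 :: ennreal"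
    let ?h = "indicator ({q<..} \<times> UNIV) :: real \<times> real \<Rightarrow> ennreal"
    have f[measurable]: "?f \<in> borel_measurable (borel \<Otimes>\<^sub>M borel)" by measurable
    have h[measurable]: "?h \<in> borel_measurable (borel \<Otimes>\<^sub>M borel)" by measurable
    have m: "(\<lambda>\<omega>. ?f (T n \<omega>, Z n \<omega>) * ?h (T (Suc n) \<omega> - T n \<omega>, Z (Suc n) \<omega>)) \<in> borel_measurable P"
      by measurable
    have "(\<integral>\<^sup>+\<omega>. ?f (T n \<omega>, Z n \<omega>) * ?h (T (Suc n) \<omega> - T n \<omega>, Z (Suc n) \<omega>) \<partial>P) =
        (\<integral>\<^sup>+\<omega>. ?f (T n \<omega>, Z n \<omega>) * jump_integral ?h (Z n \<omega>) \<partial>P)"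
      by (rule markov[OF f h])
    also have "\<dots> = (\<integral>\<^sup>+\<omega>. 0 \<partial>P)"
      using AE_Z_pos by (intro nn_integral_cong_AE, eventually_elim) (simp add: jump_integral_after q)
    finally have "AE \<omega> in P. ?f (T n \<omega>, Z n \<omega>) * ?h (T (Suc n) \<omega> - T n \<omega>, Z (Suc n) \<omega>) = 0"
      using nn_integral_0_iff_AE[OF m] by simp
    then show ?thesis by eventually_elim (auto simp: indicator_def split: if_splits)
  qed
  then have "AE \<omega> in P. \<forall>n. \<forall>r :: rat. 0 \<le> r \<longrightarrow> of_rat r < T (Suc n) \<omega> - T n \<omega> \<longrightarrow> fdom (Z n \<omega>) (of_rat r)"
    unfolding AE_all_countable by (auto simp: zero_le_of_rat_iff)
  then show ?thesis
  proof eventually_elim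
    case (elim \<omega>)
    show ?case
    proof (intro allI impI)
      fix n and s :: real assume s: "0 \<le> s" "s < T (Suc n) \<omega> - T n \<omega>"
      then obtain r where r: "s < of_rat r" "of_rat r < T (Suc n) \<omega> - T n \<omega>" using of_rat_dense by blast
      then have "(0::real) \<le> of_rat r" using s by linarith
      then have "0 \<le> r" by (simp add: zero_le_of_rat_iff)
      with elim r have "fdom (Z n \<omega>) (of_rat r)" by blast
      then show "fdom (Z n \<omega>) s" using s r by (auto intro: fdom_mono)
    qed
  qed
qed

lemma AE_X: "AE \<omega> in P. (\<forall>t\<ge>0. \<exists>!n. t \<in> {T n \<omega>..<T (Suc n) \<omega>}) \<and>
    (\<forall>n. \<forall>t\<in>{T n \<omega>..<T (Suc n) \<omega>}. fdom (Z n \<omega>) (t - T n \<omega>) \<and> X t \<omega> = \<phi> (Z n \<omega>) (t - T n \<omega>))"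
  using AE_path AE_flow AE_fdom
proof eventually_elim
  case (elim \<omega>)
  have "fdom (Z n \<omega>) (t - T n \<omega>)" if "t \<in> {T n \<omega>..<T (Suc n) \<omega>}" for n t
    using elim(3) that by simp
  moreover have "\<exists>!n. t \<in> {T n \<omega>..<T (Suc n) \<omega>}" if "0 \<le> t" for t
    using elim(1) that by (intro ex1_interval) auto
  moreover have "flow \<tau> (Z n \<omega>) (t - T n \<omega>) = \<phi> (Z n \<omega>) (t - T n \<omega>)" if "t \<in> {T n \<omega>..<T (Suc n) \<omega>}" for n t
    using flow_eq elim(3) that by simp
  ultimately show ?case using elim(2) by metis
qed

text \<open>The random index of the segment containing \<open>t\<close> is resolved by a sum of
  indicators. Its terms involve only \<open>T n\<close>, \<open>T (Suc n)\<close>,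
  \<open>Z n\<close> and \<open>\<phi>\<close>, and are therefore jointly measurable in
  \<open>t\<close> and the path, whereas \<open>X\<close> is measurable at fixed times.\<close>

lemma X_decompose:
  assumes t: "0 \<le> t" and f[measurable]: "f \<in> borel_measurable borel"
  shows "(\<integral>\<^sup>+\<omega>. f (X t \<omega>) \<partial>P) =
    (\<Sum>n. \<integral>\<^sup>+\<omega>. indicator {T n \<omega>..<T (Suc n) \<omega>} t * f (\<phi> (Z n \<omega>) (t - T n \<omega>)) \<partial>P)"
proof -
  have "(\<integral>\<^sup>+\<omega>. f (X t \<omega>) \<partial>P) =
      (\<integral>\<^sup>+\<omega>. (\<Sum>n. indicator {T n \<omega>..<T (Suc n) \<omega>} t * f (\<phi> (Z n \<omega>) (t - T n \<omega>))) \<partial>P)"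
    using AE_X
  proof (intro nn_integral_cong_AE, eventually_elim)
    case (elim \<omega>)
    with t obtain n where n: "t \<in> {T n \<omega>..<T (Suc n) \<omega>}" "\<And>m. t \<in> {T m \<omega>..<T (Suc m) \<omega>} \<Longrightarrow> m = n" by blast
    have "(\<Sum>m. indicator {T m \<omega>..<T (Suc m) \<omega>} t * f (\<phi> (Z m \<omega>) (t - T m \<omega>))) =
        (\<Sum>m\<in>{n}. indicator {T m \<omega>..<T (Suc m) \<omega>} t * f (\<phi> (Z m \<omega>) (t - T m \<omega>)))"
      by (rule suminf_finite) (use n(2) in \<open>auto simp: indicator_def\<close>)
    also have "\<dots> = f (X t \<omega>)" using elim n(1) by simp
    finally show ?case by simp
  qed
  also have "\<dots> = (\<Sum>n. \<integral>\<^sup>+\<omega>. indicator {T n \<omega>..<T (Suc n) \<omega>} t * f (\<phi> (Z n \<omega>) (t - T n \<omega>)) \<partial>P)"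
    by (rule nn_integral_suminf) (simp add: indicator_def, measurable)
  finally show ?thesis .
qed

text \<open>Conditioning on \<open>(T n, Z n)\<close> turns the event that segment \<open>n\<close>
  lasts longer than \<open>s\<close> into the survival probability. Fubini is applied twice, because
  \<open>markov\<close> is used with \<open>s\<close> fixed while \<open>discounted\<close>
  integrates over \<open>s\<close> with the path fixed.\<close>

lemma resolvent_term:
  assumes f[measurable]: "f \<in> borel_measurable borel"
  shows "(\<integral>\<^sup>+t. ennreal (exp (- t)) * indicator {0..} t *
      (\<integral>\<^sup>+\<omega>. indicator {T n \<omega>..<T (Suc n) \<omega>} t * f (\<phi> (Z n \<omega>) (t - T n \<omega>)) \<partial>P) \<partial>lborel) =
    (\<integral>\<^sup>+\<omega>. ennreal (exp (- T n \<omega>)) * discounted f (Z n \<omega>) \<partial>P)" (is "?lhs = ?rhs")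
proof -
  interpret LP: pair_sigma_finite lborel P
    unfolding pair_sigma_finite_def by (intro conjI lborel.sigma_finite_measure_axioms P.sigma_finite_measure_axioms)
  define a where "a t \<omega> = ennreal (exp (- t)) * indicator {0..} t *
    ((if T n \<omega> \<le> t \<and> t < T (Suc n) \<omega> then 1 else 0) * f (\<phi> (Z n \<omega>) (t - T n \<omega>)))" for t \<omega>
  define b where "b s \<omega> = ennreal (exp (- T n \<omega>)) * (ennreal (exp (- s)) * indicator {0..} s * f (\<phi> (Z n \<omega>) s))" for s \<omega>
  have [measurable]: "(\<lambda>(t, \<omega>). a t \<omega>) \<in> borel_measurable (lborel \<Otimes>\<^sub>M P)" unfolding a_def by measurable
  have a_meas[measurable]: "(\<lambda>\<omega>. a t \<omega>) \<in> borel_measurable P" for t unfolding a_def by measurable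
  have b_meas[measurable]: "(\<lambda>(s, \<omega>). b s \<omega>) \<in> borel_measurable (lborel \<Otimes>\<^sub>M P)"
    unfolding b_def by measurable
  have "?lhs = (\<integral>\<^sup>+t. \<integral>\<^sup>+\<omega>. a t \<omega> \<partial>P \<partial>lborel)"
  proof (rule nn_integral_cong)
    fix t
    have "(\<integral>\<^sup>+\<omega>. a t \<omega> \<partial>P) = ennreal (exp (- t)) * indicator {0..} t *
        (\<integral>\<^sup>+\<omega>. (if T n \<omega> \<le> t \<and> t < T (Suc n) \<omega> then 1 else 0) * f (\<phi> (Z n \<omega>) (t - T n \<omega>)) \<partial>P)"
      unfolding a_def by (rule nn_integral_cmult) measurable
    then show "ennreal (exp (- t)) * indicator {0..} t *
        (\<integral>\<^sup>+\<omega>. indicator {T n \<omega>..<T (Suc n) \<omega>} t * f (\<phi> (Z n \<omega>) (t - T n \<omega>)) \<partial>P) = (\<integral>\<^sup>+\<omega>. a t \<omega> \<partial>P)"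
      by (simp add: indicator_def of_bool_def)
  qed
  also have "\<dots> = (\<integral>\<^sup>+\<omega>. \<integral>\<^sup>+t. a t \<omega> \<partial>lborel \<partial>P)"
    by (rule LP.Fubini'[symmetric]) measurable
  \<comment> \<open>Substitution \<open>t = T n \<omega> + s\<close> on each path; since
    \<open>T n \<omega>\<close> is nonnegative, the condition \<open>T n \<omega> \<le> t\<close>
    already implies \<open>0 \<le> t\<close>.\<close>
  also have "\<dots> = (\<integral>\<^sup>+\<omega>. \<integral>\<^sup>+s. b s \<omega> * indicator ({s<..} \<times> UNIV) (T (Suc n) \<omega> - T n \<omega>, Z (Suc n) \<omega>) \<partial>lborel \<partial>P)"
  proof (rule nn_integral_cong_AE)
    show "AE \<omega> in P. (\<integral>\<^sup>+t. a t \<omega> \<partial>lborel) =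
        (\<integral>\<^sup>+s. b s \<omega> * indicator ({s<..} \<times> UNIV) (T (Suc n) \<omega> - T n \<omega>, Z (Suc n) \<omega>) \<partial>lborel)"
      using AE_path AE_space
    proof eventually_elim
      case (elim \<omega>)
      then have inc: "T m \<omega> < T (Suc m) \<omega>" for m by blast
      have "T 0 \<omega> \<le> T n \<omega>"
        by (rule lift_Suc_mono_le[of "\<lambda>n. T n \<omega>", OF less_imp_le[OF inc]]) simp
      with elim have T: "0 \<le> T n \<omega>" by simp
      have "(\<lambda>t. ennreal (exp (- t)) * indicator {0..} t * ((if r \<le> t \<and> t < r' then 1 else 0) * f (\<phi> z (t - r))))
          \<in> borel_measurable borel" for r r' z :: real
        by measurable
      then have a_\<omega>: "(\<lambda>t. a t \<omega>) \<in> borel_measurable borel" unfolding a_def .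
      have "(\<integral>\<^sup>+t. a t \<omega> \<partial>lborel) = (\<integral>\<^sup>+s. a (T n \<omega> + 1 * s) \<omega> \<partial>lborel)"
        using nn_integral_real_affine[OF a_\<omega>, of 1 "T n \<omega>"] by simp
      also have "\<dots> = (\<integral>\<^sup>+s. b s \<omega> * indicator ({s<..} \<times> UNIV) (T (Suc n) \<omega> - T n \<omega>, Z (Suc n) \<omega>) \<partial>lborel)"
      proof (rule nn_integral_cong)
        fix s
        have "ennreal (exp (- (T n \<omega> + s))) = ennreal (exp (- T n \<omega>)) * ennreal (exp (- s))"
          by (simp add: exp_add[symmetric] flip: ennreal_mult)
        then show "a (T n \<omega> + 1 * s) \<omega> =
            b s \<omega> * indicator ({s<..} \<times> UNIV) (T (Suc n) \<omega> - T n \<omega>, Z (Suc n) \<omega>)"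
          using T by (auto simp: a_def b_def indicator_def mult_ac)
      qed
      finally show ?case .
    qed
  qed
  also have "\<dots> = (\<integral>\<^sup>+s. \<integral>\<^sup>+\<omega>. b s \<omega> * indicator ({s<..} \<times> UNIV) (T (Suc n) \<omega> - T n \<omega>, Z (Suc n) \<omega>) \<partial>P \<partial>lborel)"
  proof (rule LP.Fubini')
    have "(\<lambda>(s, \<omega>). b s \<omega> * (if s < T (Suc n) \<omega> - T n \<omega> then 1 else 0)) \<in> borel_measurable (lborel \<Otimes>\<^sub>M P)"
      by measurable
    then show "(\<lambda>(s, \<omega>). b s \<omega> * indicator ({s<..} \<times> UNIV) (T (Suc n) \<omega> - T n \<omega>, Z (Suc n) \<omega>))
        \<in> borel_measurable (lborel \<Otimes>\<^sub>M P)"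
      by (simp add: indicator_def of_bool_def)
  qed
  \<comment> \<open>For fixed \<open>s\<close>, the factor \<open>b s\<close> depends on the path
    through \<open>T n\<close> and \<open>Z n\<close> only, so \<open>markov\<close> applies with
    the event that the waiting time exceeds \<open>s\<close>.\<close>
  also have "\<dots> = (\<integral>\<^sup>+s. \<integral>\<^sup>+\<omega>. b s \<omega> * jump_integral (indicator ({s<..} \<times> UNIV)) (Z n \<omega>) \<partial>P \<partial>lborel)"
  proof (rule nn_integral_cong)
    fix s
    let ?f = "\<lambda>p. ennreal (exp (- fst p)) * (ennreal (exp (- s)) * indicator {0..} s * f (\<phi> (snd p) s))"
    have "?f \<in> borel_measurable (borel \<Otimes>\<^sub>M borel)" by measurable
    moreover have "indicator ({s<..} \<times> UNIV) \<in> borel_measurable (borel \<Otimes>\<^sub>M borel :: (real \<times> real) measure)"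
      by measurable
    ultimately show "(\<integral>\<^sup>+\<omega>. b s \<omega> * indicator ({s<..} \<times> UNIV) (T (Suc n) \<omega> - T n \<omega>, Z (Suc n) \<omega>) \<partial>P) =
        (\<integral>\<^sup>+\<omega>. b s \<omega> * jump_integral (indicator ({s<..} \<times> UNIV)) (Z n \<omega>) \<partial>P)"
      using markov[of ?f "indicator ({s<..} \<times> UNIV)" n] unfolding b_def fst_conv snd_conv by blast
  qed
  also have "\<dots> = (\<integral>\<^sup>+s. \<integral>\<^sup>+\<omega>. b s \<omega> * (indicator {s. fdom (Z n \<omega>) s} s * ennreal (surv (Z n \<omega>) s)) \<partial>P \<partial>lborel)"
  proof (rule nn_integral_cong, rule nn_integral_cong_AE)
    fix s
    show "AE \<omega> in P. b s \<omega> * jump_integral (indicator ({s<..} \<times> UNIV)) (Z n \<omega>) =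
        b s \<omega> * (indicator {s. fdom (Z n \<omega>) s} s * ennreal (surv (Z n \<omega>) s))"
      using AE_Z_pos
    proof eventually_elim
      case (elim \<omega>)
      show ?case
      proof (cases "0 \<le> s")
        case True
        with elim show ?thesis by (simp add: jump_integral_after indicator_def)
      qed (simp add: b_def)
    qed
  qed
  also have "\<dots> = (\<integral>\<^sup>+\<omega>. \<integral>\<^sup>+s. b s \<omega> * (indicator {s. fdom (Z n \<omega>) s} s * ennreal (surv (Z n \<omega>) s)) \<partial>lborel \<partial>P)"
    by (rule LP.Fubini'[symmetric]) measurable
  also have "\<dots> = ?rhs"
  proof (rule nn_integral_cong)
    fix \<omega>
    have "(\<integral>\<^sup>+s. b s \<omega> * (indicator {s. fdom (Z n \<omega>) s} s * ennreal (surv (Z n \<omega>) s)) \<partial>lborel) =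
        (\<integral>\<^sup>+s. ennreal (exp (- T n \<omega>)) * (ennreal (exp (- s)) * ennreal (surv (Z n \<omega>) s) * f (\<phi> (Z n \<omega>) s) *
          indicator {s. fdom (Z n \<omega>) s} s) \<partial>lborel)"
      by (intro nn_integral_cong) (auto simp: b_def indicator_def mult_ac dest: fdom_pos)
    also have "\<dots> = ennreal (exp (- T n \<omega>)) * discounted f (Z n \<omega>)"
      unfolding discounted_def by (rule nn_integral_cmult) measurable
    finally show "(\<integral>\<^sup>+s. b s \<omega> * (indicator {s. fdom (Z n \<omega>) s} s * ennreal (surv (Z n \<omega>) s)) \<partial>lborel) =
        ennreal (exp (- T n \<omega>)) * discounted f (Z n \<omega>)" .
  qed
  finally show ?thesis .
qed

lemma resolvent_eq:
  assumes f[measurable]: "f \<in> borel_measurable borel"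
  shows "resolvent P X f = (\<Sum>n. \<integral>\<^sup>+\<omega>. ennreal (exp (- T n \<omega>)) * discounted f (Z n \<omega>) \<partial>P)"
proof -
  let ?I = "\<lambda>n t. \<integral>\<^sup>+\<omega>. indicator {T n \<omega>..<T (Suc n) \<omega>} t * f (\<phi> (Z n \<omega>) (t - T n \<omega>)) \<partial>P"
  have [measurable]: "(\<lambda>t. ?I n t) \<in> borel_measurable lborel" for n
  proof -
    have "(\<lambda>t. \<integral>\<^sup>+\<omega>. (if T n \<omega> \<le> t \<and> t < T (Suc n) \<omega> then 1 else 0) * f (\<phi> (Z n \<omega>) (t - T n \<omega>)) \<partial>P)
        \<in> borel_measurable lborel" by measurable
    then show ?thesis by (simp add: indicator_def of_bool_def)
  qed
  have "resolvent P X f = (\<integral>\<^sup>+t. (\<Sum>n. ennreal (exp (- t)) * indicator {0..} t * ?I n t) \<partial>lborel)"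
    unfolding resolvent_def
  proof (rule nn_integral_cong)
    fix t :: real
    show "ennreal (exp (- t)) * (\<integral>\<^sup>+\<omega>. f (X t \<omega>) \<partial>P) * indicator {0..} t =
        (\<Sum>n. ennreal (exp (- t)) * indicator {0..} t * ?I n t)"
      by (cases "0 \<le> t") (simp_all add: X_decompose[OF _ f])
  qed
  also have "\<dots> = (\<Sum>n. \<integral>\<^sup>+t. ennreal (exp (- t)) * indicator {0..} t * ?I n t \<partial>lborel)"
    by (rule nn_integral_suminf) measurable
  also have "\<dots> = (\<Sum>n. \<integral>\<^sup>+\<omega>. ennreal (exp (- T n \<omega>)) * discounted f (Z n \<omega>) \<partial>P)"
    by (simp only: resolvent_term[OF f])
  finally show ?thesis .
qed

text \<open>This is the term \<open>n = 0\<close> of the series, where \<open>T 0 = 0\<close> and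
  \<open>Z 0 = x\<close> almost surely.\<close>

lemma resolvent_ge_discounted:
  assumes f[measurable]: "f \<in> borel_measurable borel" and x: "AE \<omega> in P. Z 0 \<omega> = x"
  shows "discounted f x \<le> resolvent P X f"
proof -
  have "discounted f x = (\<integral>\<^sup>+\<omega>. discounted f x \<partial>P)" by (simp add: P.emeasure_space_1)
  also have "\<dots> = (\<integral>\<^sup>+\<omega>. ennreal (exp (- T 0 \<omega>)) * discounted f (Z 0 \<omega>) \<partial>P)"
    using x AE_path by (intro nn_integral_cong_AE, eventually_elim) simp
  also have "\<dots> \<le> (\<Sum>n. \<integral>\<^sup>+\<omega>. ennreal (exp (- T n \<omega>)) * discounted f (Z n \<omega>) \<partial>P)"
    using sum_le_suminf[of "\<lambda>n. \<integral>\<^sup>+\<omega>. ennreal (exp (- T n \<omega>)) * discounted f (Z n \<omega>) \<partial>P" "{0}"] by simp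
  finally show ?thesis by (simp add: resolvent_eq)
qed

text \<open>Weighted by \<open>exp (- T n)\<close>, the value of \<open>V\<close> after jump
  \<open>n + 1\<close> in \<open>step\<close> is the initial value for the next segment, so the
  one-jump inequalities telescope.\<close>

lemma resolvent_drift:
  assumes [measurable]: "V \<in> borel_measurable borel" "h \<in> borel_measurable borel" "k \<in> borel_measurable borel"
    and step: "\<And>z. 0 < z \<Longrightarrow> discounted h z + jump_integral (\<lambda>(s, y). ennreal (exp (- s)) * ennreal (V y)) z
      \<le> ennreal (V z) + discounted k z"
    and x: "AE \<omega> in P. Z 0 \<omega> = x"
  shows "resolvent P X h \<le> ennreal (V x) + resolvent P X k"
proof -
  define v where "v n = (\<integral>\<^sup>+\<omega>. ennreal (exp (- T n \<omega>)) * ennreal (V (Z n \<omega>)) \<partial>P)" for n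
  define w where "w n = (\<integral>\<^sup>+\<omega>. ennreal (exp (- T n \<omega>)) * discounted h (Z n \<omega>) \<partial>P)" for n
  define c where "c n = (\<integral>\<^sup>+\<omega>. ennreal (exp (- T n \<omega>)) * discounted k (Z n \<omega>) \<partial>P)" for n
  let ?J = "jump_integral (\<lambda>(s, y). ennreal (exp (- s)) * ennreal (V y))"
  have v_Suc: "v (Suc n) = (\<integral>\<^sup>+\<omega>. ennreal (exp (- T n \<omega>)) * ?J (Z n \<omega>) \<partial>P)" for n
  proof -
    have "v (Suc n) = (\<integral>\<^sup>+\<omega>. (\<lambda>p. ennreal (exp (- fst p))) (T n \<omega>, Z n \<omega>) *
        (\<lambda>(s, y). ennreal (exp (- s)) * ennreal (V y)) (T (Suc n) \<omega> - T n \<omega>, Z (Suc n) \<omega>) \<partial>P)"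
      unfolding v_def
    proof (rule nn_integral_cong)
      fix \<omega>
      have "ennreal (exp (- T (Suc n) \<omega>)) = ennreal (exp (- T n \<omega>)) * ennreal (exp (- (T (Suc n) \<omega> - T n \<omega>)))"
        by (simp add: exp_add[symmetric] flip: ennreal_mult)
      then show "ennreal (exp (- T (Suc n) \<omega>)) * ennreal (V (Z (Suc n) \<omega>)) =
          (\<lambda>p. ennreal (exp (- fst p))) (T n \<omega>, Z n \<omega>) *
          (\<lambda>(s, y). ennreal (exp (- s)) * ennreal (V y)) (T (Suc n) \<omega> - T n \<omega>, Z (Suc n) \<omega>)"
        by (simp add: mult.assoc)
    qed
    also have "\<dots> = (\<integral>\<^sup>+\<omega>. (\<lambda>p. ennreal (exp (- fst p))) (T n \<omega>, Z n \<omega>) * ?J (Z n \<omega>) \<partial>P)"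
      by (rule markov[where f="\<lambda>p. ennreal (exp (- fst p))" and h="\<lambda>(s, y). ennreal (exp (- s)) * ennreal (V y)"])
        measurable
    finally show ?thesis by simp
  qed
  have J[measurable]: "?J \<in> borel_measurable borel" by (rule measurable_jump_integral) measurable
  have step': "w n + v (Suc n) \<le> v n + c n" for n
  proof -
    have "w n + v (Suc n) = (\<integral>\<^sup>+\<omega>. ennreal (exp (- T n \<omega>)) * discounted h (Z n \<omega>) +
        ennreal (exp (- T n \<omega>)) * ?J (Z n \<omega>) \<partial>P)"
      unfolding w_def v_Suc by (rule nn_integral_add[symmetric]) measurable
    also have "\<dots> \<le> (\<integral>\<^sup>+\<omega>. ennreal (exp (- T n \<omega>)) * ennreal (V (Z n \<omega>)) +
        ennreal (exp (- T n \<omega>)) * discounted k (Z n \<omega>) \<partial>P)"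
    proof (rule nn_integral_mono_AE)
      show "AE \<omega> in P. ennreal (exp (- T n \<omega>)) * discounted h (Z n \<omega>) + ennreal (exp (- T n \<omega>)) * ?J (Z n \<omega>) \<le>
          ennreal (exp (- T n \<omega>)) * ennreal (V (Z n \<omega>)) + ennreal (exp (- T n \<omega>)) * discounted k (Z n \<omega>)"
        using AE_Z_pos
      proof eventually_elim
        case (elim \<omega>)
        then have "0 < Z n \<omega>" by blast
        from mult_left_mono[OF step[OF this], of "ennreal (exp (- T n \<omega>))"]
        show ?case by (simp only: distrib_left zero_le)
      qed
    qed
    also have "\<dots> = v n + c n"
      unfolding v_def c_def by (rule nn_integral_add) measurable
    finally show ?thesis .
  qed
  \<comment> \<open>The terms \<open>v N\<close> may be infinite and cannot be subtracted; the
    remainder \<open>v N\<close> stays on the left during the induction and is discarded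
    afterwards.\<close>
  have sum_le: "(\<Sum>n<N. w n) + v N \<le> v 0 + (\<Sum>n<N. c n)" for N
  proof (induction N)
    case (Suc N)
    have "(\<Sum>n<Suc N. w n) + v (Suc N) = (\<Sum>n<N. w n) + (w N + v (Suc N))" by (simp add: ac_simps)
    also have "\<dots> \<le> (\<Sum>n<N. w n) + (v N + c N)" by (intro add_left_mono step')
    also have "\<dots> = ((\<Sum>n<N. w n) + v N) + c N" by (simp add: ac_simps)
    also have "\<dots> \<le> (v 0 + (\<Sum>n<N. c n)) + c N" by (intro add_right_mono Suc)
    finally show ?case by (simp add: ac_simps)
  qed simp
  have v0: "v 0 = ennreal (V x)"
  proof -
    have "v 0 = (\<integral>\<^sup>+\<omega>. ennreal (V x) \<partial>P)" unfolding v_def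
      using x AE_path by (intro nn_integral_cong_AE, eventually_elim) simp
    then show ?thesis by (simp add: P.emeasure_space_1)
  qed
  have "(\<Sum>n<N. w n) \<le> ennreal (V x) + (\<Sum>n. c n)" for N
  proof -
    have "(\<Sum>n<N. w n) \<le> (\<Sum>n<N. w n) + v N" by simp
    also have "\<dots> \<le> v 0 + (\<Sum>n<N. c n)" by (rule sum_le)
    also have "\<dots> \<le> ennreal (V x) + (\<Sum>n. c n)"
      unfolding v0 by (intro add_left_mono sum_le_suminf) auto
    finally show ?thesis .
  qed
  then have "(\<Sum>n. w n) \<le> ennreal (V x) + (\<Sum>n. c n)"
    unfolding suminf_eq_SUP[of w] by (rule SUP_least)
  then show ?thesis unfolding w_def c_def by (simp add: resolvent_eq)
qed

end

section \<open>Stationary measures\<close>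

locale pdmp_coord_family = pdmp_coord +
  fixes P :: "real \<Rightarrow> 'w measure" and X :: "real \<Rightarrow> 'w \<Rightarrow> real"
  assumes family: "pdmp_family \<tau> \<beta> Q P X"
begin

lemma ex_path:
  assumes x: "0 < x"
  obtains T Z where "pdmp_path \<tau> H \<beta> B Q (P x) X T Z" "AE \<omega> in P x. Z 0 \<omega> = x"
proof -
  have pd: "pdmp \<tau> \<beta> Q (P x) X" and X0: "AE \<omega> in P x. X 0 \<omega> = x"
    using family x by (auto simp: pdmp_family_def)
  from pd obtain T Z where TZ:
    "\<forall>n. T n \<in> borel_measurable (P x) \<and> Z n \<in> borel_measurable (P x)"
    "AE \<omega> in P x. T 0 \<omega> = 0 \<and> (\<forall>n. T n \<omega> < T (Suc n) \<omega> \<and> 0 < Z n \<omega>) \<and>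
       filterlim (\<lambda>n. T n \<omega>) at_top sequentially"
    "AE \<omega> in P x. \<forall>n. \<forall>t\<in>{T n \<omega>..<T (Suc n) \<omega>}. X t \<omega> = flow \<tau> (Z n \<omega>) (t - T n \<omega>)"
    "\<forall>n A B'. (\<forall>k\<le>n. A k \<in> sets (borel \<Otimes>\<^sub>M borel)) \<longrightarrow> B' \<in> sets (borel \<Otimes>\<^sub>M borel) \<longrightarrow>
       emeasure (P x) {\<omega>\<in>space (P x). (\<forall>k\<le>n. (T k \<omega>, Z k \<omega>) \<in> A k) \<and>
         (T (Suc n) \<omega> - T n \<omega>, Z (Suc n) \<omega>) \<in> B'}
       = (\<integral>\<^sup>+\<omega>\<in>{\<omega>\<in>space (P x). \<forall>k\<le>n. (T k \<omega>, Z k \<omega>) \<in> A k}. jump_kernel \<tau> \<beta> Q (Z n \<omega>) B' \<partial>P x)"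
    unfolding pdmp_def by blast
  have "pdmp_path_axioms \<tau> \<beta> Q (P x) X T Z"
    unfolding pdmp_path_axioms_def using TZ pd unfolding pdmp_def by blast
  moreover have "prob_space (P x)" using pd by (simp add: pdmp_def)
  ultimately have "pdmp_path \<tau> H \<beta> B Q (P x) X T Z"
    by (intro pdmp_path.intro pdmp_coord_axioms)
  \<comment> \<open>Time 0 lies in the first segment, on which \<open>X 0\<close> is the flow from
    \<open>Z 0\<close> after time 0, hence \<open>Z 0\<close> itself; so the prescribed start passes
    to the skeleton.\<close>
  moreover have "AE \<omega> in P x. Z 0 \<omega> = x"
    using TZ(2,3) X0
  proof eventually_elim
    case (elim \<omega>)
    then have T0: "T 0 \<omega> = 0" and Z0: "0 < Z 0 \<omega>" by auto
    have "T 0 \<omega> < T (Suc 0) \<omega>" using elim(1) by blast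
    then have "0 \<in> {T 0 \<omega>..<T (Suc 0) \<omega>}" using T0 by simp
    then have "X 0 \<omega> = flow \<tau> (Z 0 \<omega>) (0 - T 0 \<omega>)" using elim(2) by blast
    with T0 Z0 elim(3) show ?case by (simp add: flow_eq)
  qed
  ultimately show thesis by (rule that)
qed

text \<open>The mass condition at each \<open>z\<close> comes from the process under
  \<open>P z\<close>: all starting points contribute to the analysis of the paths from a single
  \<open>x\<close>.\<close>

lemma ex_path_total:
  assumes x: "0 < x"
  obtains T Z where "pdmp_path_total \<tau> H \<beta> B Q (P x) X T Z" "AE \<omega> in P x. Z 0 \<omega> = x"
proof -
  have total: "(\<integral>\<^sup>+t. jump_density z t \<partial>lborel) = 1" if z: "0 < z" for z
  proof -
    obtain T Z where "pdmp_path \<tau> H \<beta> B Q (P z) X T Z" "AE \<omega> in P z. Z 0 \<omega> = z" by (rule ex_path[OF z])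
    then show ?thesis by (rule pdmp_path.jump_density_total)
  qed
  obtain T Z where path: "pdmp_path \<tau> H \<beta> B Q (P x) X T Z" and Z0: "AE \<omega> in P x. Z 0 \<omega> = x"
    by (rule ex_path[OF x])
  have "pdmp_path_total \<tau> H \<beta> B Q (P x) X T Z"
    by (rule pdmp_path_total.intro[OF path pdmp_path_total_axioms.intro]) (rule total)
  then show thesis using Z0 by (rule that)
qed

lemma prob_P: "0 < x \<Longrightarrow> prob_space (P x)"
  and X_meas: "0 < x \<Longrightarrow> 0 \<le> t \<Longrightarrow> X t \<in> borel_measurable (P x)"
  using family by (auto simp: pdmp_family_def pdmp_def)

text \<open>Total on \<open>\<real> \<times> \<real>\<close>: starting points are moved to \<open>1\<close> and times to \<open>0\<close> where meaningless.\<close>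

definition start :: "real \<Rightarrow> real" where "start x = (if 0 < x then x else 1)"

lemma start_pos[simp]: "0 < start x" and start_id: "0 < x \<Longrightarrow> start x = x"
  by (auto simp: start_def)

definition law :: "real \<Rightarrow> real \<Rightarrow> real measure" where
  "law x t = distr (P (start x)) borel (X (max 0 t))"

lemma \<phi>_less_iff: "fdom z t \<Longrightarrow> \<phi> z t < c \<longleftrightarrow> 0 < c \<and> H z + t < H c"
  using H_\<phi>[of z t] H_less_iff[of "\<phi> z t" c] \<phi>_pos[of z t] by (metis order_less_trans)

text \<open>Right-continuity alone would not decide the threshold event when
  \<open>X t \<omega> = a\<close>. The flow is increasing between jumps, so
  \<open>a \<le> X t \<omega>\<close> persists to the right; \<open>X t \<omega> < a\<close>
  persists by continuity, read off in the coordinate \<open>H\<close>.\<close>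

lemma X_right_continuous:
  assumes x: "0 < x" and t: "0 \<le> t" and d: "\<And>k. t \<le> d k" "d \<longlonglongrightarrow> t"
  shows "AE \<omega> in P x. \<forall>\<^sub>F k in sequentially. (a \<le> X (d k) \<omega>) = (a \<le> X t \<omega>)"
proof -
  obtain T Z where "pdmp_path_total \<tau> H \<beta> B Q (P x) X T Z" using ex_path_total[OF x] by blast
  then interpret path: pdmp_path_total \<tau> H \<beta> B Q "P x" X T Z .
  show ?thesis
    using path.AE_X
  proof eventually_elim
    case (elim \<omega>)
    then obtain n where n: "t \<in> {T n \<omega>..<T (Suc n) \<omega>}" using t by blast
    have X: "fdom (Z n \<omega>) (s - T n \<omega>) \<and> X s \<omega> = \<phi> (Z n \<omega>) (s - T n \<omega>)" if "s \<in> {T n \<omega>..<T (Suc n) \<omega>}" for s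
      using elim that by blast
    have ev: "\<forall>\<^sub>F k in sequentially. d k \<in> {T n \<omega>..<T (Suc n) \<omega>}"
      using order_tendstoD(2)[OF d(2), of "T (Suc n) \<omega>"] n d(1)
      by (auto elim!: eventually_mono intro: order_trans)
    show ?case
    proof (cases "a \<le> X t \<omega>")
      case True
      from ev show ?thesis
      proof eventually_elim
        case (elim k)
        have "X t \<omega> \<le> X (d k) \<omega>"
          using X[OF n] X[OF elim] d(1)[of k] H_\<phi>[of "Z n \<omega>" "t - T n \<omega>"] H_\<phi>[of "Z n \<omega>" "d k - T n \<omega>"]
            H_le_iff[of "\<phi> (Z n \<omega>) (t - T n \<omega>)" "\<phi> (Z n \<omega>) (d k - T n \<omega>)"] by simp
        with True show ?case by simp
      qed
    next
      case False
      then have a: "0 < a" "H (Z n \<omega>) + (t - T n \<omega>) < H a"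
        using \<phi>_less_iff[of "Z n \<omega>" "t - T n \<omega>" a] X[OF n] by auto
      have "\<forall>\<^sub>F k in sequentially. d k < H a - H (Z n \<omega>) + T n \<omega>"
        by (rule order_tendstoD(2)[OF d(2)]) (use a(2) in linarith)
      with ev show ?thesis
      proof eventually_elim
        case (elim k)
        then have "X (d k) \<omega> < a" using X[OF elim(1)] a(1) by (simp add: \<phi>_less_iff)
        with False show ?case by simp
      qed
    qed
  qed
qed

lemma measurable_P_start:
  assumes t: "0 \<le> t" and A: "A \<in> sets borel"
  shows "(\<lambda>x. emeasure (P (start x)) {\<omega>\<in>space (P (start x)). X t \<omega> \<in> A}) \<in> borel_measurable borel"
proof -
  have "start \<in> borel \<rightarrow>\<^sub>M restrict_space borel {0<..}"
    by (rule measurable_restrict_space2) (auto simp: start_def[abs_def])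
  moreover have "(\<lambda>x. emeasure (P x) {\<omega>\<in>space (P x). X t \<omega> \<in> A}) \<in> borel_measurable (restrict_space borel {0<..})"
    using family t A by (auto simp: pdmp_family_def)
  ultimately show ?thesis by (rule measurable_compose)
qed

text \<open>The family is measurable in \<open>x\<close> at each fixed time. The half-lines
  \<open>{a..}\<close> generate the Borel sets, and by \<open>X_right_continuous\<close> their
  probabilities converge along times decreasing to \<open>t\<close>; the joint law is thus a limit
  of measurable approximations.\<close>

lemma measurable_law: "(\<lambda>p. law (fst p) (snd p)) \<in> borel \<Otimes>\<^sub>M borel \<rightarrow>\<^sub>M prob_algebra borel"
proof (rule measurable_prob_algebra_generated[where \<Omega>=UNIV and G="range (\<lambda>a::real. {a..})"])
  show "sets (borel :: real measure) = sigma_sets UNIV (range (\<lambda>a::real. {a..}))"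
    by (subst borel_Ici) (simp add: sets_measure_of)
  show "Int_stable (range (\<lambda>a::real. {a..}))"
  proof (clarsimp simp: Int_stable_def)
    fix a b :: real
    have "{a..} \<inter> {b..} = {max a b..}" by auto
    then show "{a..} \<inter> {b..} \<in> range atLeast" by blast
  qed
  fix p :: "real \<times> real"
  show "prob_space (law (fst p) (snd p))"
    unfolding law_def by (intro prob_space.prob_space_distr prob_P X_meas) auto
  show "sets (law (fst p) (snd p)) = sets borel" by (simp add: law_def)
next
  fix A assume "A \<in> range (\<lambda>a::real. {a..})"
  then obtain a where A: "A = {a..}" by blast
  \<comment> \<open>\<open>max 0 t\<close> rounded up to a multiple of \<open>1 / (n + 1)\<close>:
    an approximation from the right with countably many values, so that measurability at fixed times
    is enough.\<close>
  define d where "d n t = real (nat \<lceil>max 0 t * real (Suc n)\<rceil>) / real (Suc n)" for n t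
  define e where "e s x = emeasure (P (start x)) {\<omega>\<in>space (P (start x)). X s \<omega> \<in> A}" for s x
  have d_bounds: "max 0 t \<le> d n t \<and> d n t \<le> max 0 t + 1 / real (Suc n)" for n t
  proof -
    define y N where "y = max 0 t" and "N = real (Suc n)"
    have N: "0 < N" and y: "0 \<le> y" by (auto simp: N_def y_def)
    have "0 \<le> y * N" using N y by simp
    then have "real (nat \<lceil>y * N\<rceil>) = of_int \<lceil>y * N\<rceil>" by simp
    then have "y * N \<le> real (nat \<lceil>y * N\<rceil>)" "real (nat \<lceil>y * N\<rceil>) \<le> y * N + 1" by linarith+
    then have "y \<le> real (nat \<lceil>y * N\<rceil>) / N \<and> real (nat \<lceil>y * N\<rceil>) / N \<le> y + 1 / N"
      using N by (simp add: field_simps)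
    then show ?thesis unfolding d_def y_def N_def .
  qed
  have d_lim: "(\<lambda>n. d n t) \<longlonglongrightarrow> max 0 t" for t
  proof (rule tendsto_sandwich[where f="\<lambda>_. max 0 t" and h="\<lambda>n. max 0 t + 1 / real (Suc n)"])
    show "(\<lambda>n. max 0 t + 1 / real (Suc n)) \<longlonglongrightarrow> max 0 t"
      using tendsto_add[OF tendsto_const LIMSEQ_Suc[OF lim_1_over_n]] by simp
    show "(\<lambda>n. max 0 t) \<longlonglongrightarrow> max 0 t" by simp
  qed (use d_bounds in auto)
  have meas: "(\<lambda>p. e (d n (snd p)) (fst p)) \<in> borel_measurable (borel \<Otimes>\<^sub>M borel)" for n
  proof -
    have e: "(\<lambda>p. e (real k / real (Suc n)) (fst p)) \<in> borel_measurable (borel \<Otimes>\<^sub>M borel)" for k :: nat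
      unfolding e_def using measurable_P_start[of "real k / real (Suc n)" A] A
      by (auto intro!: measurable_compose[OF measurable_fst])
    show ?thesis unfolding d_def by (rule measurable_compose_countable[OF e]) measurable
  qed
  have lim: "(\<lambda>n. e (d n t) x) \<longlonglongrightarrow> emeasure (law x t) A" for x t
  proof -
    let ?P = "P (start x)"
    have [measurable]: "X s \<in> borel_measurable ?P" if "0 \<le> s" for s using that by (simp add: X_meas)
    have ind: "emeasure ?P {\<omega>\<in>space ?P. X s \<omega> \<in> A} = (\<integral>\<^sup>+\<omega>. indicator A (X s \<omega>) \<partial>?P)" if s: "0 \<le> s" for s
    proof -
      have "X s -` A \<inter> space ?P \<in> sets ?P" by (rule measurable_sets[OF X_meas]) (use s A in auto)
      moreover have "X s -` A \<inter> space ?P = {\<omega>\<in>space ?P. X s \<omega> \<in> A}" by auto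
      ultimately have "emeasure ?P {\<omega>\<in>space ?P. X s \<omega> \<in> A} = (\<integral>\<^sup>+\<omega>. indicator {\<omega>\<in>space ?P. X s \<omega> \<in> A} \<omega> \<partial>?P)"
        by simp
      also have "\<dots> = (\<integral>\<^sup>+\<omega>. indicator A (X s \<omega>) \<partial>?P)" by (intro nn_integral_cong) (simp add: indicator_def)
      finally show ?thesis .
    qed
    have d0: "0 \<le> d n t" for n using d_bounds[of t n] by linarith
    have "(\<lambda>n. \<integral>\<^sup>+\<omega>. indicator A (X (d n t) \<omega>) \<partial>?P) \<longlonglongrightarrow> (\<integral>\<^sup>+\<omega>. indicator A (X (max 0 t) \<omega>) \<partial>?P)"
    proof (rule nn_integral_dominated_convergence[where w="\<lambda>_. 1"])
      show "(\<lambda>\<omega>. indicator A (X (d n t) \<omega>)) \<in> borel_measurable ?P" for n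
        using A d0 by (intro measurable_compose[OF X_meas borel_measurable_indicator]) auto
      show "(\<lambda>\<omega>. indicator A (X (max 0 t) \<omega>)) \<in> borel_measurable ?P"
        using A by (intro measurable_compose[OF X_meas borel_measurable_indicator]) auto
      show "(\<integral>\<^sup>+\<omega>. 1 \<partial>?P) < \<infinity>" using prob_space.emeasure_space_1[OF prob_P[OF start_pos]] by simp
      show "AE \<omega> in ?P. (\<lambda>n. indicator A (X (d n t) \<omega>)) \<longlonglongrightarrow> (indicator A (X (max 0 t) \<omega>) :: ennreal)"
        using X_right_continuous[of "start x" "max 0 t" "\<lambda>n. d n t" a, OF start_pos _ _ d_lim] d_bounds
        by (auto simp: A indicator_def elim!: eventually_mono intro!: tendsto_eventually)
    qed (auto simp: indicator_def)
    moreover have "emeasure (law x t) A = (\<integral>\<^sup>+\<omega>. indicator A (X (max 0 t) \<omega>) \<partial>?P)"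
      unfolding law_def using A ind[of "max 0 t"]
      by (subst emeasure_distr) (auto simp: X_meas vimage_def Int_def conj_commute)
    ultimately show ?thesis unfolding e_def ind[OF d0] by simp
  qed
  show "(\<lambda>p. emeasure (law (fst p) (snd p)) A) \<in> borel_measurable (borel \<Otimes>\<^sub>M borel)"
    by (rule borel_measurable_LIMSEQ_order[OF lim meas])
qed auto

lemma measurable_law_integral[measurable]:
  assumes [measurable]: "f \<in> borel_measurable borel" "u \<in> borel_measurable M" "v \<in> borel_measurable M"
  shows "(\<lambda>p. \<integral>\<^sup>+y. f y \<partial>law (u p) (v p)) \<in> borel_measurable M"
proof -
  have "(\<lambda>p. law (u p) (v p)) \<in> M \<rightarrow>\<^sub>M subprob_algebra borel"
    using measurable_compose[OF measurable_Pair measurable_prob_algebraD[OF measurable_law], of u M v] by simp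
  then show ?thesis by (rule measurable_compose) (rule nn_integral_measurable_subprob_algebra[OF assms(1)])
qed

lemma law_integral:
  assumes "0 < x" "0 \<le> t" "f \<in> borel_measurable borel"
  shows "(\<integral>\<^sup>+y. f y \<partial>law x t) = (\<integral>\<^sup>+\<omega>. f (X t \<omega>) \<partial>P x)"
  using assms unfolding law_def by (subst nn_integral_distr) (auto simp: X_meas start_id max_def)

text \<open>The resolvent as a kernel. Building it on \<open>law\<close> makes it measurable in
  \<open>x\<close>, so that it can be integrated against \<pi>.\<close>

definition res :: "(real \<Rightarrow> ennreal) \<Rightarrow> real \<Rightarrow> ennreal" where
  "res f x = (\<integral>\<^sup>+t\<in>{0..}. ennreal (exp (- t)) * (\<integral>\<^sup>+y. f y \<partial>law x t) \<partial>lborel)"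

lemma res_eq: "0 < x \<Longrightarrow> f \<in> borel_measurable borel \<Longrightarrow> res f x = resolvent (P x) X f"
  unfolding res_def resolvent_def
  by (intro nn_integral_cong) (auto simp: law_integral indicator_def)

lemma measurable_res[measurable]:
  assumes [measurable]: "f \<in> borel_measurable borel"
  shows "res f \<in> borel_measurable borel"
  unfolding res_def[abs_def] by measurable

lemma sets_law[simp]: "sets (law x t) = sets borel"
  by (simp add: law_def)

lemma borel_measurable_law: "f \<in> borel_measurable borel \<Longrightarrow> f \<in> borel_measurable (law x t)"
  using measurable_cong_sets[OF sets_law refl] by blast

lemma res_add:
  assumes [measurable]: "f \<in> borel_measurable borel" "g \<in> borel_measurable borel"
  shows "res (\<lambda>y. f y + g y) x = res f x + res g x"
proof -
  have "res (\<lambda>y. f y + g y) x = (\<integral>\<^sup>+t. ennreal (exp (- t)) * (\<integral>\<^sup>+y. f y \<partial>law x t) * indicator {0..} t +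
      ennreal (exp (- t)) * (\<integral>\<^sup>+y. g y \<partial>law x t) * indicator {0..} t \<partial>lborel)"
    unfolding res_def
    by (intro nn_integral_cong, subst nn_integral_add) (auto intro: borel_measurable_law simp: distrib_left distrib_right)
  also have "\<dots> = res f x + res g x"
    unfolding res_def by (rule nn_integral_add) measurable
  finally show ?thesis .
qed

lemma res_mono: "(\<And>y. f y \<le> g y) \<Longrightarrow> res f x \<le> res g x"
  unfolding res_def by (intro nn_integral_mono mult_right_mono mult_left_mono) auto

lemma exp_total: "(\<integral>\<^sup>+t\<in>{0..}. ennreal (exp (- t)) \<partial>lborel) = 1"
proof -
  have "((\<lambda>t::real. - exp (- t)) \<longlongrightarrow> 0) at_top"
    using tendsto_minus[OF filterlim_compose[OF exp_at_bot filterlim_uminus_at_bot_at_top]] by simp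
  then have "(\<integral>\<^sup>+t\<in>{0..}. ennreal (exp (- t)) \<partial>lborel) = 0 - (- exp (- 0 :: real))"
    by (intro nn_integral_FTC_atLeast) (auto intro!: derivative_eq_intros)
  then show ?thesis by simp
qed

lemma res_const: "res (\<lambda>_. c) x = c"
proof -
  have "(\<integral>\<^sup>+y. c \<partial>law x t) = c" for t
  proof -
    interpret prob_space "law x t"
      unfolding law_def by (intro prob_space.prob_space_distr prob_P X_meas) auto
    show ?thesis by (simp add: emeasure_space_1)
  qed
  then have "res (\<lambda>_. c) x = (\<integral>\<^sup>+t. ennreal (exp (- t)) * indicator {0..} t * c \<partial>lborel)"
    unfolding res_def by (intro nn_integral_cong) (simp add: mult_ac)
  also have "\<dots> = c" by (subst nn_integral_multc) (auto simp: exp_total)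
  finally show ?thesis .
qed

end

section \<open>Invariance of the stationary measure, local finiteness and the integrated drift
  inequality\<close>

locale pdmp_stationary = pdmp_coord_family +
  fixes \<pi> :: "real measure"
  assumes stationary: "stationary_measure P X \<pi>"
begin

lemma sets_\<pi>[simp, measurable_cong]: "sets \<pi> = sets borel"
  and sigma_finite_\<pi>: "sigma_finite_measure \<pi>"
  using stationary by (auto simp: stationary_measure_def)

lemma space_\<pi>[simp]: "space \<pi> = UNIV"
  using sets_eq_imp_space_eq[OF sets_\<pi>] by simp

lemma AE_\<pi>_pos: "AE x in \<pi>. 0 < x"
proof (rule AE_I')
  show "{..0} \<in> null_sets \<pi>" using stationary by (auto simp: null_sets_def stationary_measure_def)
qed auto

lemma nn_integral_\<pi>_pos: "(\<integral>\<^sup>+x\<in>{0<..}. f x \<partial>\<pi>) = (\<integral>\<^sup>+x. f x \<partial>\<pi>)"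
  using AE_\<pi>_pos by (intro nn_integral_cong_AE, eventually_elim) simp

lemma measurable_law_\<pi>: "(\<lambda>x. law x t) \<in> \<pi> \<rightarrow>\<^sub>M subprob_algebra borel"
proof -
  have "(\<lambda>x. (x, t)) \<in> \<pi> \<rightarrow>\<^sub>M borel \<Otimes>\<^sub>M borel" by measurable
  from measurable_compose[OF this measurable_prob_algebraD[OF measurable_law]] show ?thesis by simp
qed

text \<open>Stationarity is given on sets; read as an identity of measures,
  \<open>\<pi> \<bind> (\<lambda>x. law x t) = \<pi>\<close>, it extends to nonnegative
  functions.\<close>

lemma integral_law_\<pi>:
  assumes t: "0 \<le> t" and f[measurable]: "f \<in> borel_measurable borel"
  shows "(\<integral>\<^sup>+x. (\<integral>\<^sup>+y. f y \<partial>law x t) \<partial>\<pi>) = (\<integral>\<^sup>+x. f x \<partial>\<pi>)"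
proof -
  have "\<pi> \<bind> (\<lambda>x. law x t) = \<pi>"
  proof (rule measure_eqI)
    show "sets (\<pi> \<bind> (\<lambda>x. law x t)) = sets \<pi>"
      using sets_bind[of \<pi> "\<lambda>x. law x t" borel] by simp
    fix A assume "A \<in> sets (\<pi> \<bind> (\<lambda>x. law x t))"
    then have A: "A \<in> sets borel" using sets_bind[of \<pi> "\<lambda>x. law x t" borel] by simp
    have "emeasure (\<pi> \<bind> (\<lambda>x. law x t)) A = (\<integral>\<^sup>+x. emeasure (law x t) A \<partial>\<pi>)"
      by (rule emeasure_bind[OF _ measurable_law_\<pi> A]) simp
    also have "\<dots> = (\<integral>\<^sup>+x\<in>{0<..}. emeasure (law x t) A \<partial>\<pi>)"
      by (rule nn_integral_\<pi>_pos[symmetric])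
    also have "\<dots> = (\<integral>\<^sup>+x\<in>{0<..}. emeasure (P x) {\<omega>\<in>space (P x). X t \<omega> \<in> A} \<partial>\<pi>)"
    proof (rule nn_integral_cong)
      fix x
      show "emeasure (law x t) A * indicator {0<..} x =
          emeasure (P x) {\<omega>\<in>space (P x). X t \<omega> \<in> A} * indicator {0<..} x"
      proof (cases "0 < x")
        case True
        then have "emeasure (law x t) A = emeasure (P x) (X t -` A \<inter> space (P x))"
          using t A by (simp add: law_def start_id emeasure_distr X_meas max_def)
        moreover have "X t -` A \<inter> space (P x) = {\<omega>\<in>space (P x). X t \<omega> \<in> A}" by auto
        ultimately show ?thesis by simp
      qed simp
    qed
    also have "\<dots> = emeasure \<pi> A" using stationary t A by (simp add: stationary_measure_def)
    finally show "emeasure (\<pi> \<bind> (\<lambda>x. law x t)) A = emeasure \<pi> A" .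
  qed
  then show ?thesis using nn_integral_bind[OF f measurable_law_\<pi>] by metis
qed

text \<open>The invariance at fixed times is averaged over an exponential time of rate 1;
  \<sigma>-finiteness of \<pi> enters through Fubini.\<close>

lemma integral_res_\<pi>:
  assumes f[measurable]: "f \<in> borel_measurable borel"
  shows "(\<integral>\<^sup>+x. res f x \<partial>\<pi>) = (\<integral>\<^sup>+x. f x \<partial>\<pi>)"
proof -
  interpret LP: pair_sigma_finite lborel \<pi>
    unfolding pair_sigma_finite_def by (intro conjI lborel.sigma_finite_measure_axioms sigma_finite_\<pi>)
  have "(\<integral>\<^sup>+x. res f x \<partial>\<pi>) =
      (\<integral>\<^sup>+x. \<integral>\<^sup>+t. ennreal (exp (- t)) * indicator {0..} t * (\<integral>\<^sup>+y. f y \<partial>law x t) \<partial>lborel \<partial>\<pi>)"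
    unfolding res_def by (intro nn_integral_cong) (simp add: mult_ac)
  also have "\<dots> = (\<integral>\<^sup>+t. \<integral>\<^sup>+x. ennreal (exp (- t)) * indicator {0..} t * (\<integral>\<^sup>+y. f y \<partial>law x t) \<partial>\<pi> \<partial>lborel)"
    by (rule LP.Fubini') measurable
  also have "\<dots> = (\<integral>\<^sup>+t. ennreal (exp (- t)) * indicator {0..} t * (\<integral>\<^sup>+x. f x \<partial>\<pi>) \<partial>lborel)"
  proof (rule nn_integral_cong)
    fix t
    have "(\<integral>\<^sup>+x. ennreal (exp (- t)) * indicator {0..} t * (\<integral>\<^sup>+y. f y \<partial>law x t) \<partial>\<pi>) =
        ennreal (exp (- t)) * indicator {0..} t * (\<integral>\<^sup>+x. (\<integral>\<^sup>+y. f y \<partial>law x t) \<partial>\<pi>)"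
      by (rule nn_integral_cmult) measurable
    then show "(\<integral>\<^sup>+x. ennreal (exp (- t)) * indicator {0..} t * (\<integral>\<^sup>+y. f y \<partial>law x t) \<partial>\<pi>) =
        ennreal (exp (- t)) * indicator {0..} t * (\<integral>\<^sup>+x. f x \<partial>\<pi>)"
      by (cases "0 \<le> t") (simp_all add: integral_law_\<pi>)
  qed
  also have "\<dots> = (\<integral>\<^sup>+t\<in>{0..}. ennreal (exp (- t)) \<partial>lborel) * (\<integral>\<^sup>+x. f x \<partial>\<pi>)"
    by (rule nn_integral_multc) measurable
  also have "\<dots> = (\<integral>\<^sup>+x. f x \<partial>\<pi>)" by (simp add: exp_total)
  finally show ?thesis .
qed

lemma res_ge_discounted:
  assumes x: "0 < x" and f: "f \<in> borel_measurable borel"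
  shows "discounted f x \<le> res f x"
proof -
  obtain T Z where path: "pdmp_path_total \<tau> H \<beta> B Q (P x) X T Z" and Z0: "AE \<omega> in P x. Z 0 \<omega> = x"
    by (rule ex_path_total[OF x])
  show ?thesis
    using pdmp_path_total.resolvent_ge_discounted[OF path f Z0] res_eq[OF x f] by simp
qed

text \<open>
  Paths that do not jump move through any window \<open>{r'..r'+1}\<close> above \<open>{r..r'}\<close> with a probability
  that is bounded below, so \<open>\<pi> A\<close> dominates a multiple of \<open>\<pi> {r..r'}\<close> for every \<open>A\<close> that
  meets the window in a set of positive measure; \<open>\<sigma>\<close>-finiteness provides such an \<open>A\<close>.
\<close>

lemma emeasure_\<pi>_compact_interval:
  assumes r: "0 < r" "r \<le> r'"
  shows "emeasure \<pi> {r..r'} < \<infinity>"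
proof -
  interpret \<pi>: sigma_finite_measure \<pi> by (rule sigma_finite_\<pi>)
  have r': "0 < r'" using r by simp
  define l where "l = H (r' + 1) - H r'"
  have l: "0 < l" using H_strict[of r' "r' + 1"] r' by (simp add: l_def)
  \<comment> \<open>The time that the flow from \<open>r'\<close> spends in \<open>A\<close> on its
    way to \<open>r' + 1\<close>; the whole passage takes time \<open>l\<close>.\<close>
  define m where "m A = (\<integral>\<^sup>+v\<in>{0..l}. indicator A (\<phi> r' v) \<partial>lborel)" for A
  have D: "fdom r' v" and le: "\<phi> r' v \<le> r' + 1" if v: "v \<in> {0..l}" for v
  proof -
    have "H (r' + 1) = H r' + l" by (simp add: l_def)
    then have "fdom r' l" using \<phi>_eqI[of r' l "r' + 1"] r' l by linarith
    then show Dv: "fdom r' v" by (rule fdom_mono) (use v in auto)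
    show "\<phi> r' v \<le> r' + 1" unfolding \<phi>_le_iff[OF Dv] using v r' by (simp add: l_def)
  qed
  obtain A :: "nat \<Rightarrow> real set" where A: "range A \<subseteq> sets \<pi>" "(\<Union>i. A i) = space \<pi>"
    "\<And>i. emeasure \<pi> (A i) \<noteq> \<infinity>" "incseq A" using \<pi>.sigma_finite_incseq by blast
  have A_meas[measurable]: "A i \<in> sets borel" for i using A(1) by auto
  have "\<exists>i. m (A i) \<noteq> 0"
  proof (rule ccontr)
    assume "\<not> (\<exists>i. m (A i) \<noteq> 0)"
    then have zero: "(\<integral>\<^sup>+v. indicator (A i) (\<phi> r' v) * indicator {0..l} v \<partial>lborel) = 0" for i
      by (simp add: m_def)
    have "(\<lambda>v. indicator (A i) (\<phi> r' v) * indicator {0..l} v :: ennreal) \<in> borel_measurable lborel" for i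
      by measurable
    from nn_integral_0_iff_AE[OF this] zero
    have "AE v in lborel. indicator (A i) (\<phi> r' v) * indicator {0..l} v = (0::ennreal)" for i by blast
    then have "AE v in lborel. \<forall>i. indicator (A i) (\<phi> r' v) * indicator {0..l} v = (0::ennreal)"
      by (intro AE_all_countable[THEN iffD2] allI)
    then have "AE v in lborel. v \<notin> {0..l}"
    proof eventually_elim
      case (elim v)
      have "\<phi> r' v \<in> (\<Union>i. A i)" using A(2) by simp
      then obtain i where "\<phi> r' v \<in> A i" by blast
      with elim show ?case by (auto simp: indicator_def split: if_splits)
    qed
    then have "(\<integral>\<^sup>+v. indicator {0..l} v \<partial>lborel) = (\<integral>\<^sup>+v. 0 \<partial>(lborel :: real measure))"
      by (intro nn_integral_cong_AE, eventually_elim) (simp add: indicator_def)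
    with l show False by simp
  qed
  then obtain i where i: "m (A i) \<noteq> 0" by blast
  \<comment> \<open>From a start in \<open>{r..r'}\<close>, level \<open>r' + 1\<close> is reached
    within time \<open>H (r' + 1) - H r\<close>, and survival up to there is at least
    \<open>exp (B r - B (r' + 1))\<close>. The constant multiplies the two worst cases.\<close>
  define c where "c = exp (- (H (r' + 1) - H r)) * exp (B r - B (r' + 1))"
  have c: "0 < c" by (simp add: c_def)
  have low: "ennreal c * m (A i) \<le> discounted (indicator (A i)) x" if x: "x \<in> {r..r'}" for x
  proof -
    have x0: "0 < x" using x r by simp
    have Hx: "H r \<le> H x" "H x \<le> H r'" using x r x0 r' by (auto simp: H_le_iff)
    let ?g = "\<lambda>s. ennreal (exp (- s)) * ennreal (surv x s) * indicator (A i) (\<phi> x s) * indicator {s. fdom x s} s"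
    have "ennreal c * m (A i) = (\<integral>\<^sup>+v. ennreal c * (indicator (A i) (\<phi> r' v) * indicator {0..l} v) \<partial>lborel)"
      unfolding m_def by (rule nn_integral_cmult[symmetric]) measurable
    \<comment> \<open>The flow from \<open>x\<close> takes time \<open>H r' - H x\<close> to reach
      \<open>r'\<close> and then coincides with the flow from \<open>r'\<close>. Shifting time by
      this amount makes the lower bound independent of \<open>x\<close>.\<close>
    also have "\<dots> \<le> (\<integral>\<^sup>+v. ?g ((H r' - H x) + 1 * v) \<partial>lborel)"
    proof (rule nn_integral_mono)
      fix v
      show "ennreal c * (indicator (A i) (\<phi> r' v) * indicator {0..l} v) \<le> ?g ((H r' - H x) + 1 * v)"
      proof (cases "v \<in> {0..l}")
        case True
        let ?s = "H r' - H x + v"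
        have s: "fdom x ?s \<and> \<phi> x ?s = \<phi> r' v"
          by (rule \<phi>_eqI) (use x0 Hx True H_\<phi>[OF D[OF True]] in auto)
        have "?s \<le> H (r' + 1) - H r" using True Hx by (simp add: l_def)
        moreover have "B r \<le> B x" using x r by (intro B_mono) auto
        moreover have "B (\<phi> r' v) \<le> B (r' + 1)" using le[OF True] by (intro B_mono) auto
        ultimately have "c \<le> exp (- ?s) * surv x ?s"
          unfolding c_def surv_def using s by (intro mult_mono) auto
        then have "ennreal c \<le> ennreal (exp (- ?s)) * ennreal (surv x ?s)"
          by (simp add: ennreal_leI flip: ennreal_mult)
        then have "ennreal c * indicator (A i) (\<phi> r' v) \<le>
            ennreal (exp (- ?s)) * ennreal (surv x ?s) * indicator (A i) (\<phi> r' v)"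
          by (rule mult_right_mono) simp
        then show ?thesis using True s by simp
      qed simp
    qed
    also have "\<dots> = (\<integral>\<^sup>+s. ?g s \<partial>lborel)"
    proof -
      have "?g \<in> borel_measurable borel" by measurable
      from nn_integral_real_affine[OF this, of 1 "H r' - H x"] show ?thesis by simp
    qed
    finally show ?thesis by (simp add: discounted_def)
  qed
  have "ennreal c * m (A i) * emeasure \<pi> {r..r'} = (\<integral>\<^sup>+x. ennreal c * m (A i) * indicator {r..r'} x \<partial>\<pi>)"
    by (simp add: nn_integral_cmult_indicator)
  also have "\<dots> \<le> (\<integral>\<^sup>+x. res (indicator (A i)) x \<partial>\<pi>)"
  proof (rule nn_integral_mono)
    fix x
    show "ennreal c * m (A i) * indicator {r..r'} x \<le> res (indicator (A i)) x"
    proof (cases "x \<in> {r..r'}")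
      case True
      have "ennreal c * m (A i) \<le> discounted (indicator (A i)) x" by (rule low[OF True])
      also have "\<dots> \<le> res (indicator (A i)) x" using True r by (intro res_ge_discounted) auto
      finally show ?thesis using True by simp
    qed simp
  qed
  also have "\<dots> = (\<integral>\<^sup>+x. indicator (A i) x \<partial>\<pi>)" by (rule integral_res_\<pi>) simp
  also have "\<dots> < \<infinity>" using A(3)[of i] by (simp add: less_top)
  finally have "ennreal c * m (A i) * emeasure \<pi> {r..r'} < \<infinity>" .
  moreover have "ennreal c * m (A i) \<noteq> 0" using c i by simp
  ultimately show ?thesis by (auto simp: ennreal_mult_less_top less_top)
qed

text \<open>
  Since \<open>V\<close> need not be \<open>\<pi>\<close>-integrable, the drift inequality is integrated for the truncations
  \<open>(n - V)\<^sup>+\<close>, which are supported in compact intervals.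
\<close>

lemma stationary_drift:
  fixes V V' :: "real \<Rightarrow> real" and W :: "real \<Rightarrow> ennreal"
  assumes V_deriv: "\<And>x. 0 < x \<Longrightarrow> (V has_real_derivative V' x) (at x)"
    and V'_cont: "continuous_on {0<..} V'"
    and V_nonneg: "\<And>x. 0 < x \<Longrightarrow> 0 \<le> V x"
    and V_meas[measurable]: "V \<in> borel_measurable borel" and W_meas[measurable]: "W \<in> borel_measurable borel"
    and r: "0 < r" "r \<le> R" and C: "0 \<le> C"
    and nonneg: "\<And>x. 0 < x \<Longrightarrow> 0 \<le> V x + \<beta> x * V x - \<tau> x * V' x + C * indicator {r..R} x"
    and drift: "\<And>x. 0 < x \<Longrightarrow> (ennreal (V x) + W x) + ennreal (\<beta> x) * (\<integral>\<^sup>+y. ennreal (V (x * y)) \<partial>Q x)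
        \<le> ennreal (V x + \<beta> x * V x - \<tau> x * V' x + C * indicator {r..R} x)"
    and sublevel: "\<And>n::nat. \<exists>s S. 0 < s \<and> s \<le> S \<and> (\<forall>x>0. V x \<le> real n \<longrightarrow> x \<in> {s..S})"
  shows "(\<integral>\<^sup>+x. W x \<partial>\<pi>) < \<infinity>"
proof -
  define k where "k x = C * indicator {r..R} x" for x :: real
  have k_meas[measurable]: "k \<in> borel_measurable borel" unfolding k_def[abs_def] by measurable
  have k_bd: "0 \<le> k x \<and> k x \<le> C" for x using C by (simp add: k_def indicator_def)
  have res_drift: "res (\<lambda>y. ennreal (V y)) x + res W x \<le> ennreal (V x) + res (\<lambda>y. ennreal (k y)) x"
    if x: "0 < x" for x
  proof -
    obtain T Z where path: "pdmp_path_total \<tau> H \<beta> B Q (P x) X T Z" and Z0: "AE \<omega> in P x. Z 0 \<omega> = x"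
      by (rule ex_path_total[OF x])
    have h_meas: "(\<lambda>y. ennreal (V y) + W y) \<in> borel_measurable borel" by measurable
    have k_meas': "(\<lambda>y. ennreal (k y)) \<in> borel_measurable borel" by measurable
    have step: "discounted (\<lambda>y. ennreal (V y) + W y) z + jump_integral (\<lambda>(s, y). ennreal (exp (- s)) * ennreal (V y)) z
        \<le> ennreal (V z) + discounted (\<lambda>x. ennreal (k x)) z" if z: "0 < z" for z
      by (rule discounted_step[where V'=V' and c=C])
        (use V_deriv V'_cont V_nonneg V_meas h_meas k_meas k_bd nonneg drift z in \<open>simp_all add: k_def\<close>)
    have "resolvent (P x) X (\<lambda>y. ennreal (V y) + W y) \<le> ennreal (V x) + resolvent (P x) X (\<lambda>y. ennreal (k y))"
      by (rule pdmp_path_total.resolvent_drift[OF path V_meas h_meas k_meas' step Z0])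
    then have "res (\<lambda>y. ennreal (V y) + W y) x \<le> ennreal (V x) + res (\<lambda>y. ennreal (k y)) x"
      using res_eq[OF x h_meas] res_eq[OF x k_meas'] by simp
    then show ?thesis by (simp add: res_add)
  qed
  \<comment> \<open>As \<open>ennreal\<close> sends negative numbers to 0, this is the truncation
    \<open>max 0 (n - V y)\<close>.\<close>
  define g where "g n y = ennreal (real n - V y)" for n :: nat and y
  have [measurable]: "g n \<in> borel_measurable borel" for n unfolding g_def[abs_def] by measurable
  define S where "S n = {x. 0 < x \<and> V x \<le> real n}" for n :: nat
  have [measurable]: "S n \<in> sets borel" for n unfolding S_def by measurable
  \<comment> \<open>Where \<open>V x \<le> n\<close>, one has \<open>V x + g n x = n\<close>, and
    \<open>n = res n \<le> res (g n) + res V\<close> since the resolvent preserves constants. Adding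
    \<open>res_drift\<close> and cancelling the finite number \<open>V x\<close> gives the claim;
    elsewhere the left side is 0.\<close>
  have pointwise: "g n x + res W x * indicator (S n) x \<le> res (g n) x + res (\<lambda>y. ennreal (k y)) x"
    if x: "0 < x" for n x
  proof (cases "x \<in> S n")
    case True
    have "ennreal (V x) + (g n x + res W x) = ennreal (real n) + res W x"
      using True V_nonneg[OF x] by (simp add: g_def S_def add.assoc[symmetric] flip: ennreal_plus)
    also have "ennreal (real n) = res (\<lambda>_. ennreal (real n)) x" by (simp add: res_const)
    also have "\<dots> \<le> res (\<lambda>y. g n y + ennreal (V y)) x"
    proof (rule res_mono)
      fix y
      show "ennreal (real n) \<le> g n y + ennreal (V y)"
      proof (cases "0 \<le> V y")
        case True
        then have "ennreal (real n) \<le> ennreal (max 0 (real n - V y) + V y)" by (intro ennreal_leI) simp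
        also have "\<dots> = g n y + ennreal (V y)"
          using True by (simp add: g_def max_def ennreal_neg)
        finally show ?thesis .
      next
        case False
        then have "ennreal (real n) \<le> g n y" unfolding g_def by (intro ennreal_leI) simp
        then show ?thesis by (rule order_trans) simp
      qed
    qed
    also have "\<dots> + res W x = res (g n) x + (res (\<lambda>y. ennreal (V y)) x + res W x)"
      by (simp add: res_add add.assoc)
    also have "\<dots> \<le> res (g n) x + (ennreal (V x) + res (\<lambda>y. ennreal (k y)) x)"
      by (intro add_left_mono res_drift x)
    also have "\<dots> = ennreal (V x) + (res (g n) x + res (\<lambda>y. ennreal (k y)) x)" by (simp add: ac_simps)
    finally show ?thesis using True by (simp add: ennreal_add_left_cancel_le add_right_mono)
  next
    case False
    then have "g n x = 0" using x by (simp add: g_def S_def ennreal_neg)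
    with False show ?thesis by simp
  qed
  \<comment> \<open>\<open>g n\<close> and \<open>res (g n)\<close> have the same \<pi>-integral. It
    is finite, because \<open>g n\<close> is at most \<open>n\<close> and vanishes off a compact
    interval almost everywhere, so it cancels and leaves a bound uniform in
    \<open>n\<close>.\<close>
  have bound: "(\<integral>\<^sup>+x. res W x * indicator (S n) x \<partial>\<pi>) \<le> (\<integral>\<^sup>+x. ennreal (k x) \<partial>\<pi>)" for n
  proof -
    obtain s s' where s: "0 < s" "s \<le> s'" "\<And>x. 0 < x \<Longrightarrow> V x \<le> real n \<Longrightarrow> x \<in> {s..s'}"
      using sublevel[of n] by blast
    have "(\<integral>\<^sup>+x. g n x \<partial>\<pi>) \<le> (\<integral>\<^sup>+x. ennreal (real n) * indicator {s..s'} x \<partial>\<pi>)"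
      using AE_\<pi>_pos
    proof (intro nn_integral_mono_AE, eventually_elim)
      case (elim x)
      show ?case
      proof (cases "V x \<le> real n")
        case True
        with s(3)[OF elim(2) True] V_nonneg[OF elim(2)] show ?thesis by (simp add: g_def ennreal_leI)
      qed (simp add: g_def ennreal_neg)
    qed
    also have "\<dots> = ennreal (real n) * emeasure \<pi> {s..s'}" by (simp add: nn_integral_cmult_indicator)
    also have "\<dots> < \<infinity>" using emeasure_\<pi>_compact_interval[OF s(1,2)] by (simp add: ennreal_mult_less_top)
    finally have fin: "(\<integral>\<^sup>+x. g n x \<partial>\<pi>) < \<infinity>" .
    have "(\<integral>\<^sup>+x. g n x \<partial>\<pi>) + (\<integral>\<^sup>+x. res W x * indicator (S n) x \<partial>\<pi>) =
        (\<integral>\<^sup>+x. g n x + res W x * indicator (S n) x \<partial>\<pi>)"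
      by (rule nn_integral_add[symmetric]) measurable
    also have "\<dots> \<le> (\<integral>\<^sup>+x. res (g n) x + res (\<lambda>y. ennreal (k y)) x \<partial>\<pi>)"
      using AE_\<pi>_pos by (intro nn_integral_mono_AE, eventually_elim) (rule pointwise)
    also have "\<dots> = (\<integral>\<^sup>+x. res (g n) x \<partial>\<pi>) + (\<integral>\<^sup>+x. res (\<lambda>y. ennreal (k y)) x \<partial>\<pi>)"
      by (rule nn_integral_add) measurable
    also have "\<dots> = (\<integral>\<^sup>+x. g n x \<partial>\<pi>) + (\<integral>\<^sup>+x. ennreal (k x) \<partial>\<pi>)"
      by (simp add: integral_res_\<pi>)
    finally show ?thesis using fin by (auto simp: ennreal_add_left_cancel_le)
  qed
  \<comment> \<open>Invariance replaces \<open>W\<close> by \<open>res W\<close>, for which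
    \<open>bound\<close> is available on every \<open>S n\<close>; these sets exhaust the
    half-line.\<close>
  have "(\<integral>\<^sup>+x. W x \<partial>\<pi>) = (\<integral>\<^sup>+x. res W x \<partial>\<pi>)" by (rule integral_res_\<pi>[symmetric]) measurable
  also have "\<dots> = (\<integral>\<^sup>+x. (SUP n. res W x * indicator (S n) x) \<partial>\<pi>)"
    using AE_\<pi>_pos
  proof (intro nn_integral_cong_AE, eventually_elim)
    case (elim x)
    obtain n :: nat where n: "V x \<le> real n" using real_arch_simple by blast
    have "(SUP n. res W x * indicator (S n) x) = res W x"
    proof (rule antisym)
      show "(SUP n. res W x * indicator (S n) x) \<le> res W x"
        by (rule SUP_least) (simp add: indicator_def)
      show "res W x \<le> (SUP n. res W x * indicator (S n) x)"
        by (rule SUP_upper2[of n]) (use n elim in \<open>auto simp: S_def\<close>)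
    qed
    then show ?case by simp
  qed
  also have "\<dots> = (SUP n. \<integral>\<^sup>+x. res W x * indicator (S n) x \<partial>\<pi>)"
  proof (rule nn_integral_monotone_convergence_SUP)
    have "S m \<subseteq> S n" if "m \<le> n" for m n using that by (auto simp: S_def)
    then have "indicator (S m) x \<le> (indicator (S n) x :: ennreal)" if "m \<le> n" for m n x
      using that by (intro indicator_leI) auto
    then show "incseq (\<lambda>n x. res W x * indicator (S n) x)"
      unfolding incseq_def le_fun_def by (intro allI impI mult_left_mono) auto
  qed measurable
  also have "\<dots> \<le> (\<integral>\<^sup>+x. ennreal (k x) \<partial>\<pi>)" by (rule SUP_least) (rule bound)
  also have "\<dots> = (\<integral>\<^sup>+x. ennreal C * indicator {r..R} x \<partial>\<pi>)"
    by (intro nn_integral_cong) (simp add: k_def indicator_def)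
  also have "\<dots> = ennreal C * emeasure \<pi> {r..R}" by (simp add: nn_integral_cmult_indicator)
  also have "\<dots> < \<infinity>" using emeasure_\<pi>_compact_interval[OF r] by (simp add: ennreal_mult_less_top)
  finally show ?thesis .
qed

end

section \<open>The Lyapunov function\<close>

lemma asymp_powr_ratio:
  fixes f :: "real \<Rightarrow> real"
  assumes f: "f \<sim>[F] (\<lambda>x. c * x powr p)" and c: "c \<noteq> 0" and pos: "\<forall>\<^sub>F x in F. 0 < x"
  shows "((\<lambda>x. f x / x powr p) \<longlongrightarrow> c) F"
proof -
  have "((\<lambda>x. f x / (c * x powr p)) \<longlongrightarrow> 1) F"
    by (rule asymp_equivD_strong[OF f]) (use pos c in \<open>auto elim: eventually_mono\<close>)
  from tendsto_mult[OF tendsto_const[of c] this] c show ?thesis by simp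
qed

text \<open>Without the indicator, the right side is a lower bound of \<open>- \<L> V\<close>, the
  jump moments being replaced by \<open>Ma\<close> and \<open>Mb\<close>. By \<open>exps\<close>,
  near 0 the jump loss \<open>\<beta> x * x powr - b\<close> is smaller than the drift
  \<open>\<tau> x * x powr (- b - 1)\<close> by a factor of order
  \<open>x powr (\<gamma>\<^sub>0 - \<nu>\<^sub>0 + 1)\<close>, and near infinity the drift
  \<open>\<tau> x * x powr (a - 1)\<close> is smaller than \<open>\<beta> x * x powr a\<close> by a
  factor of order \<open>x powr (\<nu>_inf - 1 - \<gamma>_inf)\<close>.\<close>

lemma drift_bound:
  fixes \<tau> \<beta> :: "real \<Rightarrow> real"
  assumes cont: "continuous_on {0<..} \<beta>" "continuous_on {0<..} \<tau>"
    and pos: "\<And>x. 0 < x \<Longrightarrow> 0 < \<beta> x" "\<And>x. 0 < x \<Longrightarrow> 0 < \<tau> x"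
    and const_pos: "0 < \<beta>\<^sub>0" "0 < \<beta>_inf" "0 < \<tau>\<^sub>0" "0 < \<tau>_inf"
    and asymp: "\<beta> \<sim>[at_right 0] (\<lambda>x. \<beta>\<^sub>0 * x powr \<gamma>\<^sub>0)" "\<tau> \<sim>[at_right 0] (\<lambda>x. \<tau>\<^sub>0 * x powr \<nu>\<^sub>0)"
      "\<beta> \<sim>[at_top] (\<lambda>x. \<beta>_inf * x powr \<gamma>_inf)" "\<tau> \<sim>[at_top] (\<lambda>x. \<tau>_inf * x powr \<nu>_inf)"
    and exps: "\<gamma>\<^sub>0 > \<nu>\<^sub>0 - 1" "\<gamma>_inf > \<nu>_inf - 1"
    and ab: "0 < a" "0 < b" and M: "Ma < 1" "0 \<le> Mb"
  obtains \<delta> R c C where "0 < \<delta>" "\<delta> \<le> R" "0 < c" "0 \<le> C"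
    "\<And>x. 0 < x \<Longrightarrow> (if x < \<delta> then c * x powr (\<nu>\<^sub>0 - 1 - b) else 0) \<le>
      (1 - Mb) * (\<beta> x * x powr - b) + (1 - Ma) * (\<beta> x * x powr a) +
      b * (\<tau> x * x powr (- b - 1)) - a * (\<tau> x * x powr (a - 1)) + C * indicator {\<delta>..R} x"
proof -
  define L where "L x = (1 - Mb) * (\<beta> x * x powr - b) + (1 - Ma) * (\<beta> x * x powr a) +
      b * (\<tau> x * x powr (- b - 1)) - a * (\<tau> x * x powr (a - 1))" for x
  have pos0: "\<forall>\<^sub>F x in at_right 0. (0::real) < x" by (simp add: eventually_at_right_less)
  have pos_inf: "\<forall>\<^sub>F x in at_top. (0::real) < x" by (rule eventually_gt_at_top)
  have id0: "((\<lambda>x. x) \<longlongrightarrow> (0::real)) (at_right 0)" by (rule tendsto_ident_at)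
  have nonneg0: "\<forall>\<^sub>F x in at_right 0. (0::real) \<le> x" using pos0 by (rule eventually_mono) simp
  have small: "((\<lambda>x. x powr p) \<longlongrightarrow> 0) (at_right 0)" if "0 < p" for p :: real
    by (rule tendsto_zero_powrI[OF id0 tendsto_const nonneg0 that])
  have small_inf: "((\<lambda>x. x powr p) \<longlongrightarrow> 0) at_top" if "p < 0" for p :: real
    by (rule tendsto_neg_powr[OF that filterlim_ident])
  \<comment> \<open>\<open>L\<close> divided by its leading power at 0,
    \<open>x powr (\<nu>\<^sub>0 - 1 - b)\<close>, after omitting two nonnegative terms. The limit
    is \<open>b * \<tau>\<^sub>0\<close>, half of which becomes the constant
    \<open>c\<close>.\<close>
  define E0 where "E0 x = b * (\<tau> x / x powr \<nu>\<^sub>0) - a * (\<tau> x / x powr \<nu>\<^sub>0) * x powr (a + b)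
    - Mb * (\<beta> x / x powr \<gamma>\<^sub>0) * x powr (\<gamma>\<^sub>0 - \<nu>\<^sub>0 + 1)" for x
  have "(E0 \<longlongrightarrow> b * \<tau>\<^sub>0 - a * \<tau>\<^sub>0 * 0 - Mb * \<beta>\<^sub>0 * 0) (at_right 0)"
    unfolding E0_def[abs_def]
    by (intro tendsto_intros asymp_powr_ratio asymp small) (use const_pos pos0 exps ab in auto)
  then have "\<forall>\<^sub>F x in at_right 0. b * \<tau>\<^sub>0 / 2 < E0 x"
    by (rule order_tendstoD(1)) (use const_pos ab in simp)
  then obtain \<delta> where \<delta>: "0 < \<delta>" "\<And>x. 0 < x \<Longrightarrow> x < \<delta> \<Longrightarrow> b * \<tau>\<^sub>0 / 2 < E0 x"
    unfolding eventually_at_right_field by auto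
  \<comment> \<open>The analogue at infinity, with leading power
    \<open>x powr (\<gamma>_inf + a)\<close> and limit \<open>(1 - Ma) * \<beta>_inf\<close>,
    positive because \<open>Ma < 1\<close>.\<close>
  define E1 where "E1 x = (1 - Ma) * (\<beta> x / x powr \<gamma>_inf) - Mb * (\<beta> x / x powr \<gamma>_inf) * x powr (- b - a)
    - a * (\<tau> x / x powr \<nu>_inf) * x powr (\<nu>_inf - 1 - \<gamma>_inf)" for x
  have "(E1 \<longlongrightarrow> (1 - Ma) * \<beta>_inf - Mb * \<beta>_inf * 0 - a * \<tau>_inf * 0) at_top"
    unfolding E1_def[abs_def]
    by (intro tendsto_intros asymp_powr_ratio asymp small_inf) (use const_pos pos_inf exps ab in auto)
  then have "\<forall>\<^sub>F x in at_top. 0 < E1 x"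
    by (rule order_tendstoD(1)) (use const_pos M in simp)
  then obtain R0 where R0: "\<And>x. R0 \<le> x \<Longrightarrow> 0 < E1 x"
    unfolding eventually_at_top_linorder by auto
  define R where "R = max \<delta> R0"
  have near: "x powr (\<nu>\<^sub>0 - 1 - b) * E0 x \<le> L x" if x: "0 < x" for x
  proof -
    have "x powr (\<nu>\<^sub>0 - 1 - b) = x powr \<nu>\<^sub>0 * x powr (- b - 1)"
      "x powr (\<nu>\<^sub>0 - 1 - b) * x powr (a + b) = x powr \<nu>\<^sub>0 * x powr (a - 1)"
      "x powr (\<nu>\<^sub>0 - 1 - b) * x powr (\<gamma>\<^sub>0 - \<nu>\<^sub>0 + 1) = x powr \<gamma>\<^sub>0 * x powr - b"
      by (simp_all add: algebra_simps flip: powr_add)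
    moreover have "x powr (\<nu>\<^sub>0 - 1 - b) * E0 x = b * (\<tau> x / x powr \<nu>\<^sub>0) * x powr (\<nu>\<^sub>0 - 1 - b)
        - a * (\<tau> x / x powr \<nu>\<^sub>0) * (x powr (\<nu>\<^sub>0 - 1 - b) * x powr (a + b))
        - Mb * (\<beta> x / x powr \<gamma>\<^sub>0) * (x powr (\<nu>\<^sub>0 - 1 - b) * x powr (\<gamma>\<^sub>0 - \<nu>\<^sub>0 + 1))"
      by (simp add: E0_def algebra_simps)
    ultimately have "x powr (\<nu>\<^sub>0 - 1 - b) * E0 x =
        b * (\<tau> x * x powr (- b - 1)) - a * (\<tau> x * x powr (a - 1)) - Mb * (\<beta> x * x powr - b)"
      using x by simp
    moreover have "0 \<le> \<beta> x * x powr - b" "0 \<le> (1 - Ma) * (\<beta> x * x powr a)"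
      using pos(1)[OF x] M by simp_all
    ultimately show ?thesis by (simp add: L_def algebra_simps)
  qed
  have far: "x powr (\<gamma>_inf + a) * E1 x \<le> L x" if x: "0 < x" for x
  proof -
    have "x powr (\<gamma>_inf + a) = x powr \<gamma>_inf * x powr a"
      "x powr (\<gamma>_inf + a) * x powr (- b - a) = x powr \<gamma>_inf * x powr - b"
      "x powr (\<gamma>_inf + a) * x powr (\<nu>_inf - 1 - \<gamma>_inf) = x powr \<nu>_inf * x powr (a - 1)"
      by (simp_all add: algebra_simps flip: powr_add)
    moreover have "x powr (\<gamma>_inf + a) * E1 x = (1 - Ma) * (\<beta> x / x powr \<gamma>_inf) * x powr (\<gamma>_inf + a)
        - Mb * (\<beta> x / x powr \<gamma>_inf) * (x powr (\<gamma>_inf + a) * x powr (- b - a))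
        - a * (\<tau> x / x powr \<nu>_inf) * (x powr (\<gamma>_inf + a) * x powr (\<nu>_inf - 1 - \<gamma>_inf))"
      by (simp add: E1_def algebra_simps)
    ultimately have "x powr (\<gamma>_inf + a) * E1 x =
        (1 - Ma) * (\<beta> x * x powr a) - Mb * (\<beta> x * x powr - b) - a * (\<tau> x * x powr (a - 1))"
      using x by simp
    moreover have "0 \<le> \<beta> x * x powr - b" "0 \<le> b * (\<tau> x * x powr (- b - 1))"
      using pos[OF x] ab by simp_all
    ultimately show ?thesis by (simp add: L_def algebra_simps)
  qed
  have "continuous_on {\<delta>..R} L"
    unfolding L_def[abs_def]
    by (intro continuous_intros continuous_on_subset[OF cont(1)] continuous_on_subset[OF cont(2)])
      (use \<delta> in auto)
  then obtain y where y: "y \<in> {\<delta>..R}" "\<And>x. x \<in> {\<delta>..R} \<Longrightarrow> L y \<le> L x"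
    using continuous_attains_inf[of "{\<delta>..R}" L] by (auto simp: R_def)
  \<comment> \<open>\<open>L\<close> attains its minimum on \<open>{\<delta>..R}\<close> at
    \<open>y\<close>; \<open>C\<close> lifts it to a nonnegative value there.\<close>
  define C where "C = max 0 (- L y)"
  show thesis
  proof (rule that[of \<delta> R "b * \<tau>\<^sub>0 / 2" C])
    fix x :: real assume x: "0 < x"
    consider "x < \<delta>" | "x \<in> {\<delta>..R}" | "R < x" by (cases "x < \<delta>"; cases "R < x") auto
    then have "(if x < \<delta> then b * \<tau>\<^sub>0 / 2 * x powr (\<nu>\<^sub>0 - 1 - b) else 0) \<le> L x + C * indicator {\<delta>..R} x"
    proof cases
      case 1
      have "b * \<tau>\<^sub>0 / 2 * x powr (\<nu>\<^sub>0 - 1 - b) \<le> x powr (\<nu>\<^sub>0 - 1 - b) * E0 x"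
        using mult_left_mono[OF less_imp_le[OF \<delta>(2)[OF x 1]], of "x powr (\<nu>\<^sub>0 - 1 - b)"]
        by (simp add: mult.commute)
      with near[OF x] 1 show ?thesis by simp
    next
      case 2
      with y(2)[OF 2] show ?thesis by (simp add: C_def)
    next
      case 3
      then have "0 < E1 x" by (intro R0) (simp add: R_def)
      then have "0 \<le> x powr (\<gamma>_inf + a) * E1 x" by simp
      moreover have "\<not> x < \<delta>" "x \<notin> {\<delta>..R}" using 3 by (auto simp: R_def)
      ultimately show ?thesis using far[OF x] by simp
    qed
    then show "(if x < \<delta> then b * \<tau>\<^sub>0 / 2 * x powr (\<nu>\<^sub>0 - 1 - b) else 0) \<le>
      (1 - Mb) * (\<beta> x * x powr - b) + (1 - Ma) * (\<beta> x * x powr a) +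
      b * (\<tau> x * x powr (- b - 1)) - a * (\<tau> x * x powr (a - 1)) + C * indicator {\<delta>..R} x"
      unfolding L_def .
  qed (use \<delta> const_pos ab in \<open>auto simp: R_def C_def\<close>)
qed

lemma (in pdmp_coord) jump_moment_le:
  assumes x: "0 < x" and unit: "emeasure (Q x) {0..1} = 1"
    and Ma: "moment_sup Q a \<le> ennreal Ma" and Mb: "moment_sup Q (- b) \<le> ennreal Mb"
    and M0: "0 \<le> Ma" "0 \<le> Mb"
  shows "(\<integral>\<^sup>+y. ennreal ((x * y) powr - b + (x * y) powr a) \<partial>Q x) \<le> ennreal (x powr - b * Mb + x powr a * Ma)"
proof -
  interpret Qx: prob_space "Q x" by (rule prob_Q[OF x])
  have [measurable]: "(\<lambda>y. epowr y c) \<in> borel_measurable borel" for c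
    unfolding epowr_def[abs_def] by measurable
  have m: "(\<lambda>y. ennreal (x powr p) * (epowr y c * indicator {0..1} y)) \<in> borel_measurable (Q x)" for p c
    by (rule borel_measurable_Q[OF x], measurable)
  have m': "(\<lambda>y. epowr y c * indicator {0..1} y) \<in> borel_measurable (Q x)" for c
    by (rule borel_measurable_Q[OF x], measurable)
  have moment: "(\<integral>\<^sup>+y\<in>{0..1}. epowr y c \<partial>Q x) \<le> moment_sup Q c" for c
    unfolding moment_sup_def using x by (intro SUP_upper) simp
  have "AE y in Q x. y \<in> {0..1}"
    by (rule Qx.AE_in_set_eq_1[THEN iffD2]) (use unit sets_Q[OF x] in \<open>simp_all add: Qx.emeasure_eq_measure\<close>)
  then have "(\<integral>\<^sup>+y. ennreal ((x * y) powr - b + (x * y) powr a) \<partial>Q x) \<le>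
      (\<integral>\<^sup>+y. ennreal (x powr - b) * (epowr y (- b) * indicator {0..1} y) +
        ennreal (x powr a) * (epowr y a * indicator {0..1} y) \<partial>Q x)"
  proof (intro nn_integral_mono_AE, eventually_elim)
    case (elim y)
    \<comment> \<open>For \<open>y > 0\<close> the powers are multiplicative. At
      \<open>y = 0\<close> the left side is 0 by the convention for \<open>powr\<close>, so the
      inequality also holds at an atom there.\<close>
    show ?case
    proof (cases "y = 0")
      case False
      with elim x show ?thesis by (simp add: epowr_def powr_mult flip: ennreal_mult ennreal_plus)
    qed simp
  qed
  also have "\<dots> = ennreal (x powr - b) * (\<integral>\<^sup>+y\<in>{0..1}. epowr y (- b) \<partial>Q x) +
      ennreal (x powr a) * (\<integral>\<^sup>+y\<in>{0..1}. epowr y a \<partial>Q x)"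
    by (subst nn_integral_add[OF m m]) (simp add: nn_integral_cmult[OF m'])
  also have "\<dots> \<le> ennreal (x powr - b) * ennreal Mb + ennreal (x powr a) * ennreal Ma"
    by (intro add_mono mult_left_mono order_trans[OF moment] Ma Mb) simp_all
  also have "\<dots> = ennreal (x powr - b * Mb + x powr a * Ma)"
    using M0 by (simp add: ennreal_mult ennreal_plus)
  finally show ?thesis .
qed

text \<open>The end points solve \<open>x powr - b = N\<close> and \<open>x powr a = N\<close>.
  Taking \<open>N = n + 1\<close> keeps the base at least 1, which puts them in the right order, and
  makes \<open>V\<close> exceed \<open>n\<close> outside.\<close>

lemma powr_sublevel:
  fixes a b :: real
  assumes ab: "0 < a" "0 < b" and n: "0 \<le> n"
  obtains s S where "0 < s" "s \<le> S" "\<And>x. 0 < x \<Longrightarrow> x powr - b + x powr a \<le> n \<Longrightarrow> x \<in> {s..S}"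
proof -
  define N where "N = n + 1"
  have N: "1 \<le> N" "0 < N" using n by (auto simp: N_def)
  show thesis
  proof (rule that[of "N powr (- (1 / b))" "N powr (1 / a)"])
    show "0 < N powr (- (1 / b))" using N by simp
    show "N powr (- (1 / b)) \<le> N powr (1 / a)" using N ab
      by (intro powr_mono) (auto intro: order_trans[of _ 0])
    fix x :: real assume x: "0 < x" and le: "x powr - b + x powr a \<le> n"
    have p: "0 < x powr - b" "0 < x powr a" using x by simp_all
    show "x \<in> {N powr (- (1 / b))..N powr (1 / a)}"
    proof (rule ccontr)
      assume "x \<notin> {N powr (- (1 / b))..N powr (1 / a)}"
      then consider "x < N powr (- (1 / b))" | "N powr (1 / a) < x" by (auto simp: not_le)
      then show False
      proof cases
        case 1
        then have "(N powr (- (1 / b))) powr - b < x powr - b"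
          using x ab by (intro powr_less_mono2_neg) auto
        then show False using le p N ab by (simp add: powr_powr N_def)
      next
        case 2
        then have "(N powr (1 / a)) powr a < x powr a"
          using ab by (intro powr_less_mono2) auto
        then show False using le p N ab by (simp add: powr_powr N_def)
      qed
    qed
  qed
qed

section \<open>Finiteness of the moment near the origin\<close>

context pdmp_stationary begin

text \<open>The drift inequality controls the power on \<open>x < \<delta>\<close>. The rest of the
  unit interval lies in a compact interval, where the power is bounded and \<pi> is finite.\<close>

lemma moment_near_zero:
  assumes unit: "\<And>x. 0 < x \<Longrightarrow> emeasure (Q x) {0..1} = 1"
    and const_pos: "0 < \<beta>\<^sub>0" "0 < \<beta>_inf" "0 < \<tau>\<^sub>0" "0 < \<tau>_inf"
    and asymp: "\<beta> \<sim>[at_right 0] (\<lambda>x. \<beta>\<^sub>0 * x powr \<gamma>\<^sub>0)" "\<tau> \<sim>[at_right 0] (\<lambda>x. \<tau>\<^sub>0 * x powr \<nu>\<^sub>0)"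
      "\<beta> \<sim>[at_top] (\<lambda>x. \<beta>_inf * x powr \<gamma>_inf)" "\<tau> \<sim>[at_top] (\<lambda>x. \<tau>_inf * x powr \<nu>_inf)"
    and exps: "\<gamma>\<^sub>0 > \<nu>\<^sub>0 - 1" "\<gamma>_inf > \<nu>_inf - 1"
    and ab: "0 < a" "0 < b" and moments: "moment_sup Q a < 1" "moment_sup Q (- b) < \<infinity>"
  shows "(\<integral>\<^sup>+x\<in>{0<..1}. ennreal (x powr (\<nu>\<^sub>0 - 1 - b)) \<partial>\<pi>) < \<infinity>"
proof -
  define Ma Mb where "Ma = enn2real (moment_sup Q a)" and "Mb = enn2real (moment_sup Q (- b))"
  have fin: "moment_sup Q a < top" "moment_sup Q (- b) < top"
    using moments by (auto intro: less_trans[OF _ ennreal_one_less_top])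
  then have Ma_eq: "moment_sup Q a = ennreal Ma" and Mb_eq: "moment_sup Q (- b) = ennreal Mb"
    by (simp_all add: Ma_def Mb_def)
  have M: "Ma < 1" "0 \<le> Mb" "0 \<le> Ma"
    using moments(1) unfolding Ma_eq by (simp_all add: Ma_def Mb_def)
  obtain \<delta> R c C where \<delta>: "0 < \<delta>" "\<delta> \<le> R" and c: "0 < c" and C: "0 \<le> C" and bound:
    "\<And>x. 0 < x \<Longrightarrow> (if x < \<delta> then c * x powr (\<nu>\<^sub>0 - 1 - b) else 0) \<le>
      (1 - Mb) * (\<beta> x * x powr - b) + (1 - Ma) * (\<beta> x * x powr a) +
      b * (\<tau> x * x powr (- b - 1)) - a * (\<tau> x * x powr (a - 1)) + C * indicator {\<delta>..R} x"
    by (rule drift_bound[OF \<beta>_cont \<tau>_cont \<beta>_pos \<tau>_pos const_pos asymp exps ab M(1,2)])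
      (assumption | rule that)+
  define V where "V x = x powr - b + x powr a" for x :: real
  define V' where "V' x = - b * x powr (- b - 1) + a * x powr (a - 1)" for x :: real
  define w where "w x = (if x < \<delta> then c * x powr (\<nu>\<^sub>0 - 1 - b) else 0)" for x :: real
  have w_nonneg: "0 \<le> w x" for x using c by (simp add: w_def)
  \<comment> \<open>This is \<open>bound\<close> in terms of \<open>V\<close> and \<open>V'\<close>,
    with the jump integral of \<open>V\<close> replaced by its majorant from
    \<open>jump_moment_le\<close>.\<close>
  have key: "V x + w x + \<beta> x * (x powr - b * Mb + x powr a * Ma) \<le>
      V x + \<beta> x * V x - \<tau> x * V' x + C * indicator {\<delta>..R} x" if "0 < x" for x
    using bound[OF that] unfolding V_def V'_def w_def by (simp add: algebra_simps)
  have lhs_nonneg: "0 \<le> V x + w x + \<beta> x * (x powr - b * Mb + x powr a * Ma)" if "0 < x" for x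
    using that \<beta>_pos[OF that] M w_nonneg[of x] by (auto simp: V_def intro!: add_nonneg_nonneg mult_nonneg_nonneg)
  have W: "(\<integral>\<^sup>+x. ennreal (w x) \<partial>\<pi>) < \<infinity>"
  proof (rule stationary_drift[where V=V and V'=V' and r=\<delta> and R=R and C=C])
    fix x :: real assume x: "0 < x"
    show "(V has_real_derivative V' x) (at x)"
      unfolding V_def[abs_def] V'_def using x by (auto intro!: derivative_eq_intros simp: powr_diff)
    show "0 \<le> V x" by (simp add: V_def)
    show "0 \<le> V x + \<beta> x * V x - \<tau> x * V' x + C * indicator {\<delta>..R} x"
      using key[OF x] lhs_nonneg[OF x] by linarith
    have "ennreal (V x) + ennreal (w x) + ennreal (\<beta> x) * (\<integral>\<^sup>+y. ennreal (V (x * y)) \<partial>Q x) \<le>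
        ennreal (V x) + ennreal (w x) + ennreal (\<beta> x) * ennreal (x powr - b * Mb + x powr a * Ma)"
      unfolding V_def
      by (intro add_left_mono mult_left_mono jump_moment_le x unit) (use Ma_eq Mb_eq M in simp_all)
    also have "\<dots> = ennreal (V x + w x + \<beta> x * (x powr - b * Mb + x powr a * Ma))"
      using \<beta>_pos[OF x] M w_nonneg[of x] by (simp add: V_def ennreal_mult ennreal_plus)
    also have "\<dots> \<le> ennreal (V x + \<beta> x * V x - \<tau> x * V' x + C * indicator {\<delta>..R} x)"
      by (rule ennreal_leI[OF key[OF x]])
    finally show "(ennreal (V x) + ennreal (w x)) + ennreal (\<beta> x) * (\<integral>\<^sup>+y. ennreal (V (x * y)) \<partial>Q x)
        \<le> ennreal (V x + \<beta> x * V x - \<tau> x * V' x + C * indicator {\<delta>..R} x)" .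
  next
    show "continuous_on {0<..} V'"
      unfolding V'_def[abs_def] by (intro continuous_intros) auto
    show "V \<in> borel_measurable borel" unfolding V_def[abs_def] by measurable
    show "(\<lambda>x. ennreal (w x)) \<in> borel_measurable borel" unfolding w_def[abs_def] by measurable
    fix n :: nat
    show "\<exists>s S. 0 < s \<and> s \<le> S \<and> (\<forall>x>0. V x \<le> real n \<longrightarrow> x \<in> {s..S})"
      by (rule powr_sublevel[OF ab, of "real n"]) (auto simp: V_def)
  qed (use \<delta> C in auto)
  let ?p = "\<nu>\<^sub>0 - 1 - b"
  \<comment> \<open>Majorant of \<open>x powr ?p\<close> on \<open>{\<delta>..1}\<close>: the power
    is monotone, hence at most 1 or at most its value at \<open>\<delta>\<close>, according to the
    sign of \<open>?p\<close>.\<close>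
  define D where "D = \<delta> powr ?p + 1"
  have "(\<integral>\<^sup>+x\<in>{0<..1}. ennreal (x powr ?p) \<partial>\<pi>) \<le>
      (\<integral>\<^sup>+x. ennreal (1 / c) * ennreal (w x) + ennreal D * indicator {\<delta>..max \<delta> 1} x \<partial>\<pi>)"
    using AE_\<pi>_pos
  proof (intro nn_integral_mono_AE, eventually_elim)
    case (elim x)
    then have x: "0 < x" by blast
    show ?case
    proof (cases "x < \<delta>")
      case True
      then have "ennreal (x powr ?p) = ennreal (1 / c) * ennreal (w x)"
        using c by (simp add: w_def flip: ennreal_mult)
      then show ?thesis using True by (simp add: indicator_def)
    next
      case False
      have "x powr ?p \<le> D" if "x \<le> 1"
      proof (cases "0 \<le> ?p")
        case True
        have "x powr ?p \<le> 1 powr ?p" by (rule powr_mono2) (use True x that in auto)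
        then show ?thesis by (simp add: D_def add_increasing)
      next
        case False
        have "x powr ?p \<le> \<delta> powr ?p" by (rule powr_mono2') (use False \<open>\<not> x < \<delta>\<close> \<delta> in auto)
        then show ?thesis by (simp add: D_def)
      qed
      then show ?thesis using False by (auto simp: indicator_def w_def ennreal_leI)
    qed
  qed
  also have "\<dots> = ennreal (1 / c) * (\<integral>\<^sup>+x. ennreal (w x) \<partial>\<pi>) + ennreal D * emeasure \<pi> {\<delta>..max \<delta> 1}"
  proof -
    have [measurable]: "w \<in> borel_measurable borel" unfolding w_def[abs_def] by measurable
    have "(\<lambda>x. ennreal (w x)) \<in> borel_measurable \<pi>" by measurable
    then show ?thesis
      by (subst nn_integral_add) (simp_all add: nn_integral_cmult nn_integral_cmult_indicator)
  qed
  also have "\<dots> < \<infinity>"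
    using W emeasure_\<pi>_compact_interval[OF \<delta>(1), of "max \<delta> 1"] by (simp add: ennreal_mult_less_top)
  finally show ?thesis .
qed

end

section \<open>Densities\<close>

text \<open>The source of \<open>H\<close> and \<open>B\<close>, with the value 0 on the nonpositive
  axis that the locales ask for.\<close>

lemma ex_antiderivative_half_line:
  fixes f :: "real \<Rightarrow> real"
  assumes "continuous_on {0<..} f"
  shows "\<exists>F. (\<forall>x>0. (F has_real_derivative f x) (at x)) \<and> (\<forall>x\<le>0. F x = 0)"
proof -
  have "isCont f x" if "0 < x" for x using assms that by (simp add: continuous_on_eq_continuous_at)
  then obtain F where F: "\<And>x. 0 < x \<Longrightarrow> (F has_vector_derivative f x) (at x)"
    using einterval_antiderivative[of 0 \<infinity> f] by auto
  have "((\<lambda>x. if 0 < x then F x else 0) has_real_derivative f x) (at x)" if x: "0 < x" for x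
  proof (rule has_field_derivative_transform_within_open[of F])
    show "(F has_real_derivative f x) (at x)"
      using F[OF x] by (simp add: has_real_derivative_iff_has_vector_derivative)
  qed (use x in \<open>auto intro: open_greaterThan\<close>)
  then show ?thesis by (intro exI[of _ "\<lambda>x. if 0 < x then F x else 0"]) simp
qed

section \<open>Integrability of powers at the origin and its consequences for the two
  densities\<close>

lemma nn_integral_powr_finite:
  assumes "- 1 < p" "0 \<le> c"
  shows "(\<integral>\<^sup>+y\<in>{0..c}. ennreal (y powr p) \<partial>lborel) < \<infinity>"
  using nn_integral_has_integral_lebesgue'[OF _ has_integral_powr_from_0[OF assms]] by simp

lemma nn_integral_powr_infinite:
  assumes p: "p \<le> - 1" and e: "0 < e" "e \<le> 1"
  shows "(\<integral>\<^sup>+x\<in>{0<..<e}. ennreal (x powr p) \<partial>lborel) = \<infinity>"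
proof (rule ccontr)
  let ?I = "\<integral>\<^sup>+x\<in>{0<..<e}. ennreal (x powr p) \<partial>lborel"
  assume "?I \<noteq> \<infinity>"
  then obtain r where r: "?I = ennreal r" "0 \<le> r" by (cases ?I) auto
  define d where "d = e / 2"
  \<comment> \<open>Chosen so that the integral of \<open>1 / x\<close> over \<open>{h..d}\<close>
    is \<open>ln d - ln h = r + 1\<close>, more than the supposed value \<open>r\<close>; below 1
    the function \<open>1 / x\<close> is dominated by \<open>x powr p\<close>.\<close>
  define h where "h = d * exp (- (r + 1))"
  have d: "0 < d" "d < e" and h: "0 < h" "h \<le> d" using e r by (simp_all add: d_def h_def)
  have "ennreal (r + 1) = ennreal (ln d - ln h)" using d by (simp add: h_def ln_mult)
  also have "\<dots> = (\<integral>\<^sup>+x\<in>{h..d}. ennreal (1 / x) \<partial>lborel)"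
    by (rule nn_integral_FTC_Icc[symmetric]) (use h in \<open>auto intro!: DERIV_ln_divide\<close>)
  also have "\<dots> \<le> ?I"
  proof (rule nn_integral_mono)
    fix x
    show "ennreal (1 / x) * indicator {h..d} x \<le> ennreal (x powr p) * indicator {0<..<e} x"
    proof (cases "x \<in> {h..d}")
      case True
      then have x: "0 < x" "x < e" "x \<le> 1" using h d e by auto
      have "1 / x = x powr - 1" using x by (simp add: powr_minus_divide)
      also have "\<dots> \<le> x powr p" using x p by (intro powr_mono') auto
      finally show ?thesis using True x by (simp add: ennreal_leI)
    qed simp
  qed
  finally show False using r by simp
qed

text \<open>Near 0 the expansion gives
  \<open>q y \<le> (q\<^sub>0 + 1) * y powr \<mu>\<^sub>0\<close>, and
  \<open>y powr (\<mu>\<^sub>0 - b)\<close> is integrable for \<open>b < \<mu>\<^sub>0 + 1\<close>.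
  Away from 0 the factor \<open>y powr - b\<close> is bounded and \<open>q\<close> has mass 1. The
  bound is uniform because \<open>Q x\<close> is the same for all \<open>x > 0\<close>.\<close>

lemma fragmentation_moment_finite:
  assumes frag: "fragmentation_density Q q q\<^sub>0 q\<^sub>1 \<mu>\<^sub>0 \<mu>\<^sub>1"
    and prob: "\<And>x. 0 < x \<Longrightarrow> prob_space (Q x)"
    and b: "0 < b" "b < \<mu>\<^sub>0 + 1"
  shows "moment_sup Q (- b) < \<infinity>"
proof -
  have q[measurable]: "q \<in> borel_measurable borel" and q_nonneg: "\<And>y. y \<in> {0<..<1} \<Longrightarrow> 0 \<le> q y"
    and Q: "\<And>x. 0 < x \<Longrightarrow> Q x = density lborel (\<lambda>y. ennreal (q y) * indicator {0<..<1} y)"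
    and q0: "0 \<le> q\<^sub>0"
    and small: "(\<lambda>y. q y - q\<^sub>0 * y powr \<mu>\<^sub>0) \<in> o[at_right 0](\<lambda>y. y powr \<mu>\<^sub>0)"
    using frag by (auto simp: fragmentation_density_def)
  from landau_o.smallD[OF small zero_less_one]
  obtain e0 where e0: "0 < e0" "\<And>y. 0 < y \<Longrightarrow> y < e0 \<Longrightarrow> \<bar>q y - q\<^sub>0 * y powr \<mu>\<^sub>0\<bar> \<le> \<bar>y powr \<mu>\<^sub>0\<bar>"
    unfolding eventually_at_right_field by auto
  define e where "e = min e0 1"
  have e: "0 < e" "e \<le> 1" using e0 by (auto simp: e_def)
  have q_le: "q y \<le> (q\<^sub>0 + 1) * y powr \<mu>\<^sub>0" if "0 < y" "y < e" for y
    using e0(2)[of y] that by (simp add: e_def algebra_simps abs_le_iff)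
  define d where "d y = ennreal (q y) * indicator {0<..<1} y" for y
  have [measurable]: "d \<in> borel_measurable borel" unfolding d_def[abs_def] by measurable
  have ep[measurable]: "(\<lambda>y. epowr y c) \<in> borel_measurable borel" for c
    unfolding epowr_def[abs_def] by measurable
  have d1: "(\<integral>\<^sup>+y. d y \<partial>lborel) = 1"
    using prob_space.emeasure_space_1[OF prob[of 1]] by (simp add: Q emeasure_density d_def[abs_def])
  let ?K = "\<integral>\<^sup>+y. ennreal (q\<^sub>0 + 1) * (ennreal (y powr (\<mu>\<^sub>0 - b)) * indicator {0..1} y) +
      ennreal (e powr - b) * d y \<partial>lborel"
  have "(\<integral>\<^sup>+y\<in>{0..1}. epowr y (- b) \<partial>Q x) \<le> ?K" if x: "0 < x" for x
  proof -
    have "(\<integral>\<^sup>+y\<in>{0..1}. epowr y (- b) \<partial>Q x) = (\<integral>\<^sup>+y. d y * (epowr y (- b) * indicator {0..1} y) \<partial>lborel)"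
      unfolding Q[OF x] d_def by (rule nn_integral_density) measurable
    also have "\<dots> \<le> ?K"
    proof (rule nn_integral_mono)
      fix y :: real
      show "d y * (epowr y (- b) * indicator {0..1} y) \<le>
          ennreal (q\<^sub>0 + 1) * (ennreal (y powr (\<mu>\<^sub>0 - b)) * indicator {0..1} y) + ennreal (e powr - b) * d y"
      proof (cases "y \<in> {0<..<1}")
        case True
        then have y: "0 < y" "y < 1" by auto
        have lhs: "d y * (epowr y (- b) * indicator {0..1} y) = ennreal (q y * y powr - b)"
          using y q_nonneg[OF True] by (simp add: d_def epowr_def ennreal_mult)
        show ?thesis
        proof (cases "y < e")
          case True
          have "q y * y powr - b \<le> (q\<^sub>0 + 1) * y powr \<mu>\<^sub>0 * y powr - b"
            using q_le[OF y(1) True] by (rule mult_right_mono) simp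
          also have "\<dots> = (q\<^sub>0 + 1) * y powr (\<mu>\<^sub>0 - b)" by (simp add: powr_add[symmetric])
          finally have "ennreal (q y * y powr - b) \<le> ennreal ((q\<^sub>0 + 1) * y powr (\<mu>\<^sub>0 - b))"
            by (rule ennreal_leI)
          also have "\<dots> = ennreal (q\<^sub>0 + 1) * ennreal (y powr (\<mu>\<^sub>0 - b))"
            by (rule ennreal_mult) (use q0 in simp_all)
          finally have "ennreal (q y * y powr - b) \<le> ennreal (q\<^sub>0 + 1) * (ennreal (y powr (\<mu>\<^sub>0 - b)) * indicator {0..1} y)"
            using y by (simp add: indicator_def)
          then show ?thesis unfolding lhs by (rule order_trans) simp
        next
          case False
          have "y powr - b \<le> e powr - b" using False e b by (intro powr_mono2') auto
          then have "q y * y powr - b \<le> e powr - b * q y"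
            using mult_left_mono[OF _ q_nonneg[OF \<open>y \<in> {0<..<1}\<close>]] by (simp add: mult.commute[of "e powr - b"])
          then have "ennreal (q y * y powr - b) \<le> ennreal (e powr - b) * d y"
            using y q_nonneg[OF \<open>y \<in> {0<..<1}\<close>] by (simp add: d_def ennreal_leI flip: ennreal_mult)
          then show ?thesis unfolding lhs by (rule order_trans) simp
        qed
      qed (simp add: d_def)
    qed
    finally show ?thesis .
  qed
  then have "moment_sup Q (- b) \<le> ?K" unfolding moment_sup_def by (intro SUP_least) auto
  also have "\<dots> = ennreal (q\<^sub>0 + 1) * (\<integral>\<^sup>+y\<in>{0..1}. ennreal (y powr (\<mu>\<^sub>0 - b)) \<partial>lborel) + ennreal (e powr - b)"
    by (subst nn_integral_add) (simp_all add: nn_integral_cmult d1)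
  also have "\<dots> < \<infinity>"
    using nn_integral_powr_finite[of "\<mu>\<^sub>0 - b" 1] b by (simp add: ennreal_mult_less_top)
  finally show ?thesis .
qed

text \<open>Near 0 the integrand \<open>x powr p * G x\<close> is at least a positive multiple of
  \<open>x powr (p + \<alpha>\<^sub>0)\<close>, whose integral diverges when the exponent is at most
  -1.\<close>

lemma stationary_density_exponent:
  assumes dens: "stationary_density \<pi> G G\<^sub>0 \<alpha>\<^sub>0 G_inf \<alpha>_inf c \<kappa>"
    and fin: "(\<integral>\<^sup>+x\<in>{0<..1}. ennreal (x powr p) \<partial>\<pi>) < \<infinity>"
  shows "- 1 < p + \<alpha>\<^sub>0"
proof (rule ccontr)
  assume "\<not> - 1 < p + \<alpha>\<^sub>0"
  then have p: "p + \<alpha>\<^sub>0 \<le> - 1" by simp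
  have G[measurable]: "G \<in> borel_measurable borel" and G0: "0 < G\<^sub>0"
    and \<pi>: "\<pi> = density lborel (\<lambda>x. ennreal (G x) * indicator {0<..} x)"
    and asymp: "G \<sim>[at_right 0] (\<lambda>x. G\<^sub>0 * x powr \<alpha>\<^sub>0)"
    using dens by (auto simp: stationary_density_def)
  have "((\<lambda>x. G x / x powr \<alpha>\<^sub>0) \<longlongrightarrow> G\<^sub>0) (at_right 0)"
    by (rule asymp_powr_ratio[OF asymp]) (use G0 in \<open>auto simp: eventually_at_right_less\<close>)
  from order_tendstoD(1)[OF this, of "G\<^sub>0 / 2"] G0
  obtain e0 where e0: "0 < e0" "\<And>x. 0 < x \<Longrightarrow> x < e0 \<Longrightarrow> G\<^sub>0 / 2 < G x / x powr \<alpha>\<^sub>0"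
    unfolding eventually_at_right_field by auto
  define e where "e = min e0 1"
  have e: "0 < e" "e \<le> 1" using e0 by (auto simp: e_def)
  have "ennreal (G\<^sub>0 / 2) * \<infinity> = ennreal (G\<^sub>0 / 2) * (\<integral>\<^sup>+x\<in>{0<..<e}. ennreal (x powr (p + \<alpha>\<^sub>0)) \<partial>lborel)"
    by (simp add: nn_integral_powr_infinite[OF p e])
  also have "\<dots> = (\<integral>\<^sup>+x. ennreal (G\<^sub>0 / 2) * (ennreal (x powr (p + \<alpha>\<^sub>0)) * indicator {0<..<e} x) \<partial>lborel)"
    by (rule nn_integral_cmult[symmetric]) measurable
  also have "\<dots> \<le> (\<integral>\<^sup>+x. ennreal (G x) * indicator {0<..} x * (ennreal (x powr p) * indicator {0<..1} x) \<partial>lborel)"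
  proof (rule nn_integral_mono)
    fix x
    show "ennreal (G\<^sub>0 / 2) * (ennreal (x powr (p + \<alpha>\<^sub>0)) * indicator {0<..<e} x) \<le>
        ennreal (G x) * indicator {0<..} x * (ennreal (x powr p) * indicator {0<..1} x)"
    proof (cases "x \<in> {0<..<e}")
      case True
      then have x: "0 < x" "x < e0" "x \<le> 1" by (auto simp: e_def)
      have Gx: "G\<^sub>0 / 2 * x powr \<alpha>\<^sub>0 \<le> G x" using e0(2)[OF x(1,2)] x by (simp add: field_simps)
      moreover have "0 \<le> G\<^sub>0 / 2 * x powr \<alpha>\<^sub>0" using G0 by simp
      ultimately have G_nonneg: "0 \<le> G x" by linarith
      have "G\<^sub>0 / 2 * x powr (p + \<alpha>\<^sub>0) = G\<^sub>0 / 2 * x powr \<alpha>\<^sub>0 * x powr p" by (simp add: powr_add)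
      also have "\<dots> \<le> G x * x powr p" by (rule mult_right_mono[OF Gx]) simp
      finally have "ennreal (G\<^sub>0 / 2 * x powr (p + \<alpha>\<^sub>0)) \<le> ennreal (G x * x powr p)" by (rule ennreal_leI)
      moreover have "ennreal (G\<^sub>0 / 2 * x powr (p + \<alpha>\<^sub>0)) = ennreal (G\<^sub>0 / 2) * ennreal (x powr (p + \<alpha>\<^sub>0))"
        by (rule ennreal_mult) (use G0 in simp_all)
      moreover have "ennreal (G x * x powr p) = ennreal (G x) * ennreal (x powr p)"
        by (rule ennreal_mult) (use G_nonneg in simp_all)
      ultimately show ?thesis using True x by simp
    qed simp
  qed
  also have "\<dots> = (\<integral>\<^sup>+x\<in>{0<..1}. ennreal (x powr p) \<partial>\<pi>)"
    unfolding \<pi> by (rule nn_integral_density[symmetric]) measurable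
  also have "\<dots> < \<infinity>" by (rule fin)
  finally show False using G0 by (simp add: ennreal_mult_top)
qed

theorem theorem7:
  fixes \<tau> \<beta> :: "real \<Rightarrow> real" and Q :: "real \<Rightarrow> real measure"
    and P :: "real \<Rightarrow> 'w measure" and X :: "real \<Rightarrow> 'w \<Rightarrow> real" and \<pi> :: "real measure"
    and \<gamma>\<^sub>0 \<gamma>_inf \<nu>\<^sub>0 \<nu>_inf \<beta>\<^sub>0 \<beta>_inf \<tau>\<^sub>0 \<tau>_inf a b :: real
  assumes Q_kernel: "Q \<in> restrict_space borel {0<..} \<rightarrow>\<^sub>M prob_algebra borel"
    and Q_unit: "\<And>x. 0 < x \<Longrightarrow> emeasure (Q x) {0..1} = 1"
    and X: "pdmp_family \<tau> \<beta> Q P X"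
    and A1: "continuous_on {0<..} \<beta>" "continuous_on {0<..} \<tau>"
      "\<And>x. 0 < x \<Longrightarrow> 0 < \<beta> x" "\<And>x. 0 < x \<Longrightarrow> 0 < \<tau> x"
      "local_lipschitz (UNIV :: real set) {0<..} (\<lambda>_. \<tau>)"
      "0 < \<beta>\<^sub>0" "0 < \<beta>_inf" "0 < \<tau>\<^sub>0" "0 < \<tau>_inf"
      "\<beta> \<sim>[at_right 0] (\<lambda>x. \<beta>\<^sub>0 * x powr \<gamma>\<^sub>0)" "\<tau> \<sim>[at_right 0] (\<lambda>x. \<tau>\<^sub>0 * x powr \<nu>\<^sub>0)"
      "\<beta> \<sim>[at_top] (\<lambda>x. \<beta>_inf * x powr \<gamma>_inf)" "\<tau> \<sim>[at_top] (\<lambda>x. \<tau>_inf * x powr \<nu>_inf)"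
    and A2: "0 < a" "0 < b" "moment_sup Q a < 1" "moment_sup Q (- b) < \<infinity>"
      "\<And>x. 0 < x \<Longrightarrow> emeasure (Q x) {1} = 0"
    and A3: "\<gamma>\<^sub>0 > \<nu>\<^sub>0 - 1" "\<gamma>_inf > \<nu>_inf - 1"
    and stationary: "stationary_measure P X \<pi>"
  shows "(b \<ge> \<nu>\<^sub>0 - 1 \<longrightarrow> (\<integral>\<^sup>+x\<in>{0<..1}. ennreal (x powr (\<nu>\<^sub>0 - 1 - b)) \<partial>\<pi>) < \<infinity>) \<and>
    (\<forall>q q\<^sub>0 q\<^sub>1 \<mu>\<^sub>0 \<mu>\<^sub>1 G G\<^sub>0 \<alpha>\<^sub>0 G_inf \<alpha>_inf c \<kappa>.
       fragmentation_density Q q q\<^sub>0 q\<^sub>1 \<mu>\<^sub>0 \<mu>\<^sub>1 \<longrightarrow>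
       stationary_density \<pi> G G\<^sub>0 \<alpha>\<^sub>0 G_inf \<alpha>_inf c \<kappa> \<longrightarrow>
       \<mu>\<^sub>0 + 2 - \<nu>\<^sub>0 > 0 \<longrightarrow> \<alpha>\<^sub>0 \<ge> \<mu>\<^sub>0 + 1 - \<nu>\<^sub>0)"
proof -
  have "continuous_on {0<..} (\<lambda>x. inverse (\<tau> x))"
    using A1(2,4) by (intro continuous_on_inverse) fastforce+
  from ex_antiderivative_half_line[OF this] obtain H where
    H: "\<forall>x>0. (H has_real_derivative inverse (\<tau> x)) (at x)" "\<forall>x\<le>0. H x = 0" by blast
  have "continuous_on {0<..} (\<lambda>x. \<beta> x / \<tau> x)"
    using A1(1,2,4) by (intro continuous_on_divide) fastforce+
  from ex_antiderivative_half_line[OF this] obtain B where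
    B: "\<forall>x>0. (B has_real_derivative \<beta> x / \<tau> x) (at x)" "\<forall>x\<le>0. B x = 0" by blast
  interpret pdmp_stationary \<tau> H \<beta> B Q P X \<pi>
    by unfold_locales (use A1 H B Q_kernel X stationary in auto)
  \<comment> \<open>The exponent \<open>b'\<close> is left free, with \<open>a\<close> kept fixed:
    the second claim needs other values than \<open>b\<close>.\<close>
  have moment: "(\<integral>\<^sup>+x\<in>{0<..1}. ennreal (x powr (\<nu>\<^sub>0 - 1 - b')) \<partial>\<pi>) < \<infinity>"
    if "0 < b'" "moment_sup Q (- b') < \<infinity>" for b'
    by (rule moment_near_zero[OF Q_unit A1(6-13) A3 A2(1) that(1) A2(3) that(2)])
  have exponent: "\<alpha>\<^sub>0 \<ge> \<mu>\<^sub>0 + 1 - \<nu>\<^sub>0"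
    if frag: "fragmentation_density Q q q\<^sub>0 q\<^sub>1 \<mu>\<^sub>0 \<mu>\<^sub>1"
      and dens: "stationary_density \<pi> G G\<^sub>0 \<alpha>\<^sub>0 G_inf \<alpha>_inf c \<kappa>"
    for q q\<^sub>0 q\<^sub>1 \<mu>\<^sub>0 \<mu>\<^sub>1 G G\<^sub>0 \<alpha>\<^sub>0 G_inf \<alpha>_inf c \<kappa>
  proof (rule ccontr)
    assume "\<not> \<alpha>\<^sub>0 \<ge> \<mu>\<^sub>0 + 1 - \<nu>\<^sub>0"
    moreover have "- 1 < \<mu>\<^sub>0" using frag by (simp add: fragmentation_density_def)
    \<comment> \<open>The first entry of the maximum ensures \<open>0 < b'\<close>, the second the
      contradiction: both are below \<open>\<mu>\<^sub>0 + 1\<close>, so the moment for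
      \<open>b'\<close> is finite, which forces
      \<open>b' < \<alpha>\<^sub>0 + \<nu>\<^sub>0\<close>.\<close>
    ultimately obtain b' where b': "0 < b'" "b' < \<mu>\<^sub>0 + 1" "\<alpha>\<^sub>0 + \<nu>\<^sub>0 \<le> b'"
      by (intro that[of "max ((\<mu>\<^sub>0 + 1) / 2) (\<alpha>\<^sub>0 + \<nu>\<^sub>0)"]) (auto simp: less_max_iff_disj)
    have "- 1 < \<nu>\<^sub>0 - 1 - b' + \<alpha>\<^sub>0"
      by (intro stationary_density_exponent[OF dens] moment b' fragmentation_moment_finite[OF frag] prob_Q)
    with b' show False by simp
  qed
  show ?thesis using moment[OF A2(2,4)] exponent by blast
qed

end
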